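(* Let $\mathsf H$, $T$, $V$, $L$, $F=T+V$, the stochastic oracle, the RISFBF process, the errors $U_k,W_k$ and the $\sigma$-algebras $\mathcal F_k$ be as in the context. Assume $\{x:0\in F(x)\}\ne\emptyset$, that $V$ is $\mu$-strongly monotone for some $\mu>0$ (so that $\{x:0\in F(x)\}=\{\bar x\}$), and that there is $\mathtt s>0$ with $\mathbb E[\|U_k\|^2\mid\mathcal F_k]\le\mathtt s^2/m_k$ and $\mathbb E[\|W_k\|^2\mid\mathcal F_k]\le\mathtt s^2/m_k$ $\mathbb P$-a.s. for all $k\ge1$. Consider RISFBF with $X_0=X_1$. Let $0<a,b<1$, $\tilde L^2=L^2+\frac12$ ($\tilde L>0$), $\lambda_k\equiv\lambda$ with $0<\lambda\le\min\{\frac{a}{2\mu},b\mu,\frac{1-a}{2\tilde L}\}$, $\eta=(1-b)\lambda\mu$; let $(\alpha_k)_{k\in\mathbb N}$ be non-decreasing with $0<\alpha_k\le\bar\alpha<1$ and $\rho_k=\frac{(3-a)(1-\alpha_k)^2}{2(2\alpha_k^2-0.5\alpha_k+1)(1+\tilde L\lambda)}$. Put $\rho=\frac{16(3-a)(1-\bar\alpha)^2}{31(1+\tilde L\lambda)}$, $q=1-\rho\eta\in(0,1)$, $\bar\rho=\frac{3-a}{2(1+\tilde L\lambda)}$, $\mathtt B=2\bar\rho\,\mathtt s^2\left(1+\frac{2(3-a)\lambda^2}{1+\tilde L\lambda}\right)$. Let $p\in(0,1)$, $m_k=\lfloor p^{-k}\rfloor$, $\hat p\in(p,1)$, and $$C(p,q)=\frac{2(1-\alpha_1)}{1-\bar\alpha}\|X_1-\bar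 x\|^2+\frac{4\mathtt B}{(1-\bar\alpha)(1-\min\{p/q,q/p\})}\ (p\ne q),\qquad \hat C=\frac{2(1-\alpha_1)}{1-\bar\alpha}\|X_1-\bar x\|^2+\frac{4\mathtt B}{(1-\bar\alpha)\exp(1)\ln(\hat p/q)}\ (p=q).$$ Given $\epsilon>0$, let $K_\epsilon=\inf\{k\in\mathbb N:\mathbb E(\|X_{k+1}-\bar x\|^2)\le\epsilon\}$ and $$\tau_\epsilon(p,q)=\begin{cases}\left\lceil\dfrac{\ln(C(p,q)\epsilon^{-1})}{\ln(1/\max\{p,q\})}\right\rceil&\text{if }p\ne q,\\[2ex]\left\lceil\dfrac{\ln(\hat C\epsilon^{-1})}{\ln(1/\hat p)}\right\rceil&\text{if }p=q.\end{cases}$$ Then $K_\epsilon\le\tau_\epsilon(p,q)=\mathcal O(\ln(\epsilon^{-1}))$. The corresponding oracle complexity of RISFBF (total number of samples drawn) is upper bounded as $$2\sum_{i=1}^{\tau_\epsilon(p,q)}m_i=\mathcal O\left((1/\epsilon)^{1+\delta(p,q)}\right),\qquad\delta(p,q)=\begin{cases}0&\text{if }p>q,\\\frac{\ln p}{\ln q}-1&\text{if }p\in(0,q),\\\frac{\ln p}{\ln\hat p}-1&\text{if }p=q.\end{cases}$$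
   Context: $\mathsf H$ is a real separable Hilbert space with inner product $\langle\cdot,\cdot\rangle$ and norm $\|\cdot\|$. $T:\mathsf H\to2^{\mathsf H}$ is maximally monotone; $V:\mathsf H\to\mathsf H$ is maximally monotone and $L$-Lipschitz continuous ($L>0$) with full domain. $F=T+V$ and $J_{\lambda T}=(\mathrm{Id}+\lambda T)^{-1}$ is the resolvent. $V$ is $\mu$-strongly monotone if $\langle V(x)-V(y),x-y\rangle\ge\mu\|x-y\|^2$ for all $x,y\in\mathsf H$. Oracle: on a complete probability space $(\Omega,\mathcal F,\mathbb P)$, $\xi$ is a random variable with values in a measurable set $\Xi\subseteq\mathbb R^d$ and law $\mathsf P$; $\hat V:\mathsf H\times\Xi\to\mathsf H$ is a (measurable) random operator estimating $V$. RISFBF algorithm: given initial points $X_0,X_1\in\operatorname{dom}T$, nonnegative sequences $(\alpha_k)$, $(\rho_k)$, step sizes $\lambda_k>0$ and batch sizes $m_k\in\mathbb N$, $m_k\geq 1$, for $k\ge1$: $Z_k=X_k+\alpha_k(X_k-X_{k-1})$; $Y_k=J_{\lambda_kT}(Z_k-\lambda_kA_k)$ with $A_k=\frac1{m_k}\sum_{t=1}^{m_k}\hat V(Z_k,\xi_k^{(t)})$; $X_{k+1}=(1-\rho_k)Z_k+\rho_k[Y_k+\lambda_k(A_k-B_k)]$ with $B_k=\frac1{m_k}\sum_{t=1}^{m_k}\hat V(Y_k,\eta_k^{(t)})$; where the samples $\xi_k=(\xi_k^{(t)})_t$, $\eta_k=(\eta_k^{(t)})_t$ are independent draws from $\mathsf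 P$ (so iteration $k$ uses $2m_k$ samples). Errors: $U_k=A_k-V(Z_k)$, $W_k=B_k-V(Y_k)$. Filtration: $\mathcal F_0=\mathcal F_1=\sigma(X_0,X_1)$ and $\mathcal F_{k+1}=\sigma(X_0,X_1,\xi_1,\eta_1,\dots,\xi_k,\eta_k)$ for $k\ge1$. The $\mathcal O$-notation refers to $\epsilon\downarrow0$ with all other parameters fixed. *)

theory Defs
  imports "HOL-Probability.Probability"
begin

text \<open>Set-valued operators on a Hilbert space are functions \<^typ>\<open>'h \<Rightarrow> 'h set\<close>.\<close>

definition monotone_operator :: "('h::real_inner \<Rightarrow> 'h set) \<Rightarrow> bool" where
  "monotone_operator T \<longleftrightarrow>
     (\<forall>x y. \<forall>u\<in>T x. \<forall>v\<in>T y. 0 \<le> inner (u - v) (x - y))"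

definition maximally_monotone :: "('h::real_inner \<Rightarrow> 'h set) \<Rightarrow> bool" where
  "maximally_monotone T \<longleftrightarrow> monotone_operator T \<and>
     (\<forall>S. monotone_operator S \<and> (\<forall>x. T x \<subseteq> S x) \<longrightarrow> S = T)"

definition strongly_monotone :: "real \<Rightarrow> ('h::real_inner \<Rightarrow> 'h) \<Rightarrow> bool" where
  "strongly_monotone \<mu> V \<longleftrightarrow>
     (\<forall>x y. \<mu> * (norm (x - y))\<^sup>2 \<le> inner (V x - V y) (x - y))"

definition op_dom :: "('h \<Rightarrow> 'h set) \<Rightarrow> 'h set" where
  "op_dom T = {x. T x \<noteq> {}}"

definition op_sum :: "('h::real_vector \<Rightarrow> 'h set) \<Rightarrow> ('h \<Rightarrow> 'h) \<Rightarrow> 'h \<Rightarrow> 'h set" where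
  "op_sum T V x = {u + V x | u. u \<in> T x}"

definition op_zeros :: "('h::real_vector \<Rightarrow> 'h set) \<Rightarrow> 'h set" where
  "op_zeros F = {x. 0 \<in> F x}"

text \<open>The resolvent is the inverse, as a set-valued operator, of \<open>Id + lam T\<close>. For maximally monotone
  \<open>T\<close> and \<open>lam > 0\<close> its values are singletons (Minty), so that \<open>y = J(z)\<close> means
  \<open>y \<in> resolvent lam T z\<close>.\<close>

definition resolvent :: "real \<Rightarrow> ('h::real_vector \<Rightarrow> 'h set) \<Rightarrow> 'h \<Rightarrow> 'h set" where
  "resolvent lam T z = {y. \<exists>u\<in>T y. z = y + lam *\<^sub>R u}"

definition stochastic_oracle ::
  "'d set \<Rightarrow> 'd measure \<Rightarrow> ('h::real_normed_vector \<Rightarrow> 'd::euclidean_space \<Rightarrow> 'h) \<Rightarrow> bool" where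
  "stochastic_oracle \<Xi> P Vhat \<longleftrightarrow>
     \<Xi> \<in> sets borel \<and> prob_space P \<and> sets P = sets (restrict_space borel \<Xi>) \<and>
     (\<lambda>(x, z). Vhat x z) \<in> borel_measurable (borel \<Otimes>\<^sub>M restrict_space borel \<Xi>)"

text \<open>\<open>\<xi> k t\<close> and \<open>\<eta> k t\<close> are the \<open>t\<close>-th samples of the two batches of iteration \<open>k\<close>. In the index
  set, the first component distinguishes the two batches.\<close>

definition iid_samples ::
  "'w measure \<Rightarrow> 'd measure \<Rightarrow> (nat \<Rightarrow> nat) \<Rightarrow>
   (nat \<Rightarrow> nat \<Rightarrow> 'w \<Rightarrow> 'd) \<Rightarrow> (nat \<Rightarrow> nat \<Rightarrow> 'w \<Rightarrow> 'd) \<Rightarrow> bool" where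
  "iid_samples M P m \<xi> \<eta> \<longleftrightarrow>
     (\<forall>k\<ge>1. \<forall>t\<in>{1..m k}. \<xi> k t \<in> M \<rightarrow>\<^sub>M P \<and> distr M P (\<xi> k t) = P \<and>
                          \<eta> k t \<in> M \<rightarrow>\<^sub>M P \<and> distr M P (\<eta> k t) = P) \<and>
     prob_space.indep_vars M (\<lambda>_. P)
       (\<lambda>(first, k, t). if first then \<xi> k t else \<eta> k t)
       {(first, k, t). 1 \<le> k \<and> t \<in> {1..m k}}"

definition batch_mean ::
  "('h::real_vector \<Rightarrow> 'd \<Rightarrow> 'h) \<Rightarrow> nat \<Rightarrow> (nat \<Rightarrow> 'w \<Rightarrow> 'd) \<Rightarrow> ('w \<Rightarrow> 'h) \<Rightarrow> 'w \<Rightarrow> 'h" where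
  "batch_mean Vhat n \<zeta> Q \<omega> = (1 / real n) *\<^sub>R (\<Sum>t = 1..n. Vhat (Q \<omega>) (\<zeta> t \<omega>))"

definition RISFBF ::
  "'w measure \<Rightarrow> ('h::real_inner \<Rightarrow> 'h set) \<Rightarrow> ('h \<Rightarrow> 'd \<Rightarrow> 'h) \<Rightarrow>
   (nat \<Rightarrow> real) \<Rightarrow> (nat \<Rightarrow> real) \<Rightarrow> (nat \<Rightarrow> real) \<Rightarrow> (nat \<Rightarrow> nat) \<Rightarrow>
   (nat \<Rightarrow> nat \<Rightarrow> 'w \<Rightarrow> 'd) \<Rightarrow> (nat \<Rightarrow> nat \<Rightarrow> 'w \<Rightarrow> 'd) \<Rightarrow> 'h \<Rightarrow> 'h \<Rightarrow>
   (nat \<Rightarrow> 'w \<Rightarrow> 'h) \<Rightarrow> (nat \<Rightarrow> 'w \<Rightarrow> 'h) \<Rightarrow> (nat \<Rightarrow> 'w \<Rightarrow> 'h) \<Rightarrow>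
   (nat \<Rightarrow> 'w \<Rightarrow> 'h) \<Rightarrow> (nat \<Rightarrow> 'w \<Rightarrow> 'h) \<Rightarrow> bool" where
  "RISFBF M T Vhat \<alpha> \<rho> lam m \<xi> \<eta> x0 x1 X Y Z A B \<longleftrightarrow>
     x0 \<in> op_dom T \<and> x1 \<in> op_dom T \<and>
     (\<forall>k\<ge>1. 0 \<le> \<alpha> k \<and> 0 \<le> \<rho> k \<and> 0 < lam k \<and> 1 \<le> m k) \<and>
     (\<forall>\<omega>\<in>space M. X 0 \<omega> = x0 \<and> X 1 \<omega> = x1 \<and>
       (\<forall>k\<ge>1.
          Z k \<omega> = X k \<omega> + \<alpha> k *\<^sub>R (X k \<omega> - X (k - 1) \<omega>) \<and>
          A k \<omega> = batch_mean Vhat (m k) (\<xi> k) (Z k) \<omega> \<and>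
          Y k \<omega> \<in> resolvent (lam k) T (Z k \<omega> - lam k *\<^sub>R A k \<omega>) \<and>
          B k \<omega> = batch_mean Vhat (m k) (\<eta> k) (Y k) \<omega> \<and>
          X (k + 1) \<omega> = (1 - \<rho> k) *\<^sub>R Z k \<omega>
                        + \<rho> k *\<^sub>R (Y k \<omega> + lam k *\<^sub>R (A k \<omega> - B k \<omega>))))"

text \<open>For \<open>k \<le> 1\<close> no samples enter, so \<open>RISFBF_filtration\<close> at \<open>0\<close> and \<open>1\<close> is the \<open>\<sigma>\<close>-algebra
  generated by \<open>X 0\<close> and \<open>X 1\<close>; at \<open>k + 1\<close> the samples of the iterations \<open>1, \<dots>, k\<close> enter.\<close>

definition RISFBF_filtration ::
  "'w measure \<Rightarrow> 'd measure \<Rightarrow> (nat \<Rightarrow> nat) \<Rightarrow> (nat \<Rightarrow> nat \<Rightarrow> 'w \<Rightarrow> 'd) \<Rightarrow>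
   (nat \<Rightarrow> nat \<Rightarrow> 'w \<Rightarrow> 'd) \<Rightarrow> (nat \<Rightarrow> 'w \<Rightarrow> 'h::topological_space) \<Rightarrow> nat \<Rightarrow> 'w measure" where
  "RISFBF_filtration M P m \<xi> \<eta> X k = sigma (space M)
     ({X i -` S \<inter> space M | i S. i \<le> 1 \<and> S \<in> sets borel} \<union>
      {\<xi> j t -` S \<inter> space M | j t S. 1 \<le> j \<and> j < k \<and> t \<in> {1..m j} \<and> S \<in> sets P} \<union>
      {\<eta> j t -` S \<inter> space M | j t S. 1 \<le> j \<and> j < k \<and> t \<in> {1..m j} \<and> S \<in> sets P})"

text \<open>The infimum is taken in \<^typ>\<open>enat\<close> so that it is \<open>\<infinity>\<close> if no index qualifies, and the
  expectation is a nonnegative integral, so that it is \<open>\<infinity>\<close> (not \<open>0\<close>) for a non-integrable variable.\<close>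

definition hitting_index ::
  "'w measure \<Rightarrow> (nat \<Rightarrow> 'w \<Rightarrow> 'h::real_normed_vector) \<Rightarrow> 'h \<Rightarrow> real \<Rightarrow> enat" where
  "hitting_index M X xbar \<epsilon> =
     (INF k \<in> {k. (\<integral>\<^sup>+ \<omega>. ennreal ((norm (X (k + 1) \<omega> - xbar))\<^sup>2) \<partial>M) \<le> ennreal \<epsilon>}. enat k)"

end

theory Submission
  imports Defs "HOL-Library.Landau_Symbols"
begin

text \<open>
  Let \<open>w\<^sub>k = X\<^sub>k - xbar + S\<^sub>k v\<^sub>k\<close> with \<open>v\<^sub>k = X\<^sub>k - X\<^sub>k\<^sub>-\<^sub>1\<close> and \<open>S\<^sub>k = \<alpha>\<^sub>k / (1 - \<alpha>\<^sub>k)\<close>. Strong monotonicity makes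
  one step contract \<open>\<parallel>w\<parallel>\<^sup>2 + Q \<parallel>v\<parallel>\<^sup>2\<close> by the factor \<open>q\<^sup>G\<close>, where \<open>G > 1\<close> because only the worst case \<open>\<alpha>\<^sub>k = \<alpha>bar\<close> and
  crude constants enter \<open>q\<close>. Passing from \<open>\<alpha>\<^sub>k\<close> to \<open>\<alpha>\<^sub>k\<^sub>+\<^sub>1\<close> changes the quadratic form and costs a factor
  \<open>(g\<^sub>k\<^sub>+\<^sub>1 / g\<^sub>k)\<^sup>x\<close> with \<open>g = 1 / (1 - \<alpha>)\<close>. A sudden increase of \<open>\<alpha>\<close> may therefore destroy the rate \<open>q\<^sup>k\<close> at a
  single \<open>k\<close>, but only the first passage matters: at the index \<open>n \<le> k\<close> minimising
  \<open>q\<^sup>(\<^sup>G\<^sup>-\<^sup>1\<^sup>)\<^sup>n g\<^sub>n\<^sup>h\<close>, for a suitable exponent \<open>h\<close>, the surplus \<open>q\<^sup>G\<^sup>-\<^sup>1\<close> has paid for all earlier increases, and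
  \<open>E \<parallel>X\<^sub>n\<^sub>+\<^sub>1 - xbar\<parallel>\<^sup>2\<close> is below the claimed bound for \<open>k\<close>.

  The constants (\<open>\<kappa>\<close>, \<open>x\<close> and others) depend on \<open>m = lam \<mu> \<in> (0, 1/4]\<close>. Five ranges of \<open>m\<close> with one
  choice each suffice, and what they have to satisfy are polynomial inequalities in one variable.
\<close>

section \<open>Nonnegativity certificates for univariate polynomials\<close>

text \<open>The claimed bound at \<open>k\<close> contains only the first power of
  \<open>(1 - \<alpha> 1) / (1 - \<alpha>bar)\<close>, whereas the Lyapunov function loses the power
  \<open>x\<close>, about 3, over the same increase of \<alpha>. The surplus \<open>G > 1\<close>
  has to make up for the difference. This surplus has one source. In the expansion of a step, strong
  monotonicity yields \<open>2 * m\<close> times a squared distance, while \<open>q\<close> uses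
  only \<open>(1 - b) * m\<close>. The drift is taken as \<open>\<sigma> * m\<close> with
  \<open>\<sigma> = \<sigma>0 * (1 - b)\<close> and \<open>\<sigma>0\<close> at least 6/5; the rest
  of \<open>2 * m\<close> pays for a cross term that this drift creates (share \<open>d\<close>) and
  for the noise of the second batch. A larger \<kappa> gives the velocity more weight, which makes
  the return from the Lyapunov function to the norm cheaper (exponent \<open>v\<close>), but it uses
  up the coefficient \<open>Sl\<close> that absorbs the remaining noise. These demands conflict, and
  their balance shifts with \<open>m\<close>; this is why the constants are chosen range by
  range.\<close>

primrec pev :: "real list \<Rightarrow> real \<Rightarrow> real" where
  "pev [] t = 0"
| "pev (c # cs) t = c + t * pev cs t"

fun padd :: "real list \<Rightarrow> real list \<Rightarrow> real list" where
  "padd [] ys = ys"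
| "padd xs [] = xs"
| "padd (x # xs) (y # ys) = (x + y) # padd xs ys"

primrec pscale :: "real \<Rightarrow> real list \<Rightarrow> real list" where
  "pscale a [] = []"
| "pscale a (c # cs) = a * c # pscale a cs"

primrec pmul :: "real list \<Rightarrow> real list \<Rightarrow> real list" where
  "pmul [] ys = []"
| "pmul (x # xs) ys = padd (pscale x ys) (0 # pmul xs ys)"

primrec shift_step :: "real \<Rightarrow> real list \<Rightarrow> real list" where
  "shift_step c [] = [c]"
| "shift_step c (d # ds) = (c + d) # shift_step d ds"

primrec taylor_shift :: "real list \<Rightarrow> real list" where
  "taylor_shift [] = []"
| "taylor_shift (c # cs) = shift_step c (taylor_shift cs)"

text \<open>Horner's scheme run on lower bounds: for t in [0, 1] multiplication by t only moves a
  value towards 0, so \<open>min 0\<close> of a lower bound is again one.\<close>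

primrec horner_lb :: "real list \<Rightarrow> real" where
  "horner_lb [] = 0"
| "horner_lb (c # cs) = c + min 0 (horner_lb cs)"

text \<open>Covers [0, n] by unit intervals, each moved to [0, 1] by a Taylor shift. The tests are
  rational arithmetic on coefficients, which the simplifier can carry out.\<close>

primrec nonneg_upto :: "nat \<Rightarrow> real list \<Rightarrow> bool" where
  "nonneg_upto 0 cs \<longleftrightarrow> True"
| "nonneg_upto (Suc n) cs \<longleftrightarrow> 0 \<le> horner_lb cs \<and> nonneg_upto n (taylor_shift cs)"

text \<open>After \<open>n\<close> shifts, nonnegative coefficients settle the unbounded rest of the
  half-line.\<close>

primrec nonneg_beyond :: "nat \<Rightarrow> real list \<Rightarrow> bool" where
  "nonneg_beyond 0 cs \<longleftrightarrow> list_all (\<lambda>c. 0 \<le> c) cs"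
| "nonneg_beyond (Suc n) cs \<longleftrightarrow> 0 \<le> horner_lb cs \<and> nonneg_beyond n (taylor_shift cs)"

lemma pev_padd: "pev (padd xs ys) t = pev xs t + pev ys t"
  by (induction xs ys rule: padd.induct) (auto simp: algebra_simps)

lemma pev_pscale: "pev (pscale a xs) t = a * pev xs t"
  by (induction xs) (auto simp: algebra_simps)

lemma pev_pmul: "pev (pmul xs ys) t = pev xs t * pev ys t"
  by (induction xs) (auto simp: pev_padd pev_pscale algebra_simps)

lemma pev_shift_step: "pev (shift_step c ds) t = c + (t + 1) * pev ds t"
  by (induction ds arbitrary: c) (auto simp: algebra_simps)

lemma pev_taylor_shift: "pev (taylor_shift cs) t = pev cs (t + 1)"
  by (induction cs) (auto simp: pev_shift_step)

lemma horner_lb_le: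
  assumes "0 \<le> t" "t \<le> 1"
  shows "horner_lb cs \<le> pev cs t"
proof (induction cs)
  case (Cons c cs)
  have "min 0 (horner_lb cs) \<le> t * pev cs t"
  proof (cases "pev cs t \<ge> 0")
    case True
    then show ?thesis using assms by (simp add: min_le_iff_disj)
  next
    case False
    have "pev cs t \<le> t * pev cs t" using False assms
      by (metis linorder_not_le mult.commute mult_left_mono_neg mult.right_neutral less_eq_real_def)
    then show ?thesis using Cons.IH by linarith
  qed
  then show ?case by simp
qed simp

lemma nonneg_upto:
  assumes "nonneg_upto n cs" "0 \<le> t" "t \<le> real n" "0 < n"
  shows "0 \<le> pev cs t"
  using assms
proof (induction n arbitrary: cs t)
  case (Suc n)
  show ?case
  proof (cases "t \<le> 1")
    case True
    have "horner_lb cs \<le> pev cs t" by (rule horner_lb_le) (use Suc True in auto)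
    then show ?thesis using Suc.prems(1) by simp
  next
    case False
    have "0 \<le> pev (taylor_shift cs) (t - 1)"
      by (rule Suc.IH) (use Suc.prems False in \<open>auto simp: Let_def intro: Nat.gr0I\<close>)
    then show ?thesis by (simp add: pev_taylor_shift)
  qed
qed simp

lemma nonneg_beyond:
  assumes "nonneg_beyond n cs" "0 \<le> t"
  shows "0 \<le> pev cs t"
  using assms
proof (induction n arbitrary: cs t)
  case 0
  from 0(1) have "list_all (\<lambda>c. 0 \<le> c) cs" by simp
  then show ?case using 0(2) by (induction cs) auto
next
  case (Suc n)
  show ?case
  proof (cases "t \<le> 1")
    case True
    have "horner_lb cs \<le> pev cs t" by (rule horner_lb_le) (use Suc True in auto)
    then show ?thesis using Suc.prems(1) by simp
  next
    case False
    have "0 \<le> pev (taylor_shift cs) (t - 1)"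
      by (rule Suc.IH) (use Suc.prems False in \<open>auto simp: Let_def\<close>)
    then show ?thesis by (simp add: pev_taylor_shift)
  qed
qed

primrec ppow :: "real list \<Rightarrow> nat \<Rightarrow> real list" where
  "ppow xs 0 = [1]"
| "ppow xs (Suc n) = pmul xs (ppow xs n)"

lemma pev_ppow: "pev (ppow xs n) t = pev xs t ^ n"
  by (induction n) (auto simp: pev_pmul)

definition psub :: "real list \<Rightarrow> real list \<Rightarrow> real list" where
  "psub xs ys = padd xs (pscale (- 1) ys)"

lemma pev_psub: "pev (psub xs ys) t = pev xs t - pev ys t"
  by (simp add: psub_def pev_padd pev_pscale)

section \<open>Admissible constants\<close>

text \<open>Over \<open>l \<in> {m..1/2 - m}\<close> the noise condition is concave in \<open>1 / (1 + l)\<close>, so only the end points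
  matter. The polynomials \<open>left_\<dots>\<close> and \<open>right_\<dots>\<close> below belong to \<open>l = m\<close>, with denominators cleared, and to
  \<open>l = 1/2 - m\<close>. The suffixes \<open>mid\<close> and \<open>end\<close> refer to \<open>b = 3/20\<close> and \<open>b = 1\<close>.\<close>

definition left_slack :: "real \<Rightarrow> real \<Rightarrow> real \<Rightarrow> real \<Rightarrow> real" where
  "left_slack m s \<kappa> d =
     (2 - (2 + s) * m) * (1 + m) - (1 + \<kappa>) * ((3 / 2 - m) * (1 - m) ^ 2) - s ^ 2 / d * (m ^ 3
     * (1 + m))"

definition left_slack_poly :: "real list \<Rightarrow> real \<Rightarrow> real \<Rightarrow> real \<Rightarrow> real list" where
  "left_slack_poly M s \<kappa> d =
     psub (psub (pmul (psub [2] (pscale (2 + s) M)) (padd [1] M)) (pscale (1 + \<kappa>) (pmul (psub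
     [3 / 2] M) (ppow (psub [1] M) 2)))) (pscale (s ^ 2 / d) (pmul (ppow M 3) (padd [1] M)))"

definition left_cross :: "real \<Rightarrow> real \<Rightarrow> real" where
  "left_cross m \<kappa> =
     ((1 + \<kappa>) * ((3 / 2 - m) * m)) ^ 2 + ((1 + \<kappa>) * (3 / 2 - m) - 1 - m) ^ 2"

definition left_cross_poly :: "real list \<Rightarrow> real \<Rightarrow> real list" where
  "left_cross_poly M \<kappa> =
     padd (ppow (pscale (1 + \<kappa>) (pmul (psub [3 / 2] M) M)) 2) (ppow (psub (psub (pscale (1 +
     \<kappa>) (psub [3 / 2] M)) [1]) M) 2)"

text \<open>At \<open>b = 3/20\<close> one has \<open>4 * b = 3/5\<close> and
  \<open>2 * b - b^2 = 111/400\<close>; the powers of \<open>1 - b\<close> in the noise terms are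
  bounded by 1. At \<open>b = 1\<close> these terms vanish, which makes \<open>left_end\<close>
  shorter.\<close>

definition left_mid :: "real \<Rightarrow> real \<Rightarrow> real \<Rightarrow> real \<Rightarrow> real \<Rightarrow> real" where
  "left_mid m s \<kappa> d T =
     T * ((left_slack m s \<kappa> d + (3 / 20 * s * m + 111 / 400 * (s ^ 2 / d) * m ^ 3) * (1 + m))
     * (1 + m)) - 3 / 5 * (m * (left_cross m \<kappa> + 2 * (1 + \<kappa>) * (s ^ 2 / d) * ((3 / 2 -
     m) * (m ^ 3 * (1 + m))) + (s ^ 2 / d) ^ 2 * (m ^ 4 * (1 + m) ^ 2)))"

definition left_mid_poly :: "real list \<Rightarrow> real \<Rightarrow> real \<Rightarrow> real \<Rightarrow> real \<Rightarrow> real list" where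
  "left_mid_poly M s \<kappa> d T =
     psub (pscale T (pmul (padd (left_slack_poly M s \<kappa> d) (pmul (padd (pscale (3 / 20 * s) M)
     (pscale (111 / 400 * (s ^ 2 / d)) (ppow M 3))) (padd [1] M))) (padd [1] M))) (pscale (3 / 5)
     (pmul M (padd (padd (left_cross_poly M \<kappa>) (pscale (2 * (1 + \<kappa>) * (s ^ 2 / d))
     (pmul (psub [3 / 2] M) (pmul (ppow M 3) (padd [1] M))))) (pscale ((s ^ 2 / d) ^ 2) (pmul (ppow M
     4) (ppow (padd [1] M) 2))))))"

definition left_end :: "real \<Rightarrow> real \<Rightarrow> real \<Rightarrow> real \<Rightarrow> real \<Rightarrow> real" where
  "left_end m s \<kappa> d T =
     T * ((left_slack m s \<kappa> d + (s * m + s ^ 2 / d * m ^ 3) * (1 + m)) * (1 + m)) - 4 * (m *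
     left_cross m \<kappa>)"

definition left_end_poly :: "real list \<Rightarrow> real \<Rightarrow> real \<Rightarrow> real \<Rightarrow> real \<Rightarrow> real list" where
  "left_end_poly M s \<kappa> d T =
     psub (pscale T (pmul (padd (left_slack_poly M s \<kappa> d) (pmul (padd (pscale s M) (pscale (s
     ^ 2 / d) (ppow M 3))) (padd [1] M))) (padd [1] M))) (pscale 4 (pmul M (left_cross_poly M
     \<kappa>)))"

text \<open>At \<open>l = 1/2 - m\<close> the factor \<open>3/2 - m\<close> equals
  \<open>1 + l\<close>, so the quotient \<open>p / (1 + l)\<close> is just
  \<open>1 + \<kappa>\<close> and no denominator has to be cleared.\<close>

definition right_slack :: "real \<Rightarrow> real \<Rightarrow> real \<Rightarrow> real \<Rightarrow> real" where
  "right_slack m s \<kappa> d =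
     2 - (2 + s) * m - (1 + \<kappa>) * (5 / 4 - 3 * m + m ^ 2) - s ^ 2 / d * (m * (1 / 2 - m) ^ 2)"

definition right_slack_poly :: "real list \<Rightarrow> real \<Rightarrow> real \<Rightarrow> real \<Rightarrow> real list" where
  "right_slack_poly M s \<kappa> d =
     psub (psub (psub [2] (pscale (2 + s) M)) (pscale (1 + \<kappa>) (padd (psub [5 / 4] (pscale 3
     M)) (ppow M 2)))) (pscale (s ^ 2 / d) (pmul M (ppow (psub [1 / 2] M) 2)))"

definition right_cross :: "real \<Rightarrow> real \<Rightarrow> real" where
  "right_cross m \<kappa> =
     ((1 + \<kappa>) * (1 / 2 - m)) ^ 2 + \<kappa> ^ 2"

definition right_cross_poly :: "real list \<Rightarrow> real \<Rightarrow> real list" where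
  "right_cross_poly M \<kappa> =
     padd (ppow (pscale (1 + \<kappa>) (psub [1 / 2] M)) 2) [\<kappa> ^ 2]"

definition right_mid :: "real \<Rightarrow> real \<Rightarrow> real \<Rightarrow> real \<Rightarrow> real \<Rightarrow> real" where
  "right_mid m s \<kappa> d T =
     T * (right_slack m s \<kappa> d + 3 / 20 * s * m + 111 / 400 * (s ^ 2 / d) * (m * (1 / 2 - m) ^
     2)) - 3 / 5 * (m * (right_cross m \<kappa> + 2 * (1 + \<kappa>) * (s ^ 2 / d) * (m * (1 / 2 - m)
     ^ 2) + (s ^ 2 / d) ^ 2 * (m ^ 2 * (1 / 2 - m) ^ 2)))"

definition right_mid_poly :: "real list \<Rightarrow> real \<Rightarrow> real \<Rightarrow> real \<Rightarrow> real \<Rightarrow> real list" where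
  "right_mid_poly M s \<kappa> d T =
     psub (pscale T (padd (padd (right_slack_poly M s \<kappa> d) (pscale (3 / 20 * s) M)) (pscale
     (111 / 400 * (s ^ 2 / d)) (pmul M (ppow (psub [1 / 2] M) 2))))) (pscale (3 / 5) (pmul M (padd
     (padd (right_cross_poly M \<kappa>) (pscale (2 * (1 + \<kappa>) * (s ^ 2 / d)) (pmul M (ppow
     (psub [1 / 2] M) 2)))) (pscale ((s ^ 2 / d) ^ 2) (pmul (ppow M 2) (ppow (psub [1 / 2] M) 2))))))"

definition right_end :: "real \<Rightarrow> real \<Rightarrow> real \<Rightarrow> real \<Rightarrow> real \<Rightarrow> real" where
  "right_end m s \<kappa> d T =
     T * (right_slack m s \<kappa> d + s * m + s ^ 2 / d * (m * (1 / 2 - m) ^ 2)) - 4 * (m *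
     right_cross m \<kappa>)"

definition right_end_poly :: "real list \<Rightarrow> real \<Rightarrow> real \<Rightarrow> real \<Rightarrow> real \<Rightarrow> real list" where
  "right_end_poly M s \<kappa> d T =
     psub (pscale T (padd (padd (right_slack_poly M s \<kappa> d) (pscale s M)) (pscale (s ^ 2 / d)
     (pmul M (ppow (psub [1 / 2] M) 2))))) (pscale 4 (pmul M (right_cross_poly M \<kappa>)))"

text \<open>Expresses that the velocity terms lost in \<open>lyapunov_contraction\<close> fit into
  the reserve \<open>\<kappa> * (2 + 5 * S) / 4\<close> with
  \<open>S = \<alpha> / (1 - \<alpha>)\<close>, after denominators are cleared;
  \<open>1/2 + 3/4 * \<alpha>\<close> is this reserve divided by \<kappa> and multiplied by
  \<open>1 - \<alpha>\<close>.\<close>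

definition rate_gap :: "real \<Rightarrow> real \<Rightarrow> real \<Rightarrow> real" where
  "rate_gap \<alpha> \<kappa> y =
     \<kappa> * ((2 * \<alpha> ^ 2 - 1 / 2 * \<alpha> + 1) * (1 / 2 + 3 / 4 * \<alpha>)) - y * ((1 -
     1 / 5 * \<alpha> ^ 2) * (\<alpha> ^ 2 + \<kappa> * (1 + 1 / 4 * \<alpha>) - \<kappa> / 2 * (1 -
     \<alpha>) ^ 2) + 5 * \<alpha> ^ 2 - \<alpha> ^ 4)"

definition rate_gap_poly :: "real list \<Rightarrow> real \<Rightarrow> real \<Rightarrow> real list" where
  "rate_gap_poly A \<kappa> y =
     psub (pscale \<kappa> (pmul (padd (psub (pscale 2 (ppow A 2)) (pscale (1 / 2) A)) [1]) (padd [1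
     / 2] (pscale (3 / 4) A)))) (pscale y (psub (padd (pmul (psub [1] (pscale (1 / 5) (ppow A 2)))
     (psub (padd (ppow A 2) (pscale \<kappa> (padd [1] (pscale (1 / 4) A)))) (pscale (\<kappa> / 2)
     (ppow (psub [1] A) 2)))) (pscale 5 (ppow A 2))) (ppow A 4)))"

text \<open>Here \<open>693/1000\<close> stands for \<open>ln 2\<close>.\<close>

definition drift_gap :: "real \<Rightarrow> real \<Rightarrow> real \<Rightarrow> real" where
  "drift_gap \<alpha> s r =
     31 / 32 * s * ((1 - 1 / 5 * \<alpha> ^ 2) * (\<alpha> * (6 - 5 * \<alpha>) + 693 / 1000 * ((1 -
     \<alpha>) * (6 - 2 * \<alpha>)))) - r * (\<alpha> * (6 - 5 * \<alpha>) * ((2 * \<alpha> ^ 2 - 1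
     / 2 * \<alpha> + 1) * (1 - \<alpha>)))"

definition drift_gap_poly :: "real list \<Rightarrow> real \<Rightarrow> real \<Rightarrow> real list" where
  "drift_gap_poly A s r =
     psub (pscale (31 / 32 * s) (pmul (psub [1] (pscale (1 / 5) (ppow A 2))) (padd (pmul A (psub [6]
     (pscale 5 A))) (pscale (693 / 1000) (pmul (psub [1] A) (psub [6] (pscale 2 A))))))) (pscale r
     (pmul (pmul A (psub [6] (pscale 5 A))) (pmul (padd (psub (pscale 2 (ppow A 2)) (pscale (1 / 2)
     A)) [1]) (psub [1] A))))"

text \<open>This velocity weight is forced: with \<open>g = 1 + h = 1 / (1 - \<alpha>)\<close> it is
  the \<open>Q\<close> for which \<open>(\<alpha>^2 + \<alpha> + \<kappa> * (1 + \<alpha> / 4)) *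
  g^2 = g^2 - g + Q\<close>.\<close>

definition potential :: "real \<Rightarrow> real \<Rightarrow> real" where
  "potential h \<kappa> =
     h ^ 2 + \<kappa> / 4 * (5 * (1 + h) ^ 2 - (1 + h))"

definition potential_poly :: "real list \<Rightarrow> real \<Rightarrow> real list" where
  "potential_poly H \<kappa> =
     padd (ppow H 2) (pscale (\<kappa> / 4) (psub (pscale 5 (ppow (padd [1] H) 2)) (padd [1] H)))"

text \<open>The cleared form of \<open>ln (1 + h^2 / Q) \<le> v * ln (1 + h)\<close> for
  \<open>Q = potential h \<kappa>\<close>, with the left logarithm replaced by a Pade upper bound
  and the right one by a Pade lower bound.\<close>

definition lift_gap :: "real \<Rightarrow> real \<Rightarrow> real \<Rightarrow> real" where
  "lift_gap h \<kappa> v =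
     3 * v * (h * (2 + h) * (potential h \<kappa> * (6 * potential h \<kappa> + 4 * h ^ 2))) - h ^ 2
     * ((6 * potential h \<kappa> + h ^ 2) * ((1 + h) ^ 2 + 4 * (1 + h) + 1))"

definition lift_gap_poly :: "real list \<Rightarrow> real \<Rightarrow> real \<Rightarrow> real list" where
  "lift_gap_poly H \<kappa> v =
     psub (pscale (3 * v) (pmul (pmul H (padd [2] H)) (pmul (potential_poly H \<kappa>) (padd (pscale
     6 (potential_poly H \<kappa>)) (pscale 4 (ppow H 2)))))) (pmul (ppow H 2) (pmul (padd (pscale 6
     (potential_poly H \<kappa>)) (ppow H 2)) (padd (padd (ppow (padd [1] H) 2) (pscale 4 (padd [1]
     H))) [1])))"

text \<open>With \<open>N = (1 + t)\<^sup>e\<close> and \<open>D = f + (1 - f) (1 + t)\<close> the factor \<open>y = N / D \<le> (1 + t)\<^sup>e\<^sup>-\<^sup>1\<^sup>+\<^sup>f\<close> turns the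
  discriminant condition in \<open>jump_condition\<close> below into a quadratic polynomial in \<open>h\<close>, with coefficients
  \<open>jump0\<close>, \<open>jump1\<close>, \<open>jump2\<close>.\<close>

definition jump0 :: "real \<Rightarrow> real \<Rightarrow> real \<Rightarrow> nat \<Rightarrow> real" where
  "jump0 t \<kappa> f e =
     ((1 + t) ^ e - (f + (1 - f) * (1 + t))) * (\<kappa> * (1 + t) ^ e - (f + (1 - f) * (1 + t)) * (2
     * t ^ 2 + \<kappa> / 4 * (5 * (1 + t) ^ 2 - (1 + t)) - \<kappa> / 2)) - 1 * ((f + (1 - f) * (1 +
     t)) ^ 2 * t ^ 2)"

definition jump0_poly :: "real list \<Rightarrow> real \<Rightarrow> real \<Rightarrow> nat \<Rightarrow> real list" where
  "jump0_poly H \<kappa> f e =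
     psub (pmul (psub (ppow (padd [1] H) e) (padd [f] (pscale (1 - f) (padd [1] H)))) (psub (pscale
     \<kappa> (ppow (padd [1] H) e)) (pmul (padd [f] (pscale (1 - f) (padd [1] H))) (psub (padd
     (pscale 2 (ppow H 2)) (pscale (\<kappa> / 4) (psub (pscale 5 (ppow (padd [1] H) 2)) (padd [1]
     H)))) [\<kappa> / 2])))) (pscale 1 (pmul (ppow (padd [f] (pscale (1 - f) (padd [1] H))) 2) (ppow
     H 2)))"

definition jump1 :: "real \<Rightarrow> real \<Rightarrow> real \<Rightarrow> nat \<Rightarrow> real" where
  "jump1 t \<kappa> f e =
     ((1 + t) ^ e - (f + (1 - f) * (1 + t))) * (9 / 4 * \<kappa> * (1 + t) ^ e - (f + (1 - f) * (1 +
     t)) * (2 * t ^ 2 + 2 * t * (1 + t) + \<kappa> / 4 * (10 * (1 + t) ^ 2 - (1 + t)))) - 2 * ((f +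
     (1 - f) * (1 + t)) ^ 2 * t ^ 2)"

definition jump1_poly :: "real list \<Rightarrow> real \<Rightarrow> real \<Rightarrow> nat \<Rightarrow> real list" where
  "jump1_poly H \<kappa> f e =
     psub (pmul (psub (ppow (padd [1] H) e) (padd [f] (pscale (1 - f) (padd [1] H)))) (psub (pscale
     (9 / 4 * \<kappa>) (ppow (padd [1] H) e)) (pmul (padd [f] (pscale (1 - f) (padd [1] H))) (padd
     (padd (pscale 2 (ppow H 2)) (pmul (pscale 2 H) (padd [1] H))) (pscale (\<kappa> / 4) (psub
     (pscale 10 (ppow (padd [1] H) 2)) (padd [1] H))))))) (pscale 2 (pmul (ppow (padd [f] (pscale (1
     - f) (padd [1] H))) 2) (ppow H 2)))"

definition jump2 :: "real \<Rightarrow> real \<Rightarrow> real \<Rightarrow> nat \<Rightarrow> real" where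
  "jump2 t \<kappa> f e =
     ((1 + t) ^ e - (f + (1 - f) * (1 + t))) * ((1 + 5 / 4 * \<kappa>) * (1 + t) ^ e - (f + (1 - f) *
     (1 + t)) * (t ^ 2 + (1 + 5 / 4 * \<kappa>) * (1 + t) ^ 2)) - 1 * ((f + (1 - f) * (1 + t)) ^ 2 *
     t ^ 2)"

definition jump2_poly :: "real list \<Rightarrow> real \<Rightarrow> real \<Rightarrow> nat \<Rightarrow> real list" where
  "jump2_poly H \<kappa> f e =
     psub (pmul (psub (ppow (padd [1] H) e) (padd [f] (pscale (1 - f) (padd [1] H)))) (psub (pscale
     (1 + 5 / 4 * \<kappa>) (ppow (padd [1] H) e)) (pmul (padd [f] (pscale (1 - f) (padd [1] H)))
     (padd (ppow H 2) (pscale (1 + 5 / 4 * \<kappa>) (ppow (padd [1] H) 2)))))) (pscale 1 (pmul (ppow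
     (padd [f] (pscale (1 - f) (padd [1] H))) 2) (ppow H 2)))"

definition jump_disc :: "real \<Rightarrow> real \<Rightarrow> real \<Rightarrow> nat \<Rightarrow> real" where
  "jump_disc t \<kappa> f e =
     4 * (jump0 t \<kappa> f e * jump2 t \<kappa> f e) - jump1 t \<kappa> f e ^ 2"

definition jump_disc_poly :: "real list \<Rightarrow> real \<Rightarrow> real \<Rightarrow> nat \<Rightarrow> real list" where
  "jump_disc_poly H \<kappa> f e =
     psub (pscale 4 (pmul (jump0_poly H \<kappa> f e) (jump2_poly H \<kappa> f e))) (ppow (jump1_poly
     H \<kappa> f e) 2)"

section \<open>Evaluation of the certificate polynomials\<close>

lemmas pev_poly_ops = pev_padd pev_psub pev_pscale pev_pmul pev_ppow

lemma pev_left_slack_poly: "pev (left_slack_poly M s \<kappa> d) u = left_slack (pev M u) s \<kappa> d"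
  by (simp add: left_slack_def left_slack_poly_def pev_poly_ops )

lemma pev_left_cross_poly: "pev (left_cross_poly M \<kappa>) u = left_cross (pev M u) \<kappa>"
  by (simp add: left_cross_def left_cross_poly_def pev_poly_ops )

lemma pev_left_mid_poly: "pev (left_mid_poly M s \<kappa> d T) u = left_mid (pev M u) s \<kappa> d T"
  by (simp add: left_mid_def left_mid_poly_def pev_poly_ops pev_left_slack_poly pev_left_cross_poly)

lemma pev_left_end_poly: "pev (left_end_poly M s \<kappa> d T) u = left_end (pev M u) s \<kappa> d T"
  by (simp add: left_end_def left_end_poly_def pev_poly_ops pev_left_slack_poly pev_left_cross_poly)

lemma pev_right_slack_poly: "pev (right_slack_poly M s \<kappa> d) u = right_slack (pev M u) s \<kappa> d"
  by (simp add: right_slack_def right_slack_poly_def pev_poly_ops )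

lemma pev_right_cross_poly: "pev (right_cross_poly M \<kappa>) u = right_cross (pev M u) \<kappa>"
  by (simp add: right_cross_def right_cross_poly_def pev_poly_ops )

lemma pev_right_mid_poly: "pev (right_mid_poly M s \<kappa> d T) u = right_mid (pev M u) s \<kappa> d T"
  by (simp add: right_mid_def right_mid_poly_def pev_poly_ops pev_right_slack_poly pev_right_cross_poly)

lemma pev_right_end_poly: "pev (right_end_poly M s \<kappa> d T) u = right_end (pev M u) s \<kappa> d T"
  by (simp add: right_end_def right_end_poly_def pev_poly_ops pev_right_slack_poly pev_right_cross_poly)

lemma pev_rate_gap_poly: "pev (rate_gap_poly A \<kappa> y) u = rate_gap (pev A u) \<kappa> y"
  by (simp add: rate_gap_def rate_gap_poly_def pev_poly_ops )

lemma pev_drift_gap_poly: "pev (drift_gap_poly A s r) u = drift_gap (pev A u) s r"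
  by (simp add: drift_gap_def drift_gap_poly_def pev_poly_ops )

lemma pev_potential_poly: "pev (potential_poly H \<kappa>) u = potential (pev H u) \<kappa>"
  by (simp add: potential_def potential_poly_def pev_poly_ops )

lemma pev_lift_gap_poly: "pev (lift_gap_poly H \<kappa> v) u = lift_gap (pev H u) \<kappa> v"
  by (simp add: lift_gap_def lift_gap_poly_def pev_poly_ops pev_potential_poly)

lemma pev_jump0_poly: "pev (jump0_poly H \<kappa> f e) u = jump0 (pev H u) \<kappa> f e"
  by (simp add: jump0_def jump0_poly_def pev_poly_ops )

lemma pev_jump1_poly: "pev (jump1_poly H \<kappa> f e) u = jump1 (pev H u) \<kappa> f e"
  by (simp add: jump1_def jump1_poly_def pev_poly_ops )

lemma pev_jump2_poly: "pev (jump2_poly H \<kappa> f e) u = jump2 (pev H u) \<kappa> f e"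
  by (simp add: jump2_def jump2_poly_def pev_poly_ops )

lemma pev_jump_disc_poly: "pev (jump_disc_poly H \<kappa> f e) u = jump_disc (pev H u) \<kappa> f e"
  by (simp add: jump_disc_def jump_disc_poly_def pev_poly_ops pev_jump0_poly pev_jump1_poly pev_jump2_poly)

definition edge_conditions :: "real \<Rightarrow> real \<Rightarrow> real \<Rightarrow> real \<Rightarrow> real \<Rightarrow> bool" where
  "edge_conditions m s \<kappa> d T \<longleftrightarrow>
     0 \<le> left_slack m s \<kappa> d \<and> 0 \<le> left_mid m s \<kappa> d T \<and> 0 \<le> left_end m s \<kappa> d T \<and>
     0 \<le> right_slack m s \<kappa> d \<and> 0 \<le> right_mid m s \<kappa> d T \<and> 0 \<le> right_end m s \<kappa> d T"

text \<open>The discriminant test of a quadratic form: raising \<open>S = h\<close> to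
  \<open>S'\<close> with \<open>1 + S' = (1 + t) * (1 + h)\<close> multiplies the Lyapunov function
  by at most \<open>y\<close>, if the new velocity weight is lowered by \<open>\<kappa> / 2\<close>.
  The clause on \<open>y = 1\<close> makes the later division by \<open>y - 1\<close>
  legitimate.\<close>

definition jump_condition :: "real \<Rightarrow> real \<Rightarrow> bool" where
  "jump_condition \<kappa> x \<longleftrightarrow> (\<forall>h\<ge>0. \<forall>t\<ge>0. \<exists>y\<ge>1. y \<le> (1 + t) powr x \<and> (y = 1 \<longrightarrow> t = 0) \<and>
     (t * (1 + h))\<^sup>2 \<le> (y - 1) * (y * potential h \<kappa> - (t * (1 + h))\<^sup>2
        - (potential (h + t + t * h) \<kappa> - \<kappa> / 2)))"

text \<open>\<open>m\<close> is \<open>lam * \<mu>\<close>; \<open>s\<close> scales the drift and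
  \<kappa> is the relaxation reserve. \<open>d\<close> is the share of strong monotonicity spent on
  the cross term of the drift, \<open>x\<close> and \<open>v\<close> are the exponents of jump and
  lift, \<open>y\<close> bounds \<open>\<rho>b * \<sigma> * m\<close>, and \<open>T\<close> is the
  part of the noise budget 2 left for the coupling term. The bound 6/5 leads to
  \<open>1 < G\<close>, the bound 2/3 makes a coefficient in \<open>path_step\<close> nonnegative,
  and \<open>(1 + \<kappa>) * (3/2 - m) \<le> 2 * (1 + m)\<close> gives \<open>P \<le> 2\<close> in
  \<open>noise_bound\<close>.\<close>

definition admissible :: "real \<Rightarrow> real \<Rightarrow> real \<Rightarrow> real \<Rightarrow> real \<Rightarrow> real \<Rightarrow> real \<Rightarrow> real \<Rightarrow> bool" where
  "admissible m s \<kappa> d x v y T \<longleftrightarrow>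
     6/5 \<le> s \<and> s * (1 + 2 * m) + d \<le> 2 \<and> 0 < d \<and> 0 < \<kappa> \<and> \<kappa> \<le> 2/3 \<and> 2 \<le> x \<and> 0 \<le> v \<and> v \<le> 1 \<and>
     (1 + \<kappa>) * (3/2 - m) \<le> 2 * (1 + m) \<and> 26/25 \<le> T \<and>
     T \<le> 2 - 1 / (2 - d) - 16/27 * s\<^sup>2 * m\<^sup>2 / d \<and> edge_conditions m s \<kappa> d T \<and>
     s * m * (3/2 - m) \<le> y * (1 + m) \<and> (\<forall>\<alpha>\<in>{0..1}. 0 \<le> rate_gap \<alpha> \<kappa> y) \<and>
     (\<forall>\<alpha>\<in>{0..1}. 0 \<le> drift_gap \<alpha> s (x + v)) \<and> (\<forall>h\<ge>0. 0 \<le> lift_gap h \<kappa> v) \<and>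
     jump_condition \<kappa> x"

text \<open>The list \<open>[lo, w]\<close> is the substitution \<open>m = lo + w * u\<close>, which
  turns the range of \<open>m\<close> into [0, n] for \<open>u\<close>.\<close>

lemma nonneg_upto_at:
  assumes "\<And>u. pev q u = f (pev [lo, w] u)" "nonneg_upto n q"
    and "lo \<le> m" "m \<le> lo + real n * w" "0 < w" "0 < n"
  shows "0 \<le> f m"
  using nonneg_upto[OF assms(2), of "(m - lo) / w"] assms by (simp add: field_simps)

lemma nonneg_beyond_at:
  assumes "\<And>u. pev q u = f (pev [0, w] u)" "nonneg_beyond n q" "0 \<le> m" "0 < w"
  shows "0 \<le> f m"
  using nonneg_beyond[OF assms(2), of "m / w"] assms by (simp add: field_simps)

section \<open>Reduction of the jump condition to polynomials in one variable\<close>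

lemma quadratic_nonneg:
  fixes a b c h :: real
  assumes "0 \<le> a" "0 \<le> c" "0 \<le> 4 * (a * c) - b\<^sup>2"
  shows "0 \<le> a + b * h + c * h\<^sup>2"
proof (cases "c = 0")
  case True
  then show ?thesis using assms by simp
next
  case False
  have "4 * c * (a + b * h + c * h\<^sup>2) = (2 * c * h + b)\<^sup>2 + (4 * (a * c) - b\<^sup>2)"
    by (simp add: power2_eq_square algebra_simps)
  then have "0 \<le> 4 * c * (a + b * h + c * h\<^sup>2)" using assms(3) by simp
  then show ?thesis using False assms(2) by (simp add: zero_le_mult_iff)
qed

text \<open>The weighted harmonic mean of \<open>t\<close> and 1 lies below the geometric one. This
  gives a rational lower bound for a power with a real exponent.\<close>

lemma powr_fraction_lower:
  assumes "0 \<le> f" "f \<le> 1" "1 \<le> (t::real)"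
  shows "t / (f + (1 - f) * t) \<le> t powr f"
proof -
  have "(1/t) powr f * 1 powr (1 - f) \<le> f * (1/t) + (1 - f) * 1"
    using Youngs_inequality_0[of f "1 - f" "1/t" 1] assms by simp
  then have "1 / t powr f \<le> (f + (1 - f) * t) / t"
    using assms by (simp add: powr_divide field_simps)
  moreover have "0 < f + (1 - f) * t"
    using assms by (smt (verit) mult_nonneg_nonneg mult_pos_pos)
  moreover have "0 < t powr f" using assms by simp
  ultimately show ?thesis using assms by (simp add: field_simps)
qed

lemma jump_conditionI:
  assumes f: "0 \<le> f" "f \<le> 1" and e: "1 \<le> e" and x: "x = real e + f"
    and c: "\<And>t. 0 \<le> t \<Longrightarrow> 0 \<le> jump0 t \<kappa> f (Suc e)" "\<And>t. 0 \<le> t \<Longrightarrow> 0 \<le> jump2 t \<kappa> f (Suc e)"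
      "\<And>t. 0 \<le> t \<Longrightarrow> 0 \<le> jump_disc t \<kappa> f (Suc e)"
  shows "jump_condition \<kappa> x"
  unfolding jump_condition_def
proof (intro allI impI)
  fix h t :: real
  assume h: "0 \<le> h" and t: "0 \<le> t"
  define D where "D = f + (1 - f) * (1 + t)"
  define N where "N = (1 + t) ^ Suc e"
  have D: "1 \<le> D" "D \<le> 1 + t"
    using f t mult_left_le_one_le[of t f] by (auto simp: D_def algebra_simps)
  have N: "1 + t \<le> N" using t power_increasing[of 1 "Suc e" "1 + t"] by (simp add: N_def)
  have strict: "t = 0" if "N = D"
  proof -
    have "(1 + t) ^ e * (1 + t) = 1 * (1 + t)" using that D N by (simp add: N_def mult.commute)
    then have "(1 + t) ^ e = 1" using t by simp
    then show ?thesis using t e power_increasing[of 1 e "1 + t"] by simp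
  qed
  have "0 \<le> jump0 t \<kappa> f (Suc e) + jump1 t \<kappa> f (Suc e) * h + jump2 t \<kappa> f (Suc e) * h\<^sup>2"
    by (rule quadratic_nonneg) (use c[OF t] in \<open>auto simp: jump_disc_def\<close>)
  also have "\<dots> = (N - D) * (N * potential h \<kappa> - D * ((t * (1 + h))\<^sup>2
      + (potential (h + t + t * h) \<kappa> - \<kappa> / 2))) - D\<^sup>2 * (t * (1 + h))\<^sup>2"
    unfolding jump0_def jump1_def jump2_def D_def[symmetric] N_def[symmetric] potential_def
    by algebra
  finally have "D\<^sup>2 * (t * (1 + h))\<^sup>2 \<le> (N - D) * (N * potential h \<kappa> - D * ((t * (1 + h))\<^sup>2
      + (potential (h + t + t * h) \<kappa> - \<kappa> / 2)))" by simp
  then have "(t * (1 + h))\<^sup>2 \<le> (N / D - 1) * (N / D * potential h \<kappa> - (t * (1 + h))\<^sup>2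
      - (potential (h + t + t * h) \<kappa> - \<kappa> / 2))"
    using D by (simp add: divide_simps power2_eq_square) (simp add: algebra_simps)
  moreover have "N / D \<le> (1 + t) powr x"
  proof -
    \<comment> \<open>One of the \<open>Suc e\<close> factors of \<open>N\<close> is spent on the
      harmonic mean, so \<open>e + f = x\<close> is the exponent that results.\<close>
    have "N / D = (1 + t) ^ e * ((1 + t) / D)" by (simp add: N_def)
    also have "\<dots> \<le> (1 + t) ^ e * (1 + t) powr f"
      using powr_fraction_lower[OF f, of "1 + t"] t by (intro mult_left_mono) (auto simp: D_def)
    also have "\<dots> = (1 + t) powr x" using t by (simp add: x powr_add powr_realpow)
    finally show ?thesis .
  qed
  moreover have "1 \<le> N / D" using D N by simp
  moreover have "N / D = 1 \<longrightarrow> t = 0" using strict D by simp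
  ultimately show "\<exists>y\<ge>1. y \<le> (1 + t) powr x \<and> (y = 1 \<longrightarrow> t = 0) \<and>
     (t * (1 + h))\<^sup>2 \<le> (y - 1) * (y * potential h \<kappa> - (t * (1 + h))\<^sup>2
        - (potential (h + t + t * h) \<kappa> - \<kappa> / 2))" by blast
qed

lemmas poly_defs = psub_def left_slack_poly_def left_cross_poly_def left_mid_poly_def left_end_poly_def
  right_slack_poly_def right_cross_poly_def right_mid_poly_def right_end_poly_def rate_gap_poly_def
  drift_gap_poly_def potential_poly_def lift_gap_poly_def jump0_poly_def jump1_poly_def
  jump2_poly_def jump_disc_poly_def

lemma admissibleI:
  assumes m: "lo \<le> m" "m \<le> lo + 2 * w" "0 \<le> lo" "0 < w"
    and edges: "nonneg_upto 2 (left_slack_poly [lo, w] s \<kappa> d)" "nonneg_upto 2 (left_mid_poly [lo, w] s \<kappa> d T)"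
      "nonneg_upto 2 (left_end_poly [lo, w] s \<kappa> d T)" "nonneg_upto 2 (right_slack_poly [lo, w] s \<kappa> d)"
      "nonneg_upto 2 (right_mid_poly [lo, w] s \<kappa> d T)" "nonneg_upto 2 (right_end_poly [lo, w] s \<kappa> d T)"
    and rate: "0 < n1" "nonneg_upto n1 (rate_gap_poly [0, 1 / real n1] \<kappa> y)"
    and drift: "0 < n2" "nonneg_upto n2 (drift_gap_poly [0, 1 / real n2] s (x + v))"
    and lift: "0 < w3" "nonneg_beyond n3 (lift_gap_poly [0, w3] \<kappa> v)"
    and jump: "0 < w4" "nonneg_beyond n4 (jump0_poly [0, w4] \<kappa> (x - real e) (Suc e))"
      "nonneg_beyond n4 (jump2_poly [0, w4] \<kappa> (x - real e) (Suc e))"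
      "nonneg_beyond n4 (jump_disc_poly [0, w4] \<kappa> (x - real e) (Suc e))"
    and e: "1 \<le> e" "real e \<le> x" "x \<le> real e + 1"
    and scalars: "6/5 \<le> s" "s * (1 + 2 * (lo + 2 * w)) + d \<le> 2" "0 < d" "0 < \<kappa>" "\<kappa> \<le> 2/3" "2 \<le> x"
      "0 \<le> v" "v \<le> 1" "(1 + \<kappa>) * (3/2 - lo) \<le> 2 * (1 + lo)" "26/25 \<le> T"
      "T = 2 - 1 / (2 - d) - 16/27 * s\<^sup>2 * (lo + 2 * w)\<^sup>2 / d"
      "y = s * (lo + 2 * w) * (3/2 - (lo + 2 * w)) / (1 + (lo + 2 * w))" "lo + 2 * w \<le> 1/4"
  shows "admissible m s \<kappa> d x v y T"
proof -
  define hi where "hi = lo + 2 * w"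
  have m0: "0 \<le> m" "m \<le> hi" "hi \<le> 1/4" "0 \<le> hi" using m scalars by (auto simp: hi_def)
  have m2: "m \<le> lo + real 2 * w" using m by simp
  note at = nonneg_upto_at[OF _ _ m(1) m2 m(4) pos2]
  have "edge_conditions m s \<kappa> d T"
    unfolding edge_conditions_def
    by (intro conjI at[OF pev_left_slack_poly edges(1)] at[OF pev_left_mid_poly edges(2)]
        at[OF pev_left_end_poly edges(3)] at[OF pev_right_slack_poly edges(4)]
        at[OF pev_right_mid_poly edges(5)] at[OF pev_right_end_poly edges(6)])
  moreover have "0 \<le> rate_gap \<alpha> \<kappa> y" "0 \<le> drift_gap \<alpha> s (x + v)" if "\<alpha> \<in> {0..1}" for \<alpha>
    using nonneg_upto_at[OF pev_rate_gap_poly rate(2), of \<alpha>] nonneg_upto_at[OF pev_drift_gap_poly drift(2), of \<alpha>]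
      rate(1) drift(1) that by auto
  moreover have "0 \<le> lift_gap h \<kappa> v" if "0 \<le> h" for h
    by (rule nonneg_beyond_at[OF pev_lift_gap_poly lift(2) that lift(1)])
  moreover have "jump_condition \<kappa> x"
    by (rule jump_conditionI[where f = "x - real e", OF _ _ e(1)])
      (use e nonneg_beyond_at[OF pev_jump0_poly jump(2) _ jump(1)] nonneg_beyond_at[OF pev_jump2_poly jump(3) _ jump(1)]
        nonneg_beyond_at[OF pev_jump_disc_poly jump(4) _ jump(1)] in auto)
  moreover have "s * (1 + 2 * m) + d \<le> 2"
  proof -
    have "s * (1 + 2 * m) \<le> s * (1 + 2 * hi)" using m0 scalars(1) by (intro mult_left_mono) auto
    then show ?thesis using scalars(2) by (simp add: hi_def)
  qed
  moreover have "(1 + \<kappa>) * (3/2 - m) \<le> 2 * (1 + m)"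
  proof -
    have "(1 + \<kappa>) * (3/2 - m) \<le> (1 + \<kappa>) * (3/2 - lo)" using m(1) scalars(4) by (intro mult_left_mono) auto
    then show ?thesis using scalars(9) m(1) by simp
  qed
  moreover have "T \<le> 2 - 1 / (2 - d) - 16/27 * s\<^sup>2 * m\<^sup>2 / d"
  proof -
    have "16/27 * s\<^sup>2 * m\<^sup>2 / d \<le> 16/27 * s\<^sup>2 * hi\<^sup>2 / d"
      using m0 scalars(3) by (intro divide_right_mono mult_left_mono power_mono) auto
    then show ?thesis using scalars(11) by (simp add: hi_def)
  qed
  moreover have "s * m * (3/2 - m) \<le> y * (1 + m)"
  proof -
    have "(1 + m) * hi \<le> (1 + 1/4) * (1/4)" using m0 by (intro mult_mono) auto
    \<comment> \<open>This product is the difference of the two sides of the next line: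
      \<open>m * (3/2 - m) / (1 + m)\<close> increases on [0, 1/4].\<close>
    then have "0 \<le> (hi - m) * (3/2 - m - (1 + m) * hi)" using m0 by (intro mult_nonneg_nonneg) auto
    then have "m * (3/2 - m) * (1 + hi) \<le> hi * (3/2 - hi) * (1 + m)" by (simp add: field_simps)
    then have "s * (m * (3/2 - m) * (1 + hi)) \<le> s * (hi * (3/2 - hi) * (1 + m))"
      using scalars(1) by (intro mult_left_mono) auto
    then have "s * m * (3/2 - m) * (1 + hi) \<le> (s * hi * (3/2 - hi)) * (1 + m)" by (simp only: mult.assoc)
    also have "s * hi * (3/2 - hi) = y * (1 + hi)" using scalars(12) m0 unfolding hi_def[symmetric] by simp
    also have "y * (1 + hi) * (1 + m) = y * (1 + m) * (1 + hi)" by simp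
    finally have "s * m * (3/2 - m) * (1 + hi) \<le> y * (1 + m) * (1 + hi)" .
    moreover have "0 < 1 + hi" using m0 by simp
    ultimately show ?thesis by (simp only: mult_le_cancel_right_pos)
  qed
  ultimately show ?thesis using scalars by (simp add: admissible_def)
qed

text \<open>Only \<open>s\<close>, \<kappa>, \<open>d\<close>, \<open>x\<close>, \<open>v\<close>
  are free; the last two constants are the values of the formulas for \<open>y\<close> and
  \<open>T\<close> in \<open>admissibleI\<close> at the upper end of the box. From box to box
  \<open>s\<close> falls, as \<open>s * (1 + 2 * m) + d \<le> 2\<close> demands;
  \<open>drift_gap\<close> then asks for a smaller \<open>x + v\<close>, which goes along with a
  larger \<kappa>.\<close>

lemma admissible_box1:
  assumes "0 \<le> m" "m \<le> 7/100"
  shows "admissible m (8/5) (31/100) (1/10) (18/5) (11/20) (2002/13375) (2243332/1603125)"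
  by (rule admissibleI[where lo = "0" and w = "7/200" and ?n1.0 = 2 and ?n2.0 = 8 and ?w3.0 = "1/16"
        and ?n3.0 = 9 and ?w4.0 = "1/2" and ?n4.0 = 1 and e = 3])
    (use assms in \<open>simp_all add: poly_defs eval_nat_numeral\<close>)

lemma admissible_box2:
  assumes "7/100 \<le> m" "m \<le> 13/100"
  shows "admissible m (29/20) (43/100) (3/20) (82/25) (9/20) (51649/226000) (49416227/37462500)"
  by (rule admissibleI[where lo = "7/100" and w = "3/100" and ?n1.0 = 10 and ?n2.0 = 8 and ?w3.0 = "1/4"
        and ?n3.0 = 3 and ?w4.0 = "1/2" and ?n4.0 = 1 and e = 3])
    (use assms in \<open>simp_all add: poly_defs eval_nat_numeral\<close>)

lemma admissible_box3:
  assumes "13/100 \<le> m" "m \<le> 9/50"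
  shows "admissible m (33/25) (53/100) (1/5) (307/100) (39/100) (9801/36875) (898013/703125)"
  by (rule admissibleI[where lo = "13/100" and w = "1/40" and ?n1.0 = 5 and ?n2.0 = 10 and ?w3.0 = "1/2"
        and ?n3.0 = 2 and ?w4.0 = "1/2" and ?n4.0 = 2 and e = 3])
    (use assms in \<open>simp_all add: poly_defs eval_nat_numeral\<close>)

lemma admissible_box4:
  assumes "9/50 \<le> m" "m \<le> 11/50"
  shows "admissible m (63/50) (57/100) (9/50) 3 (37/100) (11088/38125) (5108422/4265625)"
  by (rule admissibleI[where lo = "9/50" and w = "1/50" and ?n1.0 = 12 and ?n2.0 = 16 and ?w3.0 = "1/2"
        and ?n3.0 = 2 and ?w4.0 = "1/2" and ?n4.0 = 2 and e = 3])
    (use assms in \<open>simp_all add: poly_defs eval_nat_numeral\<close>)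

lemma admissible_box5:
  assumes "11/50 \<le> m" "m \<le> 1/4"
  shows "admissible m (121/100) (16/25) (9/50) (147/50) (17/50) (121/400) (5082869/4422600)"
  by (rule admissibleI[where lo = "11/50" and w = "3/200" and ?n1.0 = 3 and ?n2.0 = 25 and ?w3.0 = "1/4"
        and ?n3.0 = 3 and ?w4.0 = "1/4" and ?n4.0 = 4 and e = 2])
    (use assms in \<open>simp_all add: poly_defs eval_nat_numeral\<close>)

lemma admissible_exists:
  assumes "0 \<le> m" "m \<le> 1/4"
  shows "\<exists>s \<kappa> d x v y T. admissible m s \<kappa> d x v y T"
proof -
  consider "m \<le> 7/100" | "7/100 \<le> m" "m \<le> 13/100" | "13/100 \<le> m" "m \<le> 9/50"
    | "9/50 \<le> m" "m \<le> 11/50" | "11/50 \<le> m" by linarith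
  then show ?thesis
    using assms admissible_box1 admissible_box2 admissible_box3 admissible_box4 admissible_box5
    by cases blast+
qed

section \<open>Noise constants\<close>

text \<open>The inequality in \<open>b\<close> is given only at \<open>3/20\<close> (with powers of
  \<open>1 - b\<close> bounded by 1) and at 1. Below \<open>3/20\<close>, scaling the first one
  suffices. Above, the two are averaged, and the error on the left is paid by the concavity gap
  \<open>(b - 3/20) * (1 - b)\<close> of \<open>2 * b - b^2\<close> on the right.\<close>

lemma edge_interpolation:
  fixes b m T S A c V P x :: real
  assumes b: "0 \<le> b" "b \<le> 1" and m: "0 \<le> m" "m \<le> 1/4" and T: "26/25 \<le> T"
    and nn: "0 \<le> A" "0 \<le> c" "0 \<le> V" "0 \<le> P" "P \<le> 2" "0 \<le> x"
    and S: "0 \<le> S"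
    and mid: "3/5 * m * (V + 2 * P * c + x * c) \<le> T * (S + 3/20 * A + 111/400 * c)"
    and edge: "4 * m * V \<le> T * (S + A + c)"
  shows "4 * b * m * (V + 2 * P * c * (1 - b)\<^sup>2 + x * c * (1 - b) ^ 4) \<le> T * (S + b * A + c * (2 * b - b\<^sup>2))"
proof -
  have b1: "(1 - b)\<^sup>2 \<le> 1" "(1 - b) ^ 4 \<le> 1" using b by (auto intro: power_le_one)
  have Pc: "0 \<le> 2 * P * c" "0 \<le> x * c" using nn by auto
  show ?thesis
  proof (cases "b \<le> 3/20")
    case True
    have "V + 2 * P * c * (1 - b)\<^sup>2 + x * c * (1 - b) ^ 4 \<le> V + 2 * P * c + x * c"
      using mult_left_mono[OF b1(1) Pc(1)] mult_left_mono[OF b1(2) Pc(2)] by simp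
    then have "4 * b * m * (V + 2 * P * c * (1 - b)\<^sup>2 + x * c * (1 - b) ^ 4) \<le> 4 * b * m * (V + 2 * P * c + x * c)"
      using b m by (intro mult_left_mono) auto
    also have "\<dots> = (20/3 * b) * (3/5 * m * (V + 2 * P * c + x * c))" by simp
    also have "\<dots> \<le> (20/3 * b) * (T * (S + 3/20 * A + 111/400 * c))"
      using mid b by (intro mult_left_mono) auto
    also have "\<dots> = T * (20/3 * b * S + b * A + 37/20 * b * c)" by (simp add: algebra_simps)
    also have "\<dots> \<le> T * (S + b * A + c * (2 * b - b\<^sup>2))"
    proof (intro mult_left_mono)
      have "20/3 * b * S \<le> 1 * S" using True S by (intro mult_right_mono) auto
      moreover have "0 \<le> c * (b * (3/20 - b))" using nn b True by (intro mult_nonneg_nonneg) auto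
      ultimately show "20/3 * b * S + b * A + 37/20 * b * c \<le> S + b * A + c * (2 * b - b\<^sup>2)"
        by (simp add: power2_eq_square algebra_simps)
    qed (use T in auto)
    finally show ?thesis .
  next
    case False
    \<comment> \<open>The weight of \<open>3/20\<close> when \<open>b\<close> is written as a convex
      combination of \<open>3/20\<close> and 1.\<close>
    define th where "th = 20/17 * (1 - b)"
    have th: "0 \<le> th" "th \<le> 1" "1 - th = 20/17 * b - 3/17" using b False by (auto simp: th_def field_simps)
    have "th * (3/5 * m * (V + 2 * P * c + x * c)) + (1 - th) * (4 * m * V)
        \<le> th * (T * (S + 3/20 * A + 111/400 * c)) + (1 - th) * (T * (S + A + c))"
      using mid edge th by (intro add_mono mult_left_mono) auto
    moreover have "th * (T * (S + 3/20 * A + 111/400 * c)) + (1 - th) * (T * (S + A + c))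
        = T * (S + b * A + c * (2 * b - b\<^sup>2)) - T * (c * ((b - 3/20) * (1 - b)))"
      by (simp add: th_def power2_eq_square field_simps)
    moreover have "th * (3/5 * m * (V + 2 * P * c + x * c)) + (1 - th) * (4 * m * V)
        = 4 * b * m * (V + 2 * P * c * (1 - b)\<^sup>2 + x * c * (1 - b) ^ 4)
          - 4 * m * (1 - b) * (2 * P * c * (b * (1 - b) - 3/17) + x * c * (b * (1 - b) ^ 3 - 3/17))"
      by (simp add: th_def eval_nat_numeral field_simps)
    moreover have "4 * m * (1 - b) * (2 * P * c * (b * (1 - b) - 3/17) + x * c * (b * (1 - b) ^ 3 - 3/17))
        \<le> T * (c * ((b - 3/20) * (1 - b)))"
    proof -
      have "b * (1 - b) \<le> 1/4" using zero_le_power2[of "b - 1/2"] by (simp add: power2_eq_square algebra_simps)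
      moreover have "b * (1 - b) ^ 3 \<le> 3/17"
      proof -
        \<comment> \<open>Equals \<open>4/27 - b * (1 - b)^2\<close>: the maximum 4/27 is attained
          at \<open>b = 1/3\<close> and is below 3/17.\<close>
        have "0 \<le> (b - 1/3)\<^sup>2 * (4/3 - b)" using b by simp
        then have "b * (1 - b)\<^sup>2 \<le> 3/17" by (simp add: power2_eq_square algebra_simps)
        moreover have "b * (1 - b)\<^sup>2 * (1 - b) \<le> b * (1 - b)\<^sup>2"
          using b by (intro mult_right_le_one_le) auto
        ultimately show ?thesis by (simp add: eval_nat_numeral algebra_simps)
      qed
      then have "x * c * (b * (1 - b) ^ 3 - 3/17) \<le> 0" using Pc by (simp add: mult_nonneg_nonpos)
      moreover have "2 * P * c * (b * (1 - b) - 3/17) \<le> 26/25 * (c * (b - 3/20))"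
      proof -
        \<comment> \<open>Comparison with the tangent of \<open>b * (1 - b)\<close> at
          \<open>37/100\<close>. Its slope 26/100 times \<open>2 * P \<le> 4\<close> gives 26/25,
          the least \<open>T\<close> allowed.\<close>
        have "b * (1 - b) - 3/17 \<le> 26/100 * (b - 3/20)"
          using zero_le_power2[of "b - 37/100"] by (simp add: power2_eq_square algebra_simps)
        then have "2 * P * c * (b * (1 - b) - 3/17) \<le> 2 * P * c * (26/100 * (b - 3/20))"
          by (intro mult_left_mono) (use Pc in auto)
        also have "\<dots> \<le> 2 * 2 * c * (26/100 * (b - 3/20))"
          by (intro mult_right_mono) (use nn False in auto)
        finally show ?thesis by (simp add: algebra_simps)
      qed
      ultimately have "2 * P * c * (b * (1 - b) - 3/17) + x * c * (b * (1 - b) ^ 3 - 3/17) \<le> 26/25 * (c * (b - 3/20))"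
        by linarith
      then have "4 * m * (1 - b) * (2 * P * c * (b * (1 - b) - 3/17) + x * c * (b * (1 - b) ^ 3 - 3/17))
          \<le> 4 * m * (1 - b) * (26/25 * (c * (b - 3/20)))"
        using m b by (intro mult_left_mono) auto
      also have "\<dots> \<le> 1 * (1 - b) * (T * (c * (b - 3/20)))"
        using m b T nn False by (intro mult_mono) auto
      finally show ?thesis by (simp add: algebra_simps)
    qed
    ultimately show ?thesis by linarith
  qed
qed

text \<open>With \<open>P = p / (1 + l)\<close>, \<open>slack\<close> is the coefficient
  \<open>Sl\<close> of the one-step estimate and \<open>cross\<close> the constant by which the
  coupling to the noise is measured there. Writing them in \<open>1 / (1 + l)\<close> and
  \<open>l\<close> makes their curvature visible.\<close>

definition slack :: "real \<Rightarrow> real \<Rightarrow> real \<Rightarrow> real \<Rightarrow> real \<Rightarrow> real" where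
  "slack m \<sigma> p d l = 2 - (2 + \<sigma>) * m - p * ((2 - 2 * m) / (1 + l) + l - 1) - \<sigma>\<^sup>2 * m / d * l\<^sup>2"

definition cross :: "real \<Rightarrow> real \<Rightarrow> real \<Rightarrow> real \<Rightarrow> real \<Rightarrow> real" where
  "cross m \<sigma> p d l = (p * (1 - 1 / (1 + l)) + \<sigma>\<^sup>2 * m / d * l)\<^sup>2 + (p / (1 + l) - 1)\<^sup>2"

text \<open>For fixed \<open>l\<close>, replacing \<open>s\<close> by \<open>s * (1 - b)\<close>
  raises \<open>slack\<close> by \<open>b * (s * m) + c * (2 * b - b^2)\<close>, which is the
  dependence on \<open>b\<close> that \<open>edge_interpolation\<close> handles.\<close>

lemma slack_cross_endpoint:
  assumes b: "0 < b" "b < 1" and m: "0 < m" "m \<le> 1/4" and l: "0 \<le> l" and d: "0 < d"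
    and T: "26/25 \<le> T" and s: "0 \<le> s" and p: "0 \<le> p" "p \<le> 2 * (1 + l)"
    and c: "c = s\<^sup>2 / d * m * l\<^sup>2" 
    and S: "0 \<le> slack m s p d l" and V: "V = (p * l / (1 + l))\<^sup>2 + (p / (1 + l) - 1)\<^sup>2"
    and mid: "3/5 * m * (V + 2 * (p / (1 + l)) * c + s\<^sup>2 / d * m * c)
        \<le> T * (slack m s p d l + 3/20 * (s * m) + 111/400 * c)"
    and edge: "4 * m * V \<le> T * (slack m s p d l + s * m + c)"
  shows "4 * b * m * cross m (s * (1 - b)) p d l \<le> T * slack m (s * (1 - b)) p d l"
proof -
  have "4 * b * m * (V + 2 * (p / (1 + l)) * c * (1 - b)\<^sup>2 + s\<^sup>2 / d * m * c * (1 - b) ^ 4)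
      \<le> T * (slack m s p d l + b * (s * m) + c * (2 * b - b\<^sup>2))"
  proof (rule edge_interpolation)
    show "0 \<le> c" using s d m by (simp add: c)
    show "0 \<le> V" by (simp add: V)
  qed (use assms in \<open>auto simp: divide_simps simp del: V c\<close>)
  moreover have "slack m (s * (1 - b)) p d l = slack m s p d l + b * (s * m) + c * (2 * b - b\<^sup>2)"
    unfolding slack_def c by (simp add: power2_eq_square add_divide_distrib diff_divide_distrib algebra_simps)
  moreover have "cross m (s * (1 - b)) p d l
      = V + 2 * (p / (1 + l)) * c * (1 - b)\<^sup>2 + s\<^sup>2 / d * m * c * (1 - b) ^ 4"
  proof -
    define A Y where "A = p * l / (1 + l)" and "Y = s\<^sup>2 / d * m * l"
    have "p * (1 - 1 / (1 + l)) = A" "(s * (1 - b))\<^sup>2 * m / d * l = Y * (1 - b)\<^sup>2"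
      using l by (simp_all add: A_def Y_def power_mult_distrib divide_simps)
    then have "cross m (s * (1 - b)) p d l = (A + Y * (1 - b)\<^sup>2)\<^sup>2 + (p / (1 + l) - 1)\<^sup>2" by (simp add: cross_def)
    moreover have "2 * (p / (1 + l)) * c = 2 * A * Y" "s\<^sup>2 / d * m * c = Y\<^sup>2"
      by (simp_all add: c A_def Y_def power2_eq_square)
    ultimately show ?thesis unfolding V A_def[symmetric] by algebra
  qed
  ultimately show ?thesis by simp
qed

text \<open>In the variable \<open>t = 1 / (1 + l)\<close>, \<open>l = 1 / t - 1\<close> is convex.
  Hence \<open>slack\<close> is concave, and \<open>cross\<close> is convex as a sum of the square
  of a nonnegative convex function and the square of an affine one.\<close>

lemma slack_cross_interval:
  assumes l: "l0 \<le> l" "l \<le> l1" "0 \<le> l0" and p: "0 \<le> p" and m: "0 \<le> m" "m \<le> 1" and d: "0 < d"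
    and T: "0 \<le> T" and B: "0 \<le> B"
    and e0: "B * cross m \<sigma> p d l0 \<le> T * slack m \<sigma> p d l0"
    and e1: "B * cross m \<sigma> p d l1 \<le> T * slack m \<sigma> p d l1"
  shows "B * cross m \<sigma> p d l \<le> T * slack m \<sigma> p d l"
proof (cases "l0 = l1")
  case True
  then show ?thesis using e0 l by simp
next
  case False
  define t t0 t1 where t: "t = 1 / (1 + l)" "t0 = 1 / (1 + l0)" "t1 = 1 / (1 + l1)"
  have tt: "t1 \<le> t" "t \<le> t0" "t1 < t0" "0 < t1" using l False by (auto simp: t frac_le frac_less2)
  define th where "th = (t - t1) / (t0 - t1)"
  have th: "0 \<le> th" "th \<le> 1" using tt by (auto simp: th_def)
  have tc: "t = th * t0 + (1 - th) * t1"
  proof -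
    have "th * (t0 - t1) = t - t1" using tt by (simp add: th_def)
    then show ?thesis by (simp add: algebra_simps)
  qed
  have lt: "l = 1 / t - 1" "l0 = 1 / t0 - 1" "l1 = 1 / t1 - 1" using l by (auto simp: t)
  have lc: "l \<le> th * l0 + (1 - th) * l1"
  proof -
    have "convex_on {0<..} (\<lambda>x::real. inverse x)"
      by (rule convex_on_inverse) auto
    from convex_onD[OF this, of "1 - th" t0 t1] have "inverse t \<le> th * inverse t0 + (1 - th) * inverse t1"
      using th tt tc by simp
    then show ?thesis unfolding lt by (simp add: algebra_simps inverse_eq_divide)
  qed
  have sq: "(th * u + (1 - th) * w)\<^sup>2 \<le> th * u\<^sup>2 + (1 - th) * w\<^sup>2" for u w
  proof -
    have "th * u\<^sup>2 + (1 - th) * w\<^sup>2 - (th * u + (1 - th) * w)\<^sup>2 = th * (1 - th) * (u - w)\<^sup>2"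
      by (simp add: power2_eq_square algebra_simps)
    then show ?thesis using th by (smt (verit) mult_nonneg_nonneg zero_le_power2)
  qed
  have l2: "l\<^sup>2 \<le> th * l0\<^sup>2 + (1 - th) * l1\<^sup>2"
    using power_mono[OF lc, of 2] sq[of l0 l1] l by simp
  define x where "x = \<sigma>\<^sup>2 * m / d"
  have x: "0 \<le> x" using m d by (simp add: x_def)
  have S: "th * slack m \<sigma> p d l0 + (1 - th) * slack m \<sigma> p d l1 \<le> slack m \<sigma> p d l"
  proof -
    have sl: "slack m \<sigma> p d l = 2 - (2 + \<sigma>) * m - p * ((2 - 2 * m) * t + l - 1) - x * l\<^sup>2"
      "slack m \<sigma> p d l0 = 2 - (2 + \<sigma>) * m - p * ((2 - 2 * m) * t0 + l0 - 1) - x * l0\<^sup>2"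
      "slack m \<sigma> p d l1 = 2 - (2 + \<sigma>) * m - p * ((2 - 2 * m) * t1 + l1 - 1) - x * l1\<^sup>2"
      by (simp_all add: slack_def x_def t)
    have "th * slack m \<sigma> p d l0 + (1 - th) * slack m \<sigma> p d l1
        = 2 - (2 + \<sigma>) * m - p * ((2 - 2 * m) * t + (th * l0 + (1 - th) * l1) - 1) - x * (th * l0\<^sup>2 + (1 - th) * l1\<^sup>2)"
      unfolding sl tc by (simp add: algebra_simps)
    also have "\<dots> \<le> slack m \<sigma> p d l"
      unfolding sl using mult_left_mono[OF lc p] mult_left_mono[OF l2 x] by (simp add: algebra_simps)
    finally show ?thesis .
  qed
  have C: "cross m \<sigma> p d l \<le> th * cross m \<sigma> p d l0 + (1 - th) * cross m \<sigma> p d l1"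
  proof -
    let ?a = "\<lambda>t l. p * (1 - t) + x * l" and ?b = "\<lambda>t. p * t - 1"
    have cr: "cross m \<sigma> p d l = (?a t l)\<^sup>2 + (?b t)\<^sup>2" "cross m \<sigma> p d l0 = (?a t0 l0)\<^sup>2 + (?b t0)\<^sup>2"
      "cross m \<sigma> p d l1 = (?a t1 l1)\<^sup>2 + (?b t1)\<^sup>2" by (simp_all add: cross_def x_def t)
    have "?a t l \<le> th * ?a t0 l0 + (1 - th) * ?a t1 l1"
      using mult_left_mono[OF lc x] unfolding tc by (simp add: algebra_simps)
    moreover have "0 \<le> ?a t l"
      using p x l by (auto simp: t intro!: add_nonneg_nonneg mult_nonneg_nonneg)
    ultimately have "(?a t l)\<^sup>2 \<le> (th * ?a t0 l0 + (1 - th) * ?a t1 l1)\<^sup>2" by (intro power_mono) auto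
    also have "\<dots> \<le> th * (?a t0 l0)\<^sup>2 + (1 - th) * (?a t1 l1)\<^sup>2" by (rule sq)
    finally have 1: "(?a t l)\<^sup>2 \<le> th * (?a t0 l0)\<^sup>2 + (1 - th) * (?a t1 l1)\<^sup>2" .
    have "?b t = th * ?b t0 + (1 - th) * ?b t1" unfolding tc by (simp add: algebra_simps)
    then have 2: "(?b t)\<^sup>2 \<le> th * (?b t0)\<^sup>2 + (1 - th) * (?b t1)\<^sup>2" using sq by simp
    show ?thesis unfolding cr using 1 2 by (simp add: algebra_simps)
  qed
  have "B * cross m \<sigma> p d l \<le> B * (th * cross m \<sigma> p d l0 + (1 - th) * cross m \<sigma> p d l1)"
    using C B by (rule mult_left_mono)
  also have "\<dots> = th * (B * cross m \<sigma> p d l0) + (1 - th) * (B * cross m \<sigma> p d l1)" by (simp add: algebra_simps)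
  also have "\<dots> \<le> th * (T * slack m \<sigma> p d l0) + (1 - th) * (T * slack m \<sigma> p d l1)"
    using e0 e1 th by (intro add_mono mult_left_mono) auto
  also have "\<dots> = T * (th * slack m \<sigma> p d l0 + (1 - th) * slack m \<sigma> p d l1)" by (simp add: algebra_simps)
  also have "\<dots> \<le> T * slack m \<sigma> p d l" using S T by (rule mult_left_mono)
  finally show ?thesis .
qed

text \<open>With \<open>h = lam^2\<close>, the last conclusion compares the total variance
  coefficient of a step with the one permitted by the constant \<open>Bc\<close> of the theorem;
  \<open>h \<le> b * m\<close> reflects \<open>lam \<le> b * \<mu>\<close>.\<close>

lemma noise_bound:
  assumes adm: "admissible m s \<kappa> d x v y T" and m: "0 < m" "m \<le> 1/4" and l: "m \<le> l" "l \<le> 1/2 - m"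
    and b: "0 < b" "b < 1" and sg: "\<sigma> = s * (1 - b)"
    and P: "P = (1 + \<kappa>) * (3/2 - m) / (1 + l)" and ch: "ch = \<sigma>\<^sup>2 * m / d"
    and D2: "D2 = m * (2 - \<sigma> * (1 + 2 * m) - d)"
    and Sl: "Sl = 1 - \<sigma> * m - (P - 1) + 2 * (P - 1) * m - (P + ch) * l\<^sup>2"
    and c: "c = (P + ch)\<^sup>2 * l\<^sup>2 + (P - 1)\<^sup>2"
  shows "0 < Sl" "1 \<le> P" "0 < D2"
    "\<And>h. 0 \<le> h \<Longrightarrow> h \<le> b * m \<Longrightarrow> h / D2 + 4 * h * (P + ch + c / Sl) \<le> 2 + 8 * h"
proof -
  define p where "p = (1 + \<kappa>) * (3/2 - m)"
  note adm' = adm[unfolded admissible_def edge_conditions_def]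
  have s: "0 < s" and d: "0 < d" and \<kappa>: "0 < \<kappa>" and T: "26/25 \<le> T" using adm' by auto
  have sd: "s * (1 + 2 * m) + d \<le> 2" using adm' by simp
  have d2: "d < 2" using sd s m by (smt (verit) mult_pos_pos)
  have p: "0 \<le> p" "p \<le> 2 * (1 + m)" using adm' m \<kappa> by (auto simp: p_def)
  have Pp: "P = p / (1 + l)" by (simp add: P p_def)
  have Sl': "Sl = slack m \<sigma> p d l"
  proof -
    have e: "(1 + l) * P = p" using l m by (simp add: Pp)
    have "p * ((2 - 2 * m) / (1 + l) + l - 1) = (2 - 2 * m) * P + (l - 1) * p" by (simp add: Pp algebra_simps add_divide_distrib diff_divide_distrib)
    then have "slack m \<sigma> p d l = 2 - (2 + \<sigma>) * m - ((2 - 2 * m) * P + (l - 1) * p) - ch * l\<^sup>2" by (simp add: slack_def ch)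
    then show ?thesis unfolding Sl e[symmetric] by (simp add: power2_eq_square algebra_simps)
  qed
  have c': "c = cross m \<sigma> p d l"
  proof -
    have "1 - 1 / (1 + l) = l / (1 + l)" using l m by (simp add: field_simps)
    then have "cross m \<sigma> p d l = (P * l + ch * l)\<^sup>2 + (P - 1)\<^sup>2" by (simp add: cross_def Pp ch)
    then show ?thesis unfolding c by (simp add: power2_eq_square algebra_simps)
  qed
  define X where "X = s\<^sup>2 / d"
  have left: "4 * b * m * cross m \<sigma> p d m \<le> T * slack m \<sigma> p d m"
  proof -
    define Q where "Q = p / (1 + m)"
    have e: "p = (1 + m) * Q" using m by (simp add: Q_def)
    have sl: "left_slack m s \<kappa> d = (1 + m) * slack m s p d m"
    proof -
      have "p * ((2 - 2 * m) / (1 + m) + m - 1) = (2 - 2 * m) * Q + (m - 1) * p" by (simp add: Q_def algebra_simps add_divide_distrib diff_divide_distrib)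
      then have "slack m s p d m = 2 - (2 + s) * m - ((2 - 2 * m) * Q + (m - 1) * p) - X * m * m\<^sup>2" by (simp add: slack_def X_def)
      then show ?thesis unfolding left_slack_def X_def[symmetric] using e unfolding p_def by algebra
    qed
    have cr: "left_cross m \<kappa> = (1 + m)\<^sup>2 * ((p * m / (1 + m))\<^sup>2 + (p / (1 + m) - 1)\<^sup>2)"
    proof -
      have "left_cross m \<kappa> = (p * m)\<^sup>2 + (p - 1 - m)\<^sup>2" by (simp add: left_cross_def p_def mult.assoc)
      also have "\<dots> = (1 + m)\<^sup>2 * ((Q * m)\<^sup>2 + (Q - 1)\<^sup>2)" unfolding e by (simp add: power2_eq_square algebra_simps)
      finally show ?thesis by (simp add: Q_def)
    qed
    show ?thesis unfolding sg
    proof (rule slack_cross_endpoint[OF b m _ d T _ p(1) p(2) refl _ refl])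
      show "0 \<le> slack m s p d m" using adm' sl m by (simp add: zero_le_mult_iff)
      define V where "V = (p * m / (1 + m))\<^sup>2 + (p / (1 + m) - 1)\<^sup>2"
      have "left_mid m s \<kappa> d T = (1 + m)\<^sup>2 * (T * (slack m s p d m + 3/20 * (s * m) + 111/400 * (X * m * m\<^sup>2))
          - 3/5 * m * (V + 2 * Q * (X * m * m\<^sup>2) + X * m * (X * m * m\<^sup>2)))"
        unfolding left_mid_def sl cr V_def[symmetric] X_def[symmetric] using e unfolding p_def by algebra
      then show "3/5 * m * (V + 2 * (p / (1 + m)) * (s\<^sup>2 / d * m * m\<^sup>2) + s\<^sup>2 / d * m * (s\<^sup>2 / d * m * m\<^sup>2))
          \<le> T * (slack m s p d m + 3/20 * (s * m) + 111/400 * (s\<^sup>2 / d * m * m\<^sup>2))"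
        using adm' m by (simp add: X_def[symmetric] Q_def[symmetric] zero_le_mult_iff)
      have "left_end m s \<kappa> d T = (1 + m)\<^sup>2 * (T * (slack m s p d m + s * m + X * m * m\<^sup>2) - 4 * m * V)"
        unfolding left_end_def sl cr V_def[symmetric] X_def[symmetric] by algebra
      then show "4 * m * V \<le> T * (slack m s p d m + s * m + s\<^sup>2 / d * m * m\<^sup>2)"
        using adm' m by (simp add: X_def[symmetric] zero_le_mult_iff)
    qed (use m s in auto)
  qed
  have right: "4 * b * m * cross m \<sigma> p d (1/2 - m) \<le> T * slack m \<sigma> p d (1/2 - m)"
  proof -
    let ?l = "1/2 - m"
    have Q: "p / (1 + ?l) = 1 + \<kappa>" using m by (simp add: p_def)
    have sl: "right_slack m s \<kappa> d = slack m s p d ?l"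
    proof -
      have "p * ((2 - 2 * m) / (1 + ?l) + ?l - 1) = (2 - 2 * m) * (p / (1 + ?l)) + (?l - 1) * p" by (simp add: algebra_simps add_divide_distrib diff_divide_distrib)
      then have "slack m s p d ?l = 2 - (2 + s) * m - ((2 - 2 * m) * (1 + \<kappa>) + (?l - 1) * p) - X * m * ?l\<^sup>2" unfolding Q by (simp add: slack_def X_def)
      then show ?thesis unfolding right_slack_def X_def[symmetric] p_def by algebra
    qed
    have cr: "right_cross m \<kappa> = (p * ?l / (1 + ?l))\<^sup>2 + (p / (1 + ?l) - 1)\<^sup>2"
    proof -
      have "p * ?l / (1 + ?l) = (1 + \<kappa>) * ?l" using Q by (metis times_divide_eq_left)
      then show ?thesis unfolding Q by (simp add: right_cross_def)
    qed
    show ?thesis unfolding sg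
    proof (rule slack_cross_endpoint[OF b m _ d T _ p(1) _ refl _ refl])
      show "0 \<le> slack m s p d ?l" using adm' sl by simp
      have "right_mid m s \<kappa> d T = T * (slack m s p d ?l + 3/20 * (s * m) + 111/400 * (X * m * ?l\<^sup>2))
          - 3/5 * m * (right_cross m \<kappa> + 2 * (1 + \<kappa>) * (X * m * ?l\<^sup>2) + X * m * (X * m * ?l\<^sup>2))"
        unfolding right_mid_def sl X_def[symmetric] by algebra
      then show "3/5 * m * ((p * ?l / (1 + ?l))\<^sup>2 + (p / (1 + ?l) - 1)\<^sup>2 + 2 * (p / (1 + ?l)) * (s\<^sup>2 / d * m * ?l\<^sup>2) + s\<^sup>2 / d * m * (s\<^sup>2 / d * m * ?l\<^sup>2))
          \<le> T * (slack m s p d ?l + 3/20 * (s * m) + 111/400 * (s\<^sup>2 / d * m * ?l\<^sup>2))"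
        using adm' unfolding cr[symmetric] unfolding Q X_def[symmetric] by simp
      have "right_end m s \<kappa> d T = T * (slack m s p d ?l + s * m + X * m * ?l\<^sup>2) - 4 * m * right_cross m \<kappa>"
        unfolding right_end_def sl X_def[symmetric] by algebra
      then show "4 * m * ((p * ?l / (1 + ?l))\<^sup>2 + (p / (1 + ?l) - 1)\<^sup>2) \<le> T * (slack m s p d ?l + s * m + s\<^sup>2 / d * m * ?l\<^sup>2)"
        using adm' unfolding cr[symmetric] X_def[symmetric] by simp
      show "p \<le> 2 * (1 + ?l)" using p m by simp
    qed (use m s in auto)
  qed
  have main: "4 * b * m * c \<le> T * Sl" unfolding c' Sl'
    by (rule slack_cross_interval[OF l _ p(1) _ _ d _ _ left right]) (use m b T in auto)
  have Pge: "1 + \<kappa> \<le> P"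
  proof -
    have "(1 + \<kappa>) * (1 + l) \<le> p" unfolding p_def using \<kappa> l by (intro mult_left_mono) auto
    then show ?thesis unfolding Pp using l m by (simp add: field_simps)
  qed
  then show P1: "1 \<le> P" using \<kappa> by simp
  have ch0: "0 \<le> ch" using m d by (simp add: ch)
  have "0 < (P + ch)\<^sup>2 * l\<^sup>2" using P1 ch0 l m by (intro mult_pos_pos) auto
  then have c0: "0 < c" by (simp add: c add_pos_nonneg)
  then have "0 < T * Sl" using main b m by (smt (verit) mult_pos_pos)
  then show Sl0: "0 < Sl" using T by (simp add: zero_less_mult_iff)
  have P2: "P \<le> 2" unfolding Pp using p l m by (simp add: divide_simps)
  have g: "b * (2 - d) \<le> 2 - \<sigma> * (1 + 2 * m) - d"
    using mult_left_mono[OF sd, of "1 - b"] b by (simp add: sg algebra_simps)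
  have bd: "0 < b * (2 - d)" using b d2 by simp
  then show D20: "0 < D2" unfolding D2 using g m by simp
  fix h assume h: "0 \<le> h" "h \<le> b * m"
  \<comment> \<open>The claim reads \<open>h * E \<le> 2\<close>, the \<open>- 2\<close> beside
    \<open>P\<close> accounting for \<open>8 * h\<close>. Being linear in \<open>h\<close>, it only
    needs \<open>h = b * m\<close>.\<close>
  define E where "E = 1 / D2 + 4 * (P - 2 + ch + c / Sl)"
  have "b * m * E = b * m / D2 + 4 * b * m * (P - 2) + 4 * b * m * ch + 4 * b * m * c / Sl"
    by (simp add: E_def algebra_simps)
  also have "b * m / D2 \<le> 1 / (2 - d)"
  proof -
    have "b * m * (2 - d) \<le> D2" unfolding D2 using mult_left_mono[OF g, of m] m by (simp add: algebra_simps)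
    then show ?thesis using D20 d2 by (simp add: field_simps)
  qed
  also have "4 * b * m * (P - 2) \<le> 0" using b m P2 by (simp add: mult_nonneg_nonpos)
  also have "4 * b * m * ch \<le> 16/27 * s\<^sup>2 * m\<^sup>2 / d"
  proof -
    \<comment> \<open>Again the maximum 4/27 of \<open>b * (1 - b)^2\<close>; four times it is the
      16/27 in \<open>admissible\<close>.\<close>
    have "0 \<le> (b - 1/3)\<^sup>2 * (4/3 - b)" using b by simp
    then have "4 * (b * (1 - b)\<^sup>2) \<le> 16/27" by (simp add: power2_eq_square algebra_simps)
    then have "4 * (b * (1 - b)\<^sup>2) * (s\<^sup>2 * m\<^sup>2 / d) \<le> 16/27 * (s\<^sup>2 * m\<^sup>2 / d)"
      using d by (intro mult_right_mono) auto
    then show ?thesis by (simp add: ch sg power2_eq_square mult_ac)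
  qed
  also have "4 * b * m * c / Sl \<le> T" using main Sl0 by (simp add: field_simps)
  finally have "b * m * E \<le> 2" using adm' by simp
  moreover have "h * E \<le> max 0 (b * m * E)"
    using h mult_right_mono[OF h(2), of E] by (cases "0 \<le> E") (auto simp: mult_nonneg_nonpos le_max_iff_disj)
  ultimately have "h * E \<le> 2" by simp
  then show "h / D2 + 4 * h * (P + ch + c / Sl) \<le> 2 + 8 * h" by (simp add: E_def algebra_simps)
qed

section \<open>Lyapunov function\<close>

lemma inner_young:
  fixes x y :: "'h::real_inner"
  assumes "0 < c"
  shows "- (norm y)\<^sup>2 / c \<le> c * (norm x)\<^sup>2 + 2 * inner x y"
proof -
  have "0 \<le> (norm (c *\<^sub>R x + y))\<^sup>2 / c" using assms by simp
  also have "\<dots> = c * (norm x)\<^sup>2 + 2 * inner x y + (norm y)\<^sup>2 / c"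
    using assms by (simp add: power2_norm_eq_inner inner_simps inner_commute field_simps)
  finally show ?thesis by simp
qed

lemma norm_diff_scaled_lower:
  fixes w v :: "'h::real_inner"
  assumes "0 < t"
  shows "(1 - t) * (norm w)\<^sup>2 - (1 / t - 1) * r\<^sup>2 * (norm v)\<^sup>2 \<le> (norm (w - r *\<^sub>R v))\<^sup>2"
proof -
  have "0 \<le> (norm (t *\<^sub>R w - r *\<^sub>R v))\<^sup>2 / t" using assms by simp
  also have "\<dots> = t * (norm w)\<^sup>2 - 2 * r * inner w v + r\<^sup>2 / t * (norm v)\<^sup>2"
    using assms by (simp only: power2_norm_eq_inner inner_simps inner_commute[of v w])
      (simp add: power2_eq_square field_simps)
  also have "\<dots> = (norm (w - r *\<^sub>R v))\<^sup>2 - ((1 - t) * (norm w)\<^sup>2 - (1 / t - 1) * r\<^sup>2 * (norm v)\<^sup>2)"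
    by (simp only: power2_norm_eq_inner inner_simps inner_commute[of v w])
      (simp add: power2_eq_square algebra_simps)
  finally show ?thesis by simp
qed

text \<open>Along the iteration the weights below are used with \<open>S = \<alpha> / (1 - \<alpha>)\<close>, so that
  \<open>1 + S = 1 / (1 - \<alpha>)\<close>.\<close>

definition lyapunov :: "real \<Rightarrow> real \<Rightarrow> 'h \<Rightarrow> 'h \<Rightarrow> 'h::real_inner \<Rightarrow> real" where
  "lyapunov S Q xbar x x' = (norm (x' - xbar + S *\<^sub>R (x' - x)))\<^sup>2 + Q * (norm (x' - x))\<^sup>2"

text \<open>Multiplying \<open>step\<close> by \<open>g = 1 + S\<close> and subtracting
  \<open>g - 1\<close> times the squared norm of \<open>x1 - xbar\<close> turns both sides into
  Lyapunov functions: \<open>g * a = S\<close> settles the right side, the choice of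
  \<open>potential\<close> the left one. What \<kappa> leaves over,
  \<open>\<kappa> * (4 + 5 * S) / 4\<close>, is a gain in the velocity weight.\<close>

lemma lyapunov_inertial_step:
  fixes x0 x1 x2 z xbar :: "'h::real_inner"
  assumes a: "0 < a" "a < 1" and \<kappa>: "0 \<le> \<kappa>" and S: "S = a / (1 - a)"
    and z: "z = x1 + a *\<^sub>R (x1 - x0)"
    and Q: "Q = potential S \<kappa>"
    and step: "(norm (x2 - xbar))\<^sup>2 \<le> (1 - t) * (norm (z - xbar))\<^sup>2
        - (a\<^sup>2 + a + \<kappa> * (1 + a / 4)) / (1 - a)\<^sup>2 * (norm (x2 - z))\<^sup>2 + n"
  shows "lyapunov S Q xbar x1 x2 \<le> lyapunov S (Q - \<kappa> * (4 + 5 * S) / 4) xbar x0 x1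
      - (1 + S) * t * (norm (z - xbar))\<^sup>2 + (1 + S) * n"
proof -
  define g where "g = 1 + S"
  have g: "g = 1 / (1 - a)" "0 < g" using a by (auto simp: g_def S field_simps)
  have ag: "a * g = g - 1" using g a by (simp add: field_simps)
  have ga: "a * g = g - 1" "S = g - 1" using ag by (auto simp: g_def)
  define c where "c = (a\<^sup>2 + a + \<kappa> * (1 + a / 4)) * g\<^sup>2"
  define X v w where "X = x1 - xbar" and "v = x1 - x0" and "w = x2 - x1"
  have "(norm (w - a *\<^sub>R v))\<^sup>2 = (1 - a) * (norm w)\<^sup>2 - a * (1 - a) * (norm v)\<^sup>2 + a * (norm (w - v))\<^sup>2"
    by (simp only: power2_norm_eq_inner inner_simps inner_commute[of v w])
      (simp add: power2_eq_square algebra_simps)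
  \<comment> \<open>Drops \<open>a\<close> times the squared norm of \<open>w - v\<close>, so that
    no mixed velocity term survives.\<close>
  then have wv: "(1 - a) * (norm w)\<^sup>2 - a * (1 - a) * (norm v)\<^sup>2 \<le> (norm (w - a *\<^sub>R v))\<^sup>2"
    using a by simp
  have Qc: "c = g\<^sup>2 - g + Q"
    unfolding c_def Q potential_def ga(2) using ag by algebra
  have step': "(norm (X + w))\<^sup>2 \<le> (1 - t) * (norm (X + a *\<^sub>R v))\<^sup>2 - c * (norm (w - a *\<^sub>R v))\<^sup>2 + n"
  proof -
    have "x2 - xbar = X + w" "z - xbar = X + a *\<^sub>R v" "x2 - z = w - a *\<^sub>R v"
      by (auto simp: X_def w_def v_def z algebra_simps)
    then show ?thesis using step by (simp add: c_def g power_divide)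
  qed
  have id1: "lyapunov S Q xbar x1 x2 = g * (norm (X + w))\<^sup>2 - (g - 1) * (norm X)\<^sup>2 + c * (norm w)\<^sup>2"
  proof -
    have "x2 - xbar + S *\<^sub>R (x2 - x1) = X + g *\<^sub>R w" by (simp add: g_def X_def w_def algebra_simps)
    then have "lyapunov S Q xbar x1 x2 = (norm (X + g *\<^sub>R w))\<^sup>2 + Q * (norm w)\<^sup>2" by (simp add: lyapunov_def w_def)
    also have "\<dots> = g * (norm (X + w))\<^sup>2 - (g - 1) * (norm X)\<^sup>2 + c * (norm w)\<^sup>2"
      unfolding Qc by (simp only: power2_norm_eq_inner inner_simps inner_commute[of w X])
        (simp add: power2_eq_square algebra_simps)
    finally show ?thesis .
  qed
  have gS: "g * a = S" using ga by (simp add: mult.commute)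
  have id2: "g * (norm (X + a *\<^sub>R v))\<^sup>2 - (g - 1) * (norm X)\<^sup>2 + c * a * (norm v)\<^sup>2
      = lyapunov S (Q - \<kappa> * (4 + 5 * S) / 4) xbar x0 x1"
  proof -
    have "lyapunov S (Q - \<kappa> * (4 + 5 * S) / 4) xbar x0 x1
        = (norm (X + S *\<^sub>R v))\<^sup>2 + (Q - \<kappa> * (4 + 5 * S) / 4) * (norm v)\<^sup>2"
      by (simp add: lyapunov_def X_def v_def)
    also have "\<dots> = (norm X)\<^sup>2 + 2 * S * inner X v + (S\<^sup>2 + (Q - \<kappa> * (4 + 5 * S) / 4)) * (norm v)\<^sup>2"
      by (simp only: power2_norm_eq_inner inner_simps inner_commute[of v X])
        (simp add: power2_eq_square algebra_simps)
    also have "S\<^sup>2 + (Q - \<kappa> * (4 + 5 * S) / 4) = g * a\<^sup>2 + c * a"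
      unfolding Qc Q potential_def ga(2) using ag by algebra
    also have "(norm X)\<^sup>2 + 2 * S * inner X v + (g * a\<^sup>2 + c * a) * (norm v)\<^sup>2
        = g * (norm (X + a *\<^sub>R v))\<^sup>2 - (g - 1) * (norm X)\<^sup>2 + c * a * (norm v)\<^sup>2"
      unfolding gS[symmetric] by (simp only: power2_norm_eq_inner inner_simps inner_commute[of v X])
        (simp add: power2_eq_square algebra_simps)
    finally show ?thesis by simp
  qed
  have zX: "z - xbar = X + a *\<^sub>R v" by (simp add: X_def v_def z)
  have c0: "0 \<le> c" using a \<kappa> by (simp add: c_def)
  have gc: "g * c * ((1 - a) * (norm w)\<^sup>2) = c * (norm w)\<^sup>2" "g * c * (a * (1 - a) * (norm v)\<^sup>2) = c * a * (norm v)\<^sup>2"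
    using g a by simp_all
  have "g * ((norm (X + w))\<^sup>2) \<le> g * ((1 - t) * (norm (X + a *\<^sub>R v))\<^sup>2 - c * (norm (w - a *\<^sub>R v))\<^sup>2 + n)"
    using step' g by (intro mult_left_mono) auto
  moreover have "g * c * ((1 - a) * (norm w)\<^sup>2 - a * (1 - a) * (norm v)\<^sup>2) \<le> g * c * (norm (w - a *\<^sub>R v))\<^sup>2"
    using wv g c0 by (intro mult_left_mono) auto
  ultimately show ?thesis
    using gc unfolding id1 id2[symmetric] zX g_def[symmetric] by (simp add: algebra_simps)
qed

lemma potential_bounds:
  assumes "0 \<le> S" "0 < \<kappa>"
  shows "S\<^sup>2 + \<kappa> \<le> potential S \<kappa>"
proof -
  have "5 * (1 + S)\<^sup>2 - (1 + S) = 4 + 9 * S + 5 * S\<^sup>2" by (simp add: power2_eq_square algebra_simps)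
  then have "4 \<le> 5 * (1 + S)\<^sup>2 - (1 + S)" using assms by simp
  from mult_left_mono[OF this, of "\<kappa> / 4"] show ?thesis using assms by (simp add: potential_def)
qed

text \<open>The decrease is measured at \<open>z\<close>, and
  \<open>z - xbar = w - (a * S) *\<^sub>R v\<close>. Passing to \<open>w\<close> costs velocity
  terms. They are paid from \<open>\<kappa> * (2 + 5 * S) / 4\<close>, the difference between the
  gain of the inertial step and the \<open>\<kappa> / 2\<close> kept for the jump.\<close>

lemma lyapunov_contraction:
  fixes x0 x1 x2 z xbar :: "'h::real_inner"
  assumes a: "0 < a" "a < 1" and \<kappa>: "0 < \<kappa>" and S: "S = a / (1 - a)"
    and z: "z = x1 + a *\<^sub>R (x1 - x0)"
    and Q: "Q = potential S \<kappa>"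
    and step: "(norm (x2 - xbar))\<^sup>2 \<le> (1 - t) * (norm (z - xbar))\<^sup>2
        - (a\<^sup>2 + a + \<kappa> * (1 + a / 4)) / (1 - a)\<^sup>2 * (norm (x2 - z))\<^sup>2 + n"
    and t: "0 \<le> t" "(1 + S) * t * (2 * a\<^sup>2 - 1/2 * a + 1) \<le> y * (1 - a)"
    and gap: "0 \<le> rate_gap a \<kappa> y"
  shows "lyapunov S Q xbar x1 x2
      \<le> (1 - (1 + S) * t * (1 - a\<^sup>2 / 5)) * lyapunov S (Q - \<kappa> / 2) xbar x0 x1 + (1 + S) * n"
proof -
  define \<gamma> w v where "\<gamma> = (1 + S) * t" and "w = x1 - xbar + S *\<^sub>R (x1 - x0)" and "v = x1 - x0"
  define den where "den = 2 * a\<^sup>2 - 1/2 * a + 1"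
  have S0: "0 < S" using a by (simp add: S)
  have Sa: "S * (1 - a) = a" using a by (simp add: S)
  have \<gamma>: "0 \<le> \<gamma>" using t S0 by (simp add: \<gamma>_def)
  have den: "0 < den"
  proof -
    have "den = 2 * (a - 1/8)\<^sup>2 + 31/32" by (simp add: den_def power2_eq_square algebra_simps)
    then show ?thesis by (simp add: add_nonneg_pos)
  qed
  have zw: "z - xbar = w - (a * S) *\<^sub>R v"
  proof -
    have "a = S - a * S" using Sa by (simp add: algebra_simps)
    then have "a *\<^sub>R v = S *\<^sub>R v - (a * S) *\<^sub>R v" by (metis scaleR_left_diff_distrib)
    then show ?thesis by (simp add: z w_def v_def)
  qed
  \<comment> \<open>The Young parameter is proportional to \<open>a^2\<close> because
    \<open>v\<close> enters with the factor \<open>a * S\<close>: the velocity cost becomes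
    \<open>(5 - a^2) * S^2\<close>, and the drift loses only the factor
    \<open>1 - a^2 / 5\<close>.\<close>
  have "(1 - a\<^sup>2 / 5) * (norm w)\<^sup>2 - (1 / (a\<^sup>2 / 5) - 1) * (a * S)\<^sup>2 * (norm v)\<^sup>2 \<le> (norm (z - xbar))\<^sup>2"
    unfolding zw by (rule norm_diff_scaled_lower) (use a in simp)
  also have "(1 / (a\<^sup>2 / 5) - 1) * (a * S)\<^sup>2 = (5 - a\<^sup>2) * S\<^sup>2"
    using a by (simp add: power_mult_distrib field_simps)
  finally have low: "\<gamma> * ((1 - a\<^sup>2 / 5) * (norm w)\<^sup>2 - (5 - a\<^sup>2) * S\<^sup>2 * (norm v)\<^sup>2) \<le> \<gamma> * (norm (z - xbar))\<^sup>2"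
    using \<gamma> by (rule mult_left_mono)
  define R where "R = (1 - a\<^sup>2 / 5) * (Q - \<kappa> / 2) + (5 - a\<^sup>2) * S\<^sup>2"
  have a2: "a\<^sup>2 < 1" using a by (simp add: abs_square_less_1)
  have "0 \<le> Q - \<kappa> / 2"
    using potential_bounds[of S \<kappa>] zero_le_power2[of S] S0 \<kappa> unfolding Q by linarith
  then have "0 \<le> R" unfolding R_def using a2 by (intro add_nonneg_nonneg mult_nonneg_nonneg) auto
  have coef: "\<gamma> * R \<le> \<kappa> * (2 + 5 * S) / 4"
  proof -
    have R': "R * (1 - a)\<^sup>2 = (1 - 1/5 * a\<^sup>2) * (a\<^sup>2 + \<kappa> * (1 + 1/4 * a) - \<kappa> / 2 * (1 - a)\<^sup>2) + 5 * a\<^sup>2 - a ^ 4"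
    proof -
      have e: "S\<^sup>2 * (1 - a)\<^sup>2 = a\<^sup>2" "(1 + S) * (1 - a) = 1" "(1 + S)\<^sup>2 * (1 - a)\<^sup>2 = 1"
        using Sa by (simp_all flip: power_mult_distrib) (simp_all add: algebra_simps)
      have "R * (1 - a)\<^sup>2 = (1 - 1/5 * a\<^sup>2) * (S\<^sup>2 * (1 - a)\<^sup>2 + \<kappa> / 4 * (5 * ((1 + S)\<^sup>2 * (1 - a)\<^sup>2)
          - (1 + S) * (1 - a) * (1 - a)) - \<kappa> / 2 * (1 - a)\<^sup>2) + (5 - a\<^sup>2) * (S\<^sup>2 * (1 - a)\<^sup>2)"
        unfolding R_def Q potential_def by algebra
      also have "\<dots> = (1 - 1/5 * a\<^sup>2) * (a\<^sup>2 + \<kappa> * (1 + 1/4 * a) - \<kappa> / 2 * (1 - a)\<^sup>2) + 5 * a\<^sup>2 - a ^ 4"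
      proof -
        have "\<kappa> / 4 * (5 * 1 - 1 * (1 - a)) = \<kappa> * (1 + 1/4 * a)" by (simp add: field_simps)
        moreover have "(5 - a\<^sup>2) * a\<^sup>2 = 5 * a\<^sup>2 - a ^ 4" by (simp add: eval_nat_numeral algebra_simps)
        ultimately show ?thesis unfolding e by simp
      qed
      finally show ?thesis .
    qed
    have "\<gamma> * den * R * (1 - a)\<^sup>2 \<le> y * (1 - a) * (R * (1 - a)\<^sup>2)"
    proof -
      have "\<gamma> * den * (R * (1 - a)\<^sup>2) \<le> y * (1 - a) * (R * (1 - a)\<^sup>2)"
        unfolding \<gamma>_def den_def using t(2) \<open>0 \<le> R\<close> by (intro mult_right_mono) auto
      then show ?thesis by (simp only: mult.assoc)
    qed
    also have "\<dots> = (1 - a) * (y * (R * (1 - a)\<^sup>2))" by simp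
    also have "\<dots> \<le> (1 - a) * (\<kappa> * (den * (1/2 + 3/4 * a)))"
      using gap a unfolding rate_gap_def R' den_def by (intro mult_left_mono) simp_all
    also have "\<dots> = den * (\<kappa> * (2 + 5 * S) / 4) * (1 - a)\<^sup>2"
    proof -
      have e: "(2 + 5 * S) * (1 - a) = 2 + 3 * a" using Sa by (simp add: algebra_simps)
      have "den * (\<kappa> * (2 + 5 * S) / 4) * (1 - a)\<^sup>2 = den * \<kappa> / 4 * (1 - a) * ((2 + 5 * S) * (1 - a))"
        by (simp add: power2_eq_square)
      also have "\<dots> = (1 - a) * (\<kappa> * (den * (1/2 + 3/4 * a)))" unfolding e by (simp add: field_simps)
      finally show ?thesis by (rule sym)
    qed
    finally have "(den * (1 - a)\<^sup>2) * (\<gamma> * R) \<le> (den * (1 - a)\<^sup>2) * (\<kappa> * (2 + 5 * S) / 4)"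
      by (simp only: mult_ac)
    moreover have "0 < den * (1 - a)\<^sup>2" using den a by simp
    ultimately show ?thesis by (simp only: mult_le_cancel_left_pos)
  qed
  have "lyapunov S Q xbar x1 x2 \<le> lyapunov S (Q - \<kappa> * (4 + 5 * S) / 4) xbar x0 x1
      - \<gamma> * (norm (z - xbar))\<^sup>2 + (1 + S) * n"
    unfolding \<gamma>_def using lyapunov_inertial_step[OF a _ S z Q step] \<kappa> by simp
  also have "\<dots> \<le> (1 - \<gamma> * (1 - a\<^sup>2 / 5)) * lyapunov S (Q - \<kappa> / 2) xbar x0 x1 + (1 + S) * n"
  proof -
    have "\<gamma> * R * (norm v)\<^sup>2 \<le> \<kappa> * (2 + 5 * S) / 4 * (norm v)\<^sup>2" using coef by (rule mult_right_mono) simp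
    moreover have ly: "lyapunov S r xbar x0 x1 = (norm w)\<^sup>2 + r * (norm v)\<^sup>2" for r
      by (simp add: lyapunov_def w_def v_def)
    moreover define c1 c2 where "c1 = 1 - a\<^sup>2 / 5" and "c2 = (5 - a\<^sup>2) * S\<^sup>2"
    ultimately show ?thesis using low unfolding ly R_def c1_def[symmetric] c2_def[symmetric]
      by (simp add: algebra_simps add_divide_distrib diff_divide_distrib)
  qed
  finally show ?thesis by (simp add: \<gamma>_def)
qed

text \<open>Changing \<open>S\<close> moves \<open>w\<close> by \<open>d *\<^sub>R v\<close>. For
  \<open>y > 1\<close> Young's inequality with parameter \<open>y - 1\<close> absorbs the mixed
  term, and \<open>jump_condition\<close> is what its cost requires; for \<open>y = 1\<close>
  nothing moves.\<close>

lemma lyapunov_jump: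
  fixes x0 x1 xbar :: "'h::real_inner"
  assumes jump: "jump_condition \<kappa> x" and S: "0 \<le> S" and t: "0 \<le> t" and S': "S' = S + t + t * S"
    and \<kappa>: "0 < \<kappa>"
  shows "lyapunov S' (potential S' \<kappa> - \<kappa> / 2) xbar x0 x1
      \<le> (1 + t) powr x * lyapunov S (potential S \<kappa>) xbar x0 x1"
proof -
  define w v d where "w = x1 - xbar + S *\<^sub>R (x1 - x0)" and "v = x1 - x0" and "d = t * (1 + S)"
  define Q' where "Q' = potential S' \<kappa> - \<kappa> / 2"
  obtain y where y: "1 \<le> y" "y \<le> (1 + t) powr x" "y = 1 \<longrightarrow> t = 0"
    "d\<^sup>2 \<le> (y - 1) * (y * potential S \<kappa> - d\<^sup>2 - Q')"
    using jump S t unfolding jump_condition_def d_def Q'_def S' by blast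
  have nn: "0 \<le> lyapunov S (potential S \<kappa>) xbar x0 x1"
    using potential_bounds[OF S \<kappa>] \<kappa> by (auto simp: lyapunov_def intro!: add_nonneg_nonneg mult_nonneg_nonneg order_trans[OF _ potential_bounds[OF S \<kappa>]])
  have "x1 - xbar + S' *\<^sub>R (x1 - x0) = w + d *\<^sub>R v" by (simp add: S' w_def v_def d_def algebra_simps)
  then have "lyapunov S' Q' xbar x0 x1 = (norm (w + d *\<^sub>R v))\<^sup>2 + Q' * (norm v)\<^sup>2" by (simp add: lyapunov_def v_def)
  also have "\<dots> \<le> y * ((norm w)\<^sup>2 + potential S \<kappa> * (norm v)\<^sup>2)"
  proof (cases "y = 1")
    case True
    then have "t = 0" using y by simp
    then show ?thesis using True \<kappa> by (simp add: d_def Q'_def S' algebra_simps)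
  next
    case False
    then have "0 < y - 1" using y by simp
    from inner_young[OF this, of "- (d *\<^sub>R v)" w]
    have "2 * d * inner w v \<le> (y - 1) * (norm w)\<^sup>2 + d\<^sup>2 * (norm v)\<^sup>2 / (y - 1)"
      by (simp add: power_mult_distrib)
    also have "d\<^sup>2 * (norm v)\<^sup>2 / (y - 1) \<le> (y * potential S \<kappa> - d\<^sup>2 - Q') * (norm v)\<^sup>2"
      using mult_right_mono[OF y(4), of "(norm v)\<^sup>2"] \<open>0 < y - 1\<close> by (simp add: divide_le_eq mult_ac)
    moreover have "(norm (w + d *\<^sub>R v))\<^sup>2 = (norm w)\<^sup>2 + 2 * d * inner w v + d\<^sup>2 * (norm v)\<^sup>2"
      by (simp only: power2_norm_eq_inner inner_simps inner_commute[of v w])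
        (simp add: power2_eq_square algebra_simps)
    ultimately show ?thesis by (simp add: algebra_simps)
  qed
  also have "\<dots> = y * lyapunov S (potential S \<kappa>) xbar x0 x1" by (simp add: lyapunov_def w_def v_def)
  also have "\<dots> \<le> (1 + t) powr x * lyapunov S (potential S \<kappa>) xbar x0 x1"
    using y(2) nn by (rule mult_right_mono)
  finally show ?thesis by (simp add: Q'_def)
qed

text \<open>Cauchy-Schwarz for \<open>x1 - xbar = w - S *\<^sub>R v\<close> in the norm with weights
  1 and \<open>Q\<close>.\<close>

lemma norm_le_lyapunov:
  fixes x0 x1 xbar :: "'h::real_inner"
  assumes "0 < Q"
  shows "(norm (x1 - xbar))\<^sup>2 \<le> (1 + S\<^sup>2 / Q) * lyapunov S Q xbar x0 x1"
proof -
  define w v where "w = x1 - xbar + S *\<^sub>R (x1 - x0)" and "v = x1 - x0"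
  have "x1 - xbar = w - S *\<^sub>R v" by (simp add: w_def v_def)
  then have "(norm (x1 - xbar))\<^sup>2 = (norm w)\<^sup>2 - 2 * S * inner w v + S\<^sup>2 * (norm v)\<^sup>2"
    by (simp only: power2_norm_eq_inner inner_simps inner_commute[of v w])
      (simp add: power2_eq_square algebra_simps)
  moreover have "0 \<le> (norm (S *\<^sub>R w + Q *\<^sub>R v))\<^sup>2 / Q" using assms by simp
  moreover have "(norm (S *\<^sub>R w + Q *\<^sub>R v))\<^sup>2 / Q = S\<^sup>2 / Q * (norm w)\<^sup>2 + 2 * S * inner w v + Q * (norm v)\<^sup>2"
    using assms by (simp only: power2_norm_eq_inner inner_simps inner_commute[of v w])
      (simp add: power2_eq_square field_simps)
  moreover have "(1 + S\<^sup>2 / Q) * lyapunov S Q xbar x0 x1 = (norm w)\<^sup>2 + S\<^sup>2 / Q * (norm w)\<^sup>2 + Q * (norm v)\<^sup>2 + S\<^sup>2 * (norm v)\<^sup>2"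
    using assms by (simp add: lyapunov_def w_def v_def algebra_simps)
  ultimately show ?thesis by linarith
qed

text \<open>The Pade approximant of type [2/1] of \<open>ln\<close> at 1. It agrees with
  \<open>ln\<close> at 1, and the derivative of the difference is a nonnegative multiple of
  \<open>(x - 1) ^ 3\<close>.\<close>

lemma ln_le_pade:
  assumes "1 \<le> (g::real)"
  shows "ln g \<le> (g - 1) * (g + 5) / (4 * g + 2)"
proof -
  let ?f = "\<lambda>g::real. (g - 1) * (g + 5) / (4 * g + 2) - ln g"
  have "?f 1 \<le> ?f g"
  proof (rule DERIV_nonneg_imp_nondecreasing[OF assms])
    fix x :: real assume x: "1 \<le> x"
    have d: "(?f has_real_derivative (((g + 5) * 1 + (g - 1) * 1) * (4 * g + 2) - (g - 1) * (g + 5) * 4) / (4 * g + 2)\<^sup>2 - 1 / g) (at g)"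
      if "1 \<le> g" for g
      using that by (auto intro!: derivative_eq_intros simp: power2_eq_square field_simps)
    have e: "(((x + 5) * 1 + (x - 1) * 1) * (4 * x + 2) - (x - 1) * (x + 5) * 4) / (4 * x + 2)\<^sup>2 - 1 / x
        = 4 * (x - 1) ^ 3 / (x * (4 * x + 2)\<^sup>2)"
      using x by (simp add: divide_simps) (simp add: power2_eq_square power3_eq_cube algebra_simps)
    have nn: "0 \<le> 4 * (x - 1) ^ 3 / (x * (4 * x + 2)\<^sup>2)" using x by simp
    show "\<exists>y. (?f has_real_derivative y) (at x) \<and> 0 \<le> y" using d[OF x] nn unfolding e by blast
  qed
  then show ?thesis by simp
qed

text \<open>Type [2/2] at 1; here the derivative of the difference is a nonnegative multiple of
  \<open>(x - 1) ^ 4\<close>.\<close>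

lemma pade_le_ln:
  assumes "1 \<le> (g::real)"
  shows "3 * (g\<^sup>2 - 1) / (g\<^sup>2 + 4 * g + 1) \<le> ln g"
proof -
  let ?f = "\<lambda>g::real. ln g - 3 * (g\<^sup>2 - 1) / (g\<^sup>2 + 4 * g + 1)"
  have "?f 1 \<le> ?f g"
  proof (rule DERIV_nonneg_imp_nondecreasing[OF assms])
    fix x :: real assume x: "1 \<le> x"
    have pos: "0 < x\<^sup>2 + 4 * x + 1" using x by (simp add: add_nonneg_pos)
    have d: "(?f has_real_derivative 1 / x - (3 * (2 * x) * (x\<^sup>2 + 4 * x + 1) - 3 * (x\<^sup>2 - 1) * (2 * x + 4)) / (x\<^sup>2 + 4 * x + 1)\<^sup>2) (at x)"
      using x pos by (auto intro!: derivative_eq_intros simp: power2_eq_square)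
    have e: "1 / x - (3 * (2 * x) * (x\<^sup>2 + 4 * x + 1) - 3 * (x\<^sup>2 - 1) * (2 * x + 4)) / (x\<^sup>2 + 4 * x + 1)\<^sup>2
        = (x - 1) ^ 4 / (x * (x\<^sup>2 + 4 * x + 1)\<^sup>2)"
      using x pos by (simp add: divide_simps) (simp add: eval_nat_numeral algebra_simps)
    have nn: "0 \<le> (x - 1) ^ 4 / (x * (x\<^sup>2 + 4 * x + 1)\<^sup>2)" using x by simp
    show "\<exists>y. (?f has_real_derivative y) (at x) \<and> 0 \<le> y" using d nn unfolding e by blast
  qed
  then show ?thesis by simp
qed

lemma lift_factor_bounds:
  assumes S: "0 \<le> S" and \<kappa>: "0 < \<kappa>" and v: "0 \<le> v" and gap: "0 \<le> lift_gap S \<kappa> v"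
  shows "ln (1 + S\<^sup>2 / potential S \<kappa>) \<le> v * ln (1 + S)" "S\<^sup>2 / potential S \<kappa> \<le> 1"
proof -
  define Q g where "Q = potential S \<kappa>" and "g = 1 + S"
  have Q: "S\<^sup>2 \<le> Q" "0 < Q" using potential_bounds[OF S \<kappa>] \<kappa> zero_le_power2[of S] unfolding Q_def by linarith+
  then show "S\<^sup>2 / potential S \<kappa> \<le> 1" by (simp add: Q_def)
  have z: "0 \<le> S\<^sup>2 / Q" using Q by simp
  have "ln (1 + S\<^sup>2 / Q) \<le> (S\<^sup>2 / Q) * (S\<^sup>2 / Q + 6) / (4 * (S\<^sup>2 / Q) + 6)"
    using ln_le_pade[of "1 + S\<^sup>2 / Q"] z by (simp add: add.commute)
  also have "\<dots> = S\<^sup>2 * (6 * Q + S\<^sup>2) / (Q * (6 * Q + 4 * S\<^sup>2))"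
    using Q by (simp add: divide_simps add_pos_nonneg add_nonneg_eq_0_iff) (simp add: algebra_simps)
  also have "\<dots> \<le> v * (3 * (g\<^sup>2 - 1) / (g\<^sup>2 + 4 * g + 1))"
  proof -
    have "0 < Q * (6 * Q + 4 * S\<^sup>2)" using Q by (simp add: add_pos_nonneg)
    moreover have "0 < g\<^sup>2 + 4 * g + 1" 
    proof -
      have "1 \<le> g" using S by (simp add: g_def)
      then show ?thesis using zero_le_power2[of g] by linarith
    qed
    moreover have "S\<^sup>2 * (6 * Q + S\<^sup>2) * (g\<^sup>2 + 4 * g + 1) \<le> v * (3 * (g\<^sup>2 - 1)) * (Q * (6 * Q + 4 * S\<^sup>2))"
    proof -
      have "g\<^sup>2 - 1 = S * (2 + S)" by (simp add: g_def power2_eq_square algebra_simps)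
      then have eq: "v * (3 * (g\<^sup>2 - 1)) * (Q * (6 * Q + 4 * S\<^sup>2)) = 3 * v * ((S * (2 + S)) * (Q * (6 * Q + 4 * S\<^sup>2)))"
        by simp
      then show ?thesis using gap unfolding lift_gap_def Q_def[symmetric] g_def[symmetric] eq
        by (simp only: diff_ge_0_iff_ge mult.assoc)
    qed
    ultimately show ?thesis by (simp add: divide_simps)
  qed
  also have "\<dots> \<le> v * ln g" using pade_le_ln[of g] v S by (intro mult_left_mono) (auto simp: g_def)
  finally show "ln (1 + S\<^sup>2 / potential S \<kappa>) \<le> v * ln (1 + S)" by (simp add: Q_def g_def)
qed

section \<open>First passage of a perturbed linear recursion\<close>

text \<open>\<open>l\<close>, \<open>l0\<close>, \<open>lr\<close> and \<open>k\<close> stand for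
  the logarithms of \<open>g n\<close>, \<open>g 0\<close>, the bound \<open>gb\<close> and the lift
  factor \<open>K n\<close>. The first inequality serves the noise terms, the second the initial
  term. If \<open>x \<le> G\<close>, the surplus outweighs the jumps and \<open>k \<le> ln 2\<close>
  suffices; otherwise \<open>k \<le> v * l\<close> is used and \<open>drift\<close> is the critical
  case.\<close>

lemma hitting_exponents:
  fixes lr v x G :: real
  assumes lr: "0 < lr" and v: "0 \<le> v" "v \<le> 1" and x: "1 \<le> x" and G: "1 < G"
    and drift: "G < x \<Longrightarrow> (x + v) * lr \<le> G * (ln 2 + lr)"
  obtains h where "0 \<le> h" "h \<le> x"
    "\<And>l k. \<lbrakk>0 \<le> l; l \<le> lr; k \<le> v * l; k \<le> ln 2\<rbrakk> \<Longrightarrow> k + (x - h) * l + h * (lr - l) / (G - 1) \<le> ln 2 + lr"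
    "\<And>l l0 k. \<lbrakk>0 \<le> l0; l0 \<le> l; l \<le> lr; k \<le> v * l; k \<le> ln 2\<rbrakk> \<Longrightarrow>
        k + x * (l - l0) + G * (h * (lr - l) / (G - 1)) \<le> G * (ln 2 + lr - l0)"
proof (cases "x \<le> G")
  case True
  have ln2: "(0::real) \<le> ln 2" by simp
  have f: "(x - 1) * (lr - l) / (G - 1) \<le> lr - l" if "l \<le> lr" for l
    using mult_right_mono[of "x - 1" "G - 1" "lr - l"] True that G by (simp add: divide_le_eq mult.commute)
  show ?thesis
  proof
    show "0 \<le> x - 1" "x - 1 \<le> x" using x by auto
    fix l k :: real assume a: "0 \<le> l" "l \<le> lr" "k \<le> ln 2"
    then show "k + (x - (x - 1)) * l + (x - 1) * (lr - l) / (G - 1) \<le> ln 2 + lr" using f[of l] by simp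
  next
    fix l l0 k :: real assume a: "0 \<le> l0" "l0 \<le> l" "l \<le> lr" "k \<le> ln 2"
    have "G * ((x - 1) * (lr - l) / (G - 1)) \<le> G * (lr - l)" using f[OF a(3)] G by (intro mult_left_mono) auto
    moreover have "x * (l - l0) \<le> G * (l - l0)" using True a by (intro mult_right_mono) auto
    moreover have "ln 2 \<le> G * ln (2::real)" using G by simp
    moreover have "G * (ln 2 + lr - l0) = G * ln 2 + G * (lr - l) + G * (l - l0)" by (simp add: algebra_simps)
    ultimately show "k + x * (l - l0) + G * ((x - 1) * (lr - l) / (G - 1)) \<le> G * (ln 2 + lr - l0)"
      using a by linarith
  qed
next
  case False
  \<comment> \<open>The least \<open>h \<ge> 0\<close> satisfying the first inequality at
    \<open>l = lr\<close>, \<open>k = v * lr\<close>. The second one at \<open>l = lr\<close>,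
    \<open>l0 = 0\<close> is \<open>drift\<close>.\<close>
  define h where "h = max 0 (x + v - 1 - ln 2 / lr)"
  have D: "(x + v) * lr \<le> G * (ln 2 + lr)" using drift False by simp
  have "0 \<le> ln 2 / lr" using lr by simp
  then have h0: "0 \<le> h" "h \<le> x" using x v by (auto simp: h_def)
  have hl: "h * lr \<le> (G - 1) * (ln 2 + lr)"
  proof -
    have "(x + v - 1 - ln 2 / lr) * lr = (x + v) * lr - lr - ln 2" using lr by (simp add: algebra_simps)
    moreover have "0 \<le> (G - 1) * (ln 2 + lr)" using G lr by simp
    ultimately show ?thesis using D unfolding h_def max_def by (simp add: algebra_simps)
  qed
  have hl': "v * lr + (x - h) * lr \<le> ln 2 + lr"
  proof -
    have "(x + v - 1 - ln 2 / lr) * lr \<le> h * lr" using lr by (intro mult_right_mono) (auto simp: h_def)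
    then show ?thesis using lr by (simp add: algebra_simps)
  qed
  \<comment> \<open>The inequalities are affine in \<open>l\<close>, so the end points 0 and
    \<open>lr\<close> suffice; \<open>b1\<close>, \<open>b2\<close> and \<open>b3\<close> below are
    their cases.\<close>
  have conv: "a * l + b * (lr - l) \<le> c * lr" if "0 \<le> l" "l \<le> lr" "a \<le> c" "b \<le> c" for a b c l
  proof -
    have "a * l + b * (lr - l) \<le> c * l + c * (lr - l)" using that by (intro add_mono mult_right_mono) auto
    then show ?thesis by (simp add: algebra_simps)
  qed
  have G1: "0 < G - 1" using G by simp
  define c where "c = (ln 2 + lr) / lr"
  have c: "c * lr = ln 2 + lr" using lr by (simp add: c_def)
  have b1: "h / (G - 1) \<le> c" 
    using hl G1 lr unfolding c_def by (simp add: divide_simps mult_ac)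
  have b2: "v + (x - h) \<le> c" using hl' lr unfolding c_def by (simp add: divide_simps algebra_simps)
  have b3: "v + x \<le> G * c" using D lr unfolding c_def by (simp add: divide_simps algebra_simps)
  show ?thesis
  proof
    show "0 \<le> h" "h \<le> x" by fact+
    fix l k :: real assume a: "0 \<le> l" "l \<le> lr" "k \<le> v * l"
    have "(v + (x - h)) * l + h / (G - 1) * (lr - l) \<le> c * lr" by (rule conv) (use a b1 b2 in auto)
    then show "k + (x - h) * l + h * (lr - l) / (G - 1) \<le> ln 2 + lr" using a(3) by (simp add: c distrib_right)
  next
    fix l l0 k :: real assume a: "0 \<le> l0" "l0 \<le> l" "l \<le> lr" "k \<le> v * l"
    have "(v + x) * l + G * (h / (G - 1)) * (lr - l) \<le> G * c * lr"
      by (rule conv) (use a b3 mult_left_mono[OF b1, of G] G in simp_all)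
    moreover have "G * c * lr = G * (ln 2 + lr)" using c by simp
    moreover have "G * l0 \<le> x * l0" using False a by (intro mult_right_mono) auto
    ultimately show "k + x * (l - l0) + G * (h * (lr - l) / (G - 1)) \<le> G * (ln 2 + lr - l0)"
      using a(4) by (simp add: algebra_simps)
  qed
qed

text \<open>The index is where \<open>H\<close> is minimal on \<open>{..k}\<close>. Minimality is
  used twice: against \<open>k\<close> it bounds the distance from \<open>n\<close> to
  \<open>k\<close>, and against earlier \<open>j\<close> it bounds the growth of \<open>g\<close>
  from \<open>j\<close> to \<open>n\<close>.\<close>

lemma first_passage_bound:
  fixes A E K g :: "nat \<Rightarrow> real"
  assumes q: "0 < q" "q < 1" and p: "0 < p" and c: "0 \<le> c"
    and G: "1 < G" and v: "0 \<le> v" "v \<le> 1" and x: "1 \<le> x"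
    and g: "1 < g 0" "mono g" "\<And>n. g n \<le> gb"
    and drift: "G < x \<Longrightarrow> (x + v) * ln gb \<le> G * (ln 2 + ln gb)"
    and A0: "0 \<le> A 0"
    and rec: "\<And>n. A (Suc n) \<le> q powr G * (g (Suc n) / g n) powr x * A n + c * p ^ Suc n"
    and K: "\<And>n. 0 < K n" "\<And>n. ln (K n) \<le> v * ln (g n)" "\<And>n. K n \<le> 2"
    and E: "E 0 \<le> A 0" "\<And>n. E n \<le> K n * A n"
  shows "\<exists>n\<le>k. E n \<le> 2 * (gb / g 0) * q ^ k * A 0 + 2 * c * gb * (\<Sum>j=1..k. q ^ (k - j) * p ^ j)"
proof -
  define l \<theta> lr where "l n = ln (g n)" and "\<theta> = - ln q" and "lr = ln gb" for n
  have g1: "1 < g n" for n using g(1) monoD[OF g(2), of 0 n] by simp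
  have gb: "1 < gb" using g1[of 0] g(3)[of 0] by simp
  have lr: "0 < lr" using gb by (simp add: lr_def)
  have \<theta>: "0 < \<theta>" using q by (simp add: \<theta>_def)
  have gexp: "g n = exp (l n)" for n using g1[of n] by (simp add: l_def)
  have qexp: "q ^ n = exp (- \<theta> * real n)" for n
    using q by (simp add: \<theta>_def powr_def flip: powr_realpow)
  have l_nonneg: "0 \<le> l n" for n using g1[of n] by (simp add: l_def)
  have l_le: "l n \<le> lr" for n using g1[of n] g(3)[of n] by (simp add: l_def lr_def)
  have l_mono: "l i \<le> l j" if "i \<le> j" for i j
    using monoD[OF g(2) that] g1[of i] by (simp add: l_def)
  have lnK: "ln (K n) \<le> v * l n" "ln (K n) \<le> ln 2" for n
    using K(1)[of n] K(2,3)[of n] by (auto simp: l_def)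
  obtain h where h: "0 \<le> h" "h \<le> x"
    "\<And>l k. \<lbrakk>0 \<le> l; l \<le> lr; k \<le> v * l; k \<le> ln 2\<rbrakk> \<Longrightarrow> k + (x - h) * l + h * (lr - l) / (G - 1) \<le> ln 2 + lr"
    "\<And>l l0 k. \<lbrakk>0 \<le> l0; l0 \<le> l; l \<le> lr; k \<le> v * l; k \<le> ln 2\<rbrakk> \<Longrightarrow>
        k + x * (l - l0) + G * (h * (lr - l) / (G - 1)) \<le> G * (ln 2 + lr - l0)"
    by (rule hitting_exponents[OF lr v x G drift[folded lr_def]]) blast+
  have sum_nonneg': "0 \<le> 2 * c * gb * (\<Sum>j=1..k. q ^ (k - j) * p ^ j)"
    using c gb p q by (intro mult_nonneg_nonneg sum_nonneg) auto
  show ?thesis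
  \<comment> \<open>For such \<open>k\<close> the claimed bound is at least \<open>A 0\<close>, so
    index 0 qualifies.\<close>
  proof (cases "1 \<le> 2 * (gb / g 0) * q ^ k")
    case True
    then have "1 * A 0 \<le> 2 * (gb / g 0) * q ^ k * A 0" using A0 by (rule mult_right_mono)
    then have "E 0 \<le> 2 * (gb / g 0) * q ^ k * A 0 + 2 * c * gb * (\<Sum>j=1..k. q ^ (k - j) * p ^ j)"
      using E(1) sum_nonneg' by linarith
    then show ?thesis by blast
  next
    case False
    have k_large: "ln 2 + lr - l 0 \<le> \<theta> * real k"
    proof -
      have "2 * (gb / g 0) * q ^ k = exp (ln 2 + lr - l 0 - \<theta> * real k)"
        using gb by (simp add: gexp qexp lr_def exp_add exp_diff exp_minus divide_simps)
      then show ?thesis using False by simp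
    qed
    define H where "H n = h * l n - real n * (G - 1) * \<theta>" for n
    obtain n where n: "n \<le> k" "\<And>j. j \<le> k \<Longrightarrow> H n \<le> H j"
    proof -
      have "Min (H ` {..k}) \<in> H ` {..k}" by (rule Min_in) auto
      then obtain n where n: "n \<in> {..k}" "Min (H ` {..k}) = H n" by blast
      have "H n \<le> H j" if "j \<le> k" for j using Min_le[of "H ` {..k}" "H j"] n that by auto
      then show ?thesis using that n(1) by simp
    qed
    have unroll: "A i \<le> exp (x * (l i - l 0) - G * \<theta> * real i) * A 0
        + c * (\<Sum>j=1..i. exp (x * (l i - l j) - G * \<theta> * real (i - j)) * p ^ j)" for i
    proof (induction i)
      case (Suc i)
      define r where "r = exp (x * (l (Suc i) - l i) - G * \<theta>)"
      have r: "q powr G * (g (Suc i) / g i) powr x = r"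
        using q g1[of i] g1[of "Suc i"]
        by (simp add: r_def powr_def \<theta>_def l_def ln_div mult_exp_exp algebra_simps)
      have "A (Suc i) \<le> r * A i + c * p ^ Suc i" using rec[of i] by (simp add: r)
      also have "r * A i \<le> r * (exp (x * (l i - l 0) - G * \<theta> * real i) * A 0
        + c * (\<Sum>j=1..i. exp (x * (l i - l j) - G * \<theta> * real (i - j)) * p ^ j))"
        using Suc.IH by (intro mult_left_mono) (auto simp: r_def)
      also have "\<dots> = exp (x * (l (Suc i) - l 0) - G * \<theta> * real (Suc i)) * A 0
        + c * (\<Sum>j=1..i. exp (x * (l (Suc i) - l j) - G * \<theta> * real (Suc i - j)) * p ^ j)"
      proof -
        have e1: "r * exp (x * (l i - l 0) - G * \<theta> * real i) = exp (x * (l (Suc i) - l 0) - G * \<theta> * real (Suc i))"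
          by (simp add: r_def mult_exp_exp algebra_simps)
        moreover have "r * exp (x * (l i - l j) - G * \<theta> * real (i - j)) = exp (x * (l (Suc i) - l j) - G * \<theta> * real (Suc i - j))"
          if "j \<in> {1..i}" for j
          using that by (simp add: r_def mult_exp_exp of_nat_diff algebra_simps)
        then have e2: "r * (\<Sum>j=1..i. exp (x * (l i - l j) - G * \<theta> * real (i - j)) * p ^ j)
            = (\<Sum>j=1..i. exp (x * (l (Suc i) - l j) - G * \<theta> * real (Suc i - j)) * p ^ j)"
          unfolding sum_distrib_left by (intro sum.cong) (auto simp flip: mult.assoc)
        have "r * (a * A 0 + c * s) = (r * a) * A 0 + c * (r * s)" for a s by (simp add: algebra_simps)
        then show ?thesis unfolding e1[symmetric] e2[symmetric] by simp
      qed
      finally show ?case by (simp add: algebra_simps)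
    qed simp
    have step: "\<theta> * (real k - real n) \<le> h * (lr - l n) / (G - 1)"
    proof -
      have "h * l n - real n * (G - 1) * \<theta> \<le> h * lr - real k * (G - 1) * \<theta>"
        using n(2)[of k] mult_left_mono[OF l_le[of k] h(1)] by (simp add: H_def)
      then show ?thesis using G by (simp add: le_divide_eq algebra_simps)
    qed
    \<comment> \<open>Here the case assumption enters: \<open>k_large\<close>, multiplied by
      \<open>G - 1\<close>, provides what the jumps since index 0 have cost.\<close>
    have det: "K n * exp (x * (l n - l 0) - G * \<theta> * real n) \<le> 2 * (gb / g 0) * q ^ k"
    proof -
      have "ln (K n) + x * (l n - l 0) + G * (h * (lr - l n) / (G - 1)) \<le> G * (ln 2 + lr - l 0)"
        by (rule h(4)) (use l_nonneg l_mono[of 0 n] l_le lnK in auto)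
      moreover have "G * (\<theta> * (real k - real n)) \<le> G * (h * (lr - l n) / (G - 1))"
        using step G by (intro mult_left_mono) auto
      moreover have "(G - 1) * (ln 2 + lr - l 0) \<le> (G - 1) * (\<theta> * real k)"
        using k_large G by (intro mult_left_mono) auto
      ultimately have "ln (K n) + (x * (l n - l 0) - G * \<theta> * real n) \<le> ln 2 + lr - l 0 - \<theta> * real k"
        by (simp add: algebra_simps)
      then have "exp (ln (K n) + (x * (l n - l 0) - G * \<theta> * real n)) \<le> exp (ln 2 + lr - l 0 - \<theta> * real k)" by simp
      then show ?thesis using K(1)[of n] gb
        by (simp add: exp_add exp_diff gexp qexp lr_def exp_minus divide_simps)
    qed
    \<comment> \<open>Minimality against \<open>j\<close> covers the part \<open>h\<close> of the
      jump exponent, and the choice of \<open>h\<close> covers the rest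
      \<open>x - h\<close>.\<close>
    have noise: "K n * exp (x * (l n - l j) - G * \<theta> * real (n - j)) \<le> 2 * gb * q ^ (k - j)" if j: "j \<le> n" for j
    proof -
      have "ln (K n) + (x - h) * l n + h * (lr - l n) / (G - 1) \<le> ln 2 + lr"
        by (rule h(3)) (use l_nonneg l_le lnK in auto)
      moreover have "h * (l n - l j) \<le> (G - 1) * \<theta> * (real n - real j)"
        using n(2)[of j] j n(1) by (simp add: H_def algebra_simps)
      moreover have "(x - h) * (l n - l j) \<le> (x - h) * l n" using h l_nonneg[of j] by (intro mult_left_mono) auto
      ultimately have "ln (K n) + (x * (l n - l j) - G * \<theta> * (real n - real j)) \<le> ln 2 + lr - \<theta> * (real k - real j)"
        using step by (simp add: algebra_simps)
      then have "ln (K n) + (x * (l n - l j) - G * \<theta> * real (n - j)) \<le> ln 2 + lr - \<theta> * real (k - j)"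
        using j n(1) by (simp add: of_nat_diff)
      then have "exp (ln (K n) + (x * (l n - l j) - G * \<theta> * real (n - j))) \<le> exp (ln 2 + lr - \<theta> * real (k - j))" by simp
      then show ?thesis using K(1)[of n] gb
        by (simp add: exp_add exp_diff qexp lr_def exp_minus divide_simps)
    qed
    have "E n \<le> K n * A n" by (rule E)
    also have "\<dots> \<le> K n * (exp (x * (l n - l 0) - G * \<theta> * real n) * A 0
        + c * (\<Sum>j=1..n. exp (x * (l n - l j) - G * \<theta> * real (n - j)) * p ^ j))"
      using unroll K(1)[of n] by (intro mult_left_mono) auto
    also have "\<dots> = (K n * exp (x * (l n - l 0) - G * \<theta> * real n)) * A 0
        + c * (\<Sum>j=1..n. (K n * exp (x * (l n - l j) - G * \<theta> * real (n - j))) * p ^ j)"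
      by (simp add: distrib_left sum_distrib_left mult_ac)
    also have "\<dots> \<le> (2 * (gb / g 0) * q ^ k) * A 0 + c * (\<Sum>j=1..n. (2 * gb * q ^ (k - j)) * p ^ j)"
      using det noise A0 c p by (intro add_mono mult_right_mono mult_left_mono sum_mono) auto
    also have "(\<Sum>j=1..n. (2 * gb * q ^ (k - j)) * p ^ j) \<le> (\<Sum>j=1..k. (2 * gb * q ^ (k - j)) * p ^ j)"
      using n(1) gb q p by (intro sum_mono2) auto
    finally have "E n \<le> (2 * (gb / g 0) * q ^ k) * A 0 + c * (\<Sum>j=1..k. (2 * gb * q ^ (k - j)) * p ^ j)"
      using c by (simp add: mult_left_mono)
    also have "\<dots> = 2 * (gb / g 0) * q ^ k * A 0 + 2 * c * gb * (\<Sum>j=1..k. q ^ (k - j) * p ^ j)"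
      by (simp add: sum_distrib_left mult_ac)
    finally show ?thesis using n(1) by blast
  qed
qed

section \<open>Convolutions of geometric sequences\<close>

lemma convolution_geometric_le:
  fixes p q :: real
  assumes p: "0 < p" "p < q"
  shows "(\<Sum>j=1..k. q ^ (k - j) * p ^ j) \<le> q ^ k / (1 - p / q)"
    "(\<Sum>j=1..k. p ^ (k - j) * q ^ j) \<le> q ^ k / (1 - p / q)"
proof -
  have r: "0 \<le> p / q" "p / q < 1" using p by auto
  have *: "(\<Sum>j<Suc k. (p / q) ^ j) \<le> 1 / (1 - p / q)"
  proof -
    have "(1 - (p / q) ^ Suc k) / (1 - p / q) \<le> 1 / (1 - p / q)"
      using r by (intro divide_right_mono) (auto simp del: power_Suc)
    then show ?thesis using r p by (simp add: sum_gp_strict del: power_Suc sum.lessThan_Suc)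
  qed
  have "(\<Sum>j=1..k. q ^ (k - j) * p ^ j) \<le> (\<Sum>j<Suc k. q ^ (k - j) * p ^ j)"
    using p by (intro sum_mono2) auto
  also have "\<dots> = q ^ k * (\<Sum>j<Suc k. (p / q) ^ j)"
    using p unfolding sum_distrib_left by (intro sum.cong) (auto simp: power_diff power_divide)
  finally show "(\<Sum>j=1..k. q ^ (k - j) * p ^ j) \<le> q ^ k / (1 - p / q)"
    using mult_left_mono[OF *, of "q ^ k"] p by simp
  have "(\<Sum>j=1..k. p ^ (k - j) * q ^ j) \<le> (\<Sum>j\<le>k. p ^ (k - j) * q ^ j)"
    using p by (intro sum_mono2) auto
  also have "\<dots> = (\<Sum>j\<le>k. p ^ j * q ^ (k - j))"
    by (rule sum.reindex_bij_witness[of _ "\<lambda>j. k - j" "\<lambda>j. k - j"]) auto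
  also have "\<dots> = q ^ k * (\<Sum>j<Suc k. (p / q) ^ j)"
    using p unfolding sum_distrib_left lessThan_Suc_atMost by (intro sum.cong) (auto simp: power_diff power_divide)
  finally show "(\<Sum>j=1..k. p ^ (k - j) * q ^ j) \<le> q ^ k / (1 - p / q)"
    using mult_left_mono[OF *, of "q ^ k"] p by simp
qed

lemma convolution_geometric_eq_le:
  fixes q r :: real
  assumes q: "0 < q" "q < r"
  shows "(\<Sum>j=1..k. q ^ (k - j) * q ^ j) \<le> r ^ k / (exp 1 * ln (r / q))"
proof -
  define y where "y = ln (r / q)"
  have y: "0 < y" using q by (simp add: y_def)
  have "(\<Sum>j=1..k. q ^ (k - j) * q ^ j) = (\<Sum>j=1..k. q ^ k)"
    by (intro sum.cong) (auto simp flip: power_add)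
  then have s: "(\<Sum>j=1..k. q ^ (k - j) * q ^ j) = real k * q ^ k" by simp
  \<comment> \<open>Written so that \<open>1 + u \<le> exp u\<close> applies. It is sharp at
    \<open>k * y = 1\<close>, whence the \<open>exp 1\<close> in \<open>Chat\<close>.\<close>
  have "real k * y = (1 + (real k * y - 1))" by simp
  also have "\<dots> \<le> exp (real k * y - 1)" by (rule exp_ge_add_one_self)
  also have "\<dots> = (r / q) ^ k / exp 1"
  proof -
    have "exp (real k * y) = (r / q) ^ k" using q by (simp add: y_def exp_of_nat_mult)
    then show ?thesis by (simp add: exp_diff)
  qed
  finally have "real k * (exp 1 * y) * q ^ k \<le> r ^ k"
    using q by (simp add: field_simps)
  then show ?thesis unfolding s y_def[symmetric] using y by (simp add: field_simps)
qed

section \<open>The relaxed forward-backward-forward step\<close>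

text \<open>\<open>z\<close> and \<open>y\<close> are taken relative to the zero, \<open>u\<close>
  is the search direction, \<open>r\<close> the relaxation, \<open>t\<close> the wanted drift. After
  expansion, \<open>D1\<close> absorbs the cross term of \<open>y\<close> with \<open>g + h\<close>,
  \<open>D2\<close> the oracle error \<open>om\<close>, and \<open>Sl\<close> the coupling of
  \<open>e\<close> and \<open>g\<close> to the noise \<open>h\<close>.\<close>

lemma relaxed_step_bound:
  fixes y e g h om :: "'h::real_inner"
  assumes z: "z = y + e" and u: "u = e - (g + h)"
    and mono: "m * (norm y)\<^sup>2 + inner om y \<le> inner u y"
    and strong: "m * (norm e)\<^sup>2 \<le> inner g e" and lip: "norm g \<le> l * norm e"
    and D: "0 < D1" "0 < D2" "D1 + D2 = 2 * (1 - t) * m - t"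
    and t: "0 \<le> t" "t \<le> 1" and m: "0 \<le> m" and P: "1 \<le> P"
    and ch: "ch = t\<^sup>2 / D1" and Sl: "0 < Sl" "Sl = 1 - t - (P - 1) + 2 * (P - 1) * m - (P + ch) * l\<^sup>2"
    and c: "c = (P + ch)\<^sup>2 * l\<^sup>2 + (P - 1)\<^sup>2"
    and r: "0 \<le> r"
  shows "(norm (z - r *\<^sub>R u))\<^sup>2 \<le> (1 - r * t) * (norm z)\<^sup>2 - r * (P - r) * (norm u)\<^sup>2
           + r * ((norm om)\<^sup>2 / D2 + (P + ch + c / Sl) * (norm h)\<^sup>2)"
proof -
  let ?G = "g + h"
  have c0: "0 \<le> ch" using ch D by simp
  have y1: "- ch * (norm ?G)\<^sup>2 \<le> D1 * (norm y)\<^sup>2 - 2 * t * inner y ?G"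
    using inner_young[OF D(1), of "- (t *\<^sub>R ?G)" y] D t
    by (simp add: ch power_mult_distrib)
  have y2: "- (norm om)\<^sup>2 / D2 \<le> D2 * (norm y)\<^sup>2 + 2 * (1 - t) * inner om y"
  proof -
    have "- (norm ((1 - t) *\<^sub>R om))\<^sup>2 / D2 \<le> D2 * (norm y)\<^sup>2 + 2 * (1 - t) * inner om y"
    proof -
      have "2 * inner y ((1 - t) *\<^sub>R om) = 2 * (1 - t) * inner om y" by (simp add: inner_commute)
      then show ?thesis using inner_young[OF D(2), of "(1 - t) *\<^sub>R om" y] by linarith
    qed
    moreover have "(norm ((1 - t) *\<^sub>R om))\<^sup>2 \<le> (norm om)\<^sup>2"
      using t by (intro power_mono) (auto simp: mult_left_le_one_le)
    ultimately show ?thesis using D(2) by (smt (verit) divide_right_mono minus_divide_left)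
  qed
  have gg: "(norm g)\<^sup>2 \<le> l\<^sup>2 * (norm e)\<^sup>2"
    using power_mono[OF lip, of 2] by (simp add: power_mult_distrib)
  have ge: "0 \<le> inner g e" using strong m by (smt (verit) mult_nonneg_nonneg zero_le_power2)
  have y3: "- (c / Sl) * (norm h)\<^sup>2 \<le> Sl * (norm e)\<^sup>2 - 2 * inner ((P + ch) *\<^sub>R g - (P - 1) *\<^sub>R e) h"
  proof -
    let ?c = "(P + ch) *\<^sub>R g - (P - 1) *\<^sub>R e"
    have "(norm ?c)\<^sup>2 = (P + ch)\<^sup>2 * (norm g)\<^sup>2 - 2 * ((P + ch) * (P - 1)) * inner g e + (P - 1)\<^sup>2 * (norm e)\<^sup>2"
      by (simp only: power2_norm_eq_inner inner_simps inner_commute[of e g]) (simp add: power2_eq_square algebra_simps)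
    also have "\<dots> \<le> c * (norm e)\<^sup>2"
    proof -
      \<comment> \<open>The mixed term enters with a minus sign, so monotonicity of \<open>V\<close>
        allows dropping it; this leaves the two squares in \<open>c\<close>.\<close>
      have "0 \<le> (P + ch) * (P - 1) * inner g e" using ge P c0 by simp
      moreover have "(P + ch)\<^sup>2 * (norm g)\<^sup>2 \<le> (P + ch)\<^sup>2 * (l\<^sup>2 * (norm e)\<^sup>2)"
        using gg by (rule mult_left_mono) simp
      ultimately show ?thesis unfolding c by (simp add: distrib_right mult.assoc)
    qed
    finally have n: "(norm ?c)\<^sup>2 \<le> c * (norm e)\<^sup>2" .
    have c_nn: "0 \<le> c" by (simp add: c)
    have "inner ?c h \<le> norm ?c * norm h" by (rule norm_cauchy_schwarz)
    also have "norm ?c \<le> sqrt c * norm e" using n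
      by (metis norm_ge_zero real_sqrt_le_mono real_sqrt_mult real_sqrt_abs abs_norm_cancel)
    finally have "inner ?c h \<le> sqrt c * norm e * norm h" by (simp add: mult_right_mono)
    moreover have "0 \<le> (Sl * norm e - sqrt c * norm h)\<^sup>2 / Sl" using Sl by simp
    moreover have "(Sl * norm e - sqrt c * norm h)\<^sup>2 / Sl
        = Sl * (norm e)\<^sup>2 - 2 * (sqrt c * norm e * norm h) + c / Sl * (norm h)\<^sup>2"
    proof -
      have "(sqrt c)\<^sup>2 = c" using c_nn by simp
      then have "(Sl * norm e - sqrt c * norm h)\<^sup>2
          = Sl * (Sl * (norm e)\<^sup>2 - 2 * (sqrt c * norm e * norm h)) + c * (norm h)\<^sup>2"
        by (simp add: power2_eq_square algebra_simps) 
      then show ?thesis using Sl(1) by (simp add: add_divide_distrib)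
    qed
    ultimately show ?thesis by simp
  qed
  have ge': "2 * (P - 1) * (m * (norm e)\<^sup>2) \<le> 2 * (P - 1) * inner g e"
    using strong P by (intro mult_left_mono) auto
  have gg': "(P + ch) * (norm g)\<^sup>2 \<le> (P + ch) * (l\<^sup>2 * (norm e)\<^sup>2)"
    using gg P c0 by (intro mult_left_mono) auto
  have mono': "2 * (1 - t) * (m * (norm y)\<^sup>2) + 2 * (1 - t) * inner om y \<le> 2 * (1 - t) * inner u y"
    using mult_left_mono[OF mono, of "2 * (1 - t)"] t by (simp add: distrib_left)
  have G2: "(norm ?G)\<^sup>2 = (norm g)\<^sup>2 + 2 * inner g h + (norm h)\<^sup>2"
    by (simp add: power2_norm_eq_inner inner_simps inner_commute)
  have id1: "(norm (z - r *\<^sub>R u))\<^sup>2 = (norm z)\<^sup>2 - 2 * r * inner z u + r\<^sup>2 * (norm u)\<^sup>2"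
    by (simp only: power2_norm_eq_inner inner_simps inner_commute[of u z]) (simp add: power2_eq_square algebra_simps)
  have id2: "2 * inner z u - t * (norm z)\<^sup>2 - P * (norm u)\<^sup>2
      = 2 * (1 - t) * inner u y - 2 * t * inner y ?G - t * (norm y)\<^sup>2
        + (1 - t - (P - 1)) * (norm e)\<^sup>2 + 2 * (P - 1) * inner g e + 2 * (P - 1) * inner e h - P * (norm ?G)\<^sup>2"
    unfolding z u
    by (simp only: power2_norm_eq_inner inner_simps inner_commute[of h g] inner_commute[of h e] inner_commute[of h y]
        inner_commute[of g e] inner_commute[of g y] inner_commute[of e y]) (simp add: algebra_simps)
  \<comment> \<open>The heart of the estimate: multiplied by \<open>r\<close>, it replaces the inner
    product in the expansion \<open>id1\<close>.\<close>
  have key: "- ((norm om)\<^sup>2 / D2 + (P + ch + c / Sl) * (norm h)\<^sup>2)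
      \<le> 2 * inner z u - t * (norm z)\<^sup>2 - P * (norm u)\<^sup>2"
  proof -
    have "Sl * (norm e)\<^sup>2 = (1 - t - (P - 1)) * (norm e)\<^sup>2 + 2 * (P - 1) * (m * (norm e)\<^sup>2) - (P + ch) * (l\<^sup>2 * (norm e)\<^sup>2)"
      unfolding Sl(2) by (simp add: algebra_simps)
    moreover have "2 * (1 - t) * (m * (norm y)\<^sup>2) - t * (norm y)\<^sup>2 = D1 * (norm y)\<^sup>2 + D2 * (norm y)\<^sup>2"
    proof -
      have "2 * (1 - t) * (m * (norm y)\<^sup>2) - t * (norm y)\<^sup>2 = (2 * (1 - t) * m - t) * (norm y)\<^sup>2"
        by (simp add: algebra_simps)
      also have "\<dots> = D1 * (norm y)\<^sup>2 + D2 * (norm y)\<^sup>2"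
        unfolding D(3)[symmetric] by (rule distrib_right)
      finally show ?thesis .
    qed
    moreover have "(P + ch) * (norm ?G)\<^sup>2 = (P + ch) * (norm g)\<^sup>2 + 2 * ((P + ch) * inner g h) + (P + ch) * (norm h)\<^sup>2"
      unfolding G2 by (simp add: algebra_simps)
    moreover have "inner ((P + ch) *\<^sub>R g - (P - 1) *\<^sub>R e) h = (P + ch) * inner g h - (P - 1) * inner e h"
      by (simp add: inner_simps)
    moreover have "(P + ch + c / Sl) * (norm h)\<^sup>2 = (P + ch) * (norm h)\<^sup>2 + c / Sl * (norm h)\<^sup>2"
      by (simp add: algebra_simps)
    moreover have "(P + ch) * (norm ?G)\<^sup>2 = P * (norm ?G)\<^sup>2 + ch * (norm ?G)\<^sup>2" by (simp add: algebra_simps)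
    ultimately show ?thesis
      unfolding id2 using y1 y2 y3 ge' gg' mono' by linarith
  qed
  show ?thesis
    using mult_left_mono[OF key r] unfolding id1 by (simp add: power2_eq_square algebra_simps)
qed

section \<open>Pathwise contraction\<close>

locale risfbf_setting =
  fixes T :: "'h::{real_inner, banach, second_countable_topology} \<Rightarrow> 'h set" and V :: "'h \<Rightarrow> 'h" and xbar :: 'h
    and L \<mu> a b Lt lam \<alpha>bar \<sigma>0 \<kappa> d x v y0 \<theta> :: real
  assumes T: "monotone_operator T" and zero: "- V xbar \<in> T xbar"
    and V: "L-lipschitz_on UNIV V" "strongly_monotone \<mu> V"
    and pos: "0 < \<mu>" "\<mu> \<le> L"
    and ab: "0 < a" "a < 1" "0 < b" "b < 1"
    and Lt: "Lt\<^sup>2 = L\<^sup>2 + 1 / 2" "0 < Lt"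
    and lam: "0 < lam" "lam \<le> a / (2 * \<mu>)" "lam \<le> b * \<mu>" "lam \<le> (1 - a) / (2 * Lt)"
    and \<alpha>bar: "0 < \<alpha>bar" "\<alpha>bar < 1"
    and adm: "admissible (lam * \<mu>) \<sigma>0 \<kappa> d x v y0 \<theta>"
begin

definition "m = lam * \<mu>"
definition "l = lam * L"
definition "\<sigma> = \<sigma>0 * (1 - b)"
definition "\<rho>b = (3 - a) / (2 * (1 + Lt * lam))"
definition "den \<alpha> = 2 * \<alpha>\<^sup>2 - 1/2 * \<alpha> + (1::real)"
definition "Pc = (1 + \<kappa>) * (3/2 - m) / (1 + l)"
definition "ch = \<sigma>\<^sup>2 * m / d"
definition "D2 = m * (2 - \<sigma> * (1 + 2 * m) - d)"
definition "Sl = 1 - \<sigma> * m - (Pc - 1) + 2 * (Pc - 1) * m - (Pc + ch) * l\<^sup>2"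
definition "cc = (Pc + ch)\<^sup>2 * l\<^sup>2 + (Pc - 1)\<^sup>2"
text \<open>\<open>w\<close> and \<open>u\<close> stand for the squared norms of the errors
  \<open>W\<close> and \<open>U\<close>; the factor 2 comes from the parallelogram law for
  \<open>U - W\<close>.\<close>

definition "noise w u = lam\<^sup>2 / D2 * w + 2 * lam\<^sup>2 * (Pc + ch + cc / Sl) * (u + w)"
text \<open>This is \<open>q\<close>: \<alpha> is set to \<open>\<alpha>bar\<close>,
  \<open>den\<close> is replaced by its minimum 31/32, and of the drift only
  \<open>(1 - b) * m\<close> is used.\<close>

definition "rate = 1 - 32/31 * \<rho>b * (1 - \<alpha>bar)\<^sup>2 * ((1 - b) * m)"
text \<open>The quotient of the relative decrease guaranteed at \<open>\<alpha>bar\<close> and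
  \<open>1 - rate\<close>.\<close>

definition "G = 31/32 * \<sigma>0 * (1 - \<alpha>bar\<^sup>2 / 5) / (den \<alpha>bar * (1 - \<alpha>bar))"

lemmas adm_facts = adm[folded m_def, unfolded admissible_def]

lemma parameter_bounds:
  shows m_pos: "0 < m" and m_le_l: "m \<le> l" and l_le: "l \<le> 1/2 - m" and m_le: "m \<le> 1/4"
    and Lt_lam: "l \<le> Lt * lam" "Lt * lam \<le> (1 - a) / 2" and m_a: "m \<le> a / 2"
    and lam2: "lam\<^sup>2 \<le> b * m"
proof -
  show "0 < m" using lam pos by (simp add: m_def)
  show ml: "m \<le> l" using lam pos by (simp add: m_def l_def)
  show ma: "m \<le> a / 2" using lam pos by (simp add: m_def field_simps)
  show "Lt * lam \<le> (1 - a) / 2" using lam Lt(2) by (simp add: field_simps)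
  moreover have "L \<le> Lt"
  proof (rule power2_le_imp_le)
    show "L\<^sup>2 \<le> Lt\<^sup>2" using Lt by simp
  qed (use Lt in simp)
  then show "l \<le> Lt * lam" using lam by (simp add: l_def)
  ultimately show "l \<le> 1/2 - m" using ma by simp
  then show "m \<le> 1/4" using ml by simp
  show "lam\<^sup>2 \<le> b * m" using mult_left_mono[OF lam(3), of lam] lam(1) by (simp add: m_def power2_eq_square mult_ac)
qed

lemma noise_constant_bounds:
  shows Sl_pos: "0 < Sl" and Pc_ge: "1 \<le> Pc" and D2_pos: "0 < D2"
    and noise_le: "0 \<le> h \<Longrightarrow> h \<le> b * m \<Longrightarrow> h / D2 + 4 * h * (Pc + ch + cc / Sl) \<le> 2 + 8 * h"
  using noise_bound[OF adm[folded m_def] m_pos m_le m_le_l l_le ab(3,4) \<sigma>_def Pc_def ch_def D2_def Sl_def cc_def]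
  by blast+

lemma ch_nonneg: "0 \<le> ch" "0 \<le> cc" using adm_facts m_pos by (auto simp: ch_def cc_def)

lemma \<rho>b_bounds: "1 \<le> \<rho>b" "(1 + \<kappa>) * \<rho>b \<le> Pc" "\<rho>b \<le> (3/2 - m) / (1 + m)"
proof -
  have Ll: "0 < Lt * lam" using Lt lam by simp
  show "1 \<le> \<rho>b" using Lt_lam Ll by (simp add: \<rho>b_def field_simps)
  have eq: "\<rho>b = ((3 - a) / 2) / (1 + Lt * lam)" by (simp add: \<rho>b_def)
  have le: "\<rho>b \<le> (3/2 - m) / (1 + l)"
    unfolding eq using m_a m_pos m_le_l Lt_lam ab m_le by (intro frac_le) auto
  then show "(1 + \<kappa>) * \<rho>b \<le> Pc"
    unfolding Pc_def using mult_left_mono[OF le, of "1 + \<kappa>"] adm_facts by simp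
  have "(3/2 - m) / (1 + l) \<le> (3/2 - m) / (1 + m)"
    using m_le m_pos m_le_l by (intro divide_left_mono) auto
  then show "\<rho>b \<le> (3/2 - m) / (1 + m)" using le by simp
qed

lemma den_lower: "1 - \<alpha> \<le> den \<alpha>" "31/32 \<le> den \<alpha>" if "0 \<le> \<alpha>"
proof -
  show "1 - \<alpha> \<le> den \<alpha>" unfolding den_def using that zero_le_power2[of \<alpha>] by linarith
  have "den \<alpha> = 2 * (\<alpha> - 1/8)\<^sup>2 + 31/32" by (simp add: den_def power2_eq_square algebra_simps)
  then show "31/32 \<le> den \<alpha>" by simp
qed

lemma \<sigma>_bounds: "0 \<le> \<sigma>" "\<sigma> \<le> \<sigma>0" "0 < \<sigma>0" "\<sigma> * m \<le> 1"
proof -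
  show s0: "0 < \<sigma>0" using adm_facts by simp
  then show "0 \<le> \<sigma>" "\<sigma> \<le> \<sigma>0" using ab by (auto simp: \<sigma>_def)
  moreover have "\<sigma>0 * (1 + 2 * m) \<le> 2" using adm_facts by linarith
  then have "\<sigma>0 \<le> 2" using s0 m_pos by (simp add: distrib_left) (smt (verit) mult_pos_pos)
  ultimately have "\<sigma> * m \<le> 2 * (1/4)" using m_pos m_le by (intro mult_mono) auto
  then show "\<sigma> * m \<le> 1" by simp
qed

lemma path_step:
  assumes \<alpha>: "0 < \<alpha>" "\<alpha> < 1" and z: "z = x1 + \<alpha> *\<^sub>R (x1 - x0)"
    and \<rho>: "\<rho> = \<rho>b * (1 - \<alpha>)\<^sup>2 / den \<alpha>"
    and y: "y \<in> resolvent lam T (z - lam *\<^sub>R A)"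
    and x2: "x2 = (1 - \<rho>) *\<^sub>R z + \<rho> *\<^sub>R (y + lam *\<^sub>R (A - B))"
    and U: "U = A - V z" and W: "W = B - V y"
  shows "(norm (x2 - xbar))\<^sup>2 \<le> (1 - \<rho> * (\<sigma> * m)) * (norm (z - xbar))\<^sup>2
      - (\<alpha>\<^sup>2 + \<alpha> + \<kappa> * (1 + \<alpha> / 4)) / (1 - \<alpha>)\<^sup>2 * (norm (x2 - z))\<^sup>2
      + \<rho> * noise ((norm W)\<^sup>2) ((norm U)\<^sup>2)"
proof -
  obtain t where t: "t \<in> T y" "z - lam *\<^sub>R A = y + lam *\<^sub>R t"
    using y by (auto simp: resolvent_def)
  define e g h om u where "e = z - y" and "g = lam *\<^sub>R (V z - V y)" and "h = lam *\<^sub>R (U - W)"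
    and "om = lam *\<^sub>R W" and "u = e - (g + h)"
  have u: "u = lam *\<^sub>R (t + V y + W)"
    using t(2) by (simp add: u_def e_def g_def h_def U W algebra_simps)
  have x2u: "x2 - xbar = (z - xbar) - \<rho> *\<^sub>R u" "x2 - z = - (\<rho> *\<^sub>R u)"
    by (auto simp: x2 u_def e_def g_def h_def U W algebra_simps)
  have \<rho>pos: "0 < \<rho>" using \<alpha> \<rho>b_bounds den_lower[of \<alpha>] by (simp add: \<rho>)
  have mono: "m * (norm (y - xbar))\<^sup>2 + inner om (y - xbar) \<le> inner u (y - xbar)"
  proof -
    have "0 \<le> inner (t - (- V xbar)) (y - xbar)"
      using T t(1) zero unfolding monotone_operator_def by blast
    moreover have "\<mu> * (norm (y - xbar))\<^sup>2 \<le> inner (V y - V xbar) (y - xbar)"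
      using V(2) by (simp add: strongly_monotone_def)
    ultimately have "lam * (\<mu> * (norm (y - xbar))\<^sup>2) \<le> lam * inner (t + V y) (y - xbar)"
      using lam(1) by (intro mult_left_mono) (auto simp: inner_simps)
    then show ?thesis unfolding u om_def m_def by (simp add: inner_simps algebra_simps)
  qed
  have strong: "m * (norm e)\<^sup>2 \<le> inner g e"
    using V(2) lam(1) by (simp add: strongly_monotone_def g_def e_def m_def mult.assoc)
  have lip: "norm g \<le> l * norm e"
    using lipschitz_onD[OF V(1), of z y] lam(1) by (simp add: g_def e_def l_def dist_norm mult.assoc)
  have D1: "0 < m * d" using m_pos adm_facts by simp
  have ch: "ch = (\<sigma> * m)\<^sup>2 / (m * d)" using m_pos by (simp add: ch_def power2_eq_square)
  have "(norm ((z - xbar) - \<rho> *\<^sub>R u))\<^sup>2 \<le> (1 - \<rho> * (\<sigma> * m)) * (norm (z - xbar))\<^sup>2 - \<rho> * (Pc - \<rho>) * (norm u)\<^sup>2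
           + \<rho> * ((norm om)\<^sup>2 / D2 + (Pc + ch + cc / Sl) * (norm h)\<^sup>2)"
  proof (rule relaxed_step_bound[where y = "y - xbar" and e = e and m = m and l = l and ?D1.0 = "m * d"])
    show "m * d + D2 = 2 * (1 - \<sigma> * m) * m - \<sigma> * m" by (simp add: D2_def algebra_simps)
  qed (use mono strong lip D1 D2_pos \<sigma>_bounds m_pos Pc_ge ch Sl_pos \<rho>pos in \<open>auto simp: e_def u_def Sl_def cc_def\<close>)
  moreover have "\<rho> * ((norm om)\<^sup>2 / D2 + (Pc + ch + cc / Sl) * (norm h)\<^sup>2) \<le> \<rho> * noise ((norm W)\<^sup>2) ((norm U)\<^sup>2)"
  proof (rule mult_left_mono)
    define N where "N = (norm U)\<^sup>2 + (norm W)\<^sup>2"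
    have "(norm (U - W))\<^sup>2 + (norm (U + W))\<^sup>2 = 2 * N"
      by (simp add: N_def power2_norm_eq_inner inner_simps inner_commute)
    then have "(norm (U - W))\<^sup>2 \<le> 2 * N" using zero_le_power2[of "norm (U + W)"] by linarith
    then have "(norm h)\<^sup>2 \<le> lam\<^sup>2 * (2 * N)"
      unfolding h_def norm_scaleR power_mult_distrib power2_abs by (rule mult_left_mono) simp
    then have "(Pc + ch + cc / Sl) * (norm h)\<^sup>2 \<le> (Pc + ch + cc / Sl) * (lam\<^sup>2 * (2 * N))"
      using Pc_ge ch_nonneg Sl_pos by (intro mult_left_mono add_nonneg_nonneg) auto
    then show "(norm om)\<^sup>2 / D2 + (Pc + ch + cc / Sl) * (norm h)\<^sup>2 \<le> noise ((norm W)\<^sup>2) ((norm U)\<^sup>2)"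
      by (simp add: noise_def N_def[symmetric] om_def power_mult_distrib mult_ac)
  qed (use \<rho>pos in simp)
  moreover have "(\<alpha>\<^sup>2 + \<alpha> + \<kappa> * (1 + \<alpha> / 4)) / (1 - \<alpha>)\<^sup>2 * (norm (x2 - z))\<^sup>2 \<le> \<rho> * (Pc - \<rho>) * (norm u)\<^sup>2"
  proof -
    have \<kappa>: "0 < \<kappa>" "\<kappa> \<le> 2/3" using adm_facts by auto
    have d0: "0 < den \<alpha>" using den_lower(2)[of \<alpha>] \<alpha> by simp
    define c where "c = \<alpha>\<^sup>2 + \<alpha> + \<kappa> * (1 + \<alpha> / 4)"
    \<comment> \<open>This is \<open>(1 + \<kappa>) * den \<alpha>\<close> minus
      \<open>c + (1 - \<alpha>)^2\<close>. It shows how large the coefficient \<open>c\<close> of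
      the velocity term may be, and \<open>\<kappa> \<le> 2/3\<close> makes it nonnegative.\<close>
    have "0 \<le> \<alpha> * (1/2 - 3/4 * \<kappa>) + 2 * \<kappa> * \<alpha>\<^sup>2" using \<alpha> \<kappa> by (intro add_nonneg_nonneg) auto
    then have "c + (1 - \<alpha>)\<^sup>2 \<le> (1 + \<kappa>) * den \<alpha>"
      by (simp add: c_def den_def power2_eq_square field_simps)
    then have "(c + (1 - \<alpha>)\<^sup>2) * \<rho> \<le> (1 + \<kappa>) * den \<alpha> * \<rho>" using \<rho>pos by (intro mult_right_mono) auto
    also have "\<dots> = (1 + \<kappa>) * \<rho>b * (1 - \<alpha>)\<^sup>2" using d0 by (simp add: \<rho>)
    also have "\<dots> \<le> Pc * (1 - \<alpha>)\<^sup>2" using \<rho>b_bounds(2) by (intro mult_right_mono) auto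
    finally have "c * \<rho> \<le> (Pc - \<rho>) * (1 - \<alpha>)\<^sup>2" by (simp add: algebra_simps)
    then have "c / (1 - \<alpha>)\<^sup>2 * \<rho> \<le> Pc - \<rho>" using \<alpha> by (simp add: divide_le_eq)
    then have "c / (1 - \<alpha>)\<^sup>2 * \<rho> * (\<rho> * (norm u)\<^sup>2) \<le> (Pc - \<rho>) * (\<rho> * (norm u)\<^sup>2)"
      using \<rho>pos by (intro mult_right_mono) auto
    then show ?thesis unfolding c_def[symmetric] x2u
      using abs_of_pos[OF \<rho>pos] by (simp add: power_mult_distrib power2_eq_square mult_ac)
  qed
  ultimately show ?thesis unfolding x2u(1) by linarith
qed

text \<open>\<open>1 - \<alpha>^2 / 5\<close> and \<open>(1 - \<alpha>) / den \<alpha>\<close> both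
  decrease in \<alpha>, so the drift is smallest at \<open>\<alpha>bar\<close>.\<close>

lemma drift_ratio_mono:
  assumes "0 \<le> \<alpha>" "\<alpha> \<le> \<beta>" "\<beta> < 1"
  shows "(1 - \<beta>\<^sup>2 / 5) * (1 - \<beta>) / den \<beta> \<le> (1 - \<alpha>\<^sup>2 / 5) * (1 - \<alpha>) / den \<alpha>"
proof -
  have d: "0 < den \<alpha>" "0 < den \<beta>" using den_lower(2)[of \<alpha>] den_lower(2)[of \<beta>] assms by auto
  have "\<alpha> * \<beta> \<le> \<beta>" using assms by (intro mult_left_le_one_le) auto
  then have "0 \<le> (\<beta> - \<alpha>) * (3/2 + 2 * (\<alpha> + \<beta> - \<alpha> * \<beta>) - 1)"
    using assms by (intro mult_nonneg_nonneg) auto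
  also have "\<dots> = (1 - \<alpha>) * den \<beta> - (1 - \<beta>) * den \<alpha>"
    by (simp add: den_def power2_eq_square field_simps)
  finally have "(1 - \<beta>) / den \<beta> \<le> (1 - \<alpha>) / den \<alpha>" using d by (simp add: field_simps)
  moreover have "\<alpha>\<^sup>2 \<le> \<beta>\<^sup>2" "\<beta>\<^sup>2 \<le> 1" "\<alpha>\<^sup>2 \<le> 1" using assms by (auto intro: power_mono power_le_one)
  ultimately have "(1 - \<beta>\<^sup>2 / 5) * ((1 - \<beta>) / den \<beta>) \<le> (1 - \<alpha>\<^sup>2 / 5) * ((1 - \<alpha>) / den \<alpha>)"
    using assms d by (intro mult_mono) auto
  then show ?thesis by simp
qed

lemma rate_bounds: "0 < rate" "rate < 1"
proof -
  have "\<rho>b \<le> 3/2"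
  proof -
    have "(3/2 - m) / (1 + m) \<le> 3/2" using m_pos by (simp add: divide_le_eq)
    then show ?thesis using \<rho>b_bounds(3) by linarith
  qed
  moreover define w k where "w = (1 - \<alpha>bar)\<^sup>2" and "k = (1 - b) * m"
  moreover have w: "w \<le> 1" "0 < w" using \<alpha>bar by (auto simp: w_def intro: power_le_one)
  moreover have k: "k \<le> 1/4" "0 < k"
    using mult_mono[of "1 - b" 1 m "1/4"] ab m_le m_pos by (auto simp: k_def)
  ultimately have "\<rho>b * w \<le> 3/2 * 1" using \<rho>b_bounds by (intro mult_mono) auto
  then have "\<rho>b * w * k \<le> 3/2 * (1/4)" using mult_mono[of "\<rho>b * w" "3/2" k "1/4"] k by simp
  moreover have "0 < \<rho>b * w * k" using \<rho>b_bounds w k by simp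
  moreover have "rate = 1 - 32/31 * (\<rho>b * w * k)" by (simp add: rate_def w_def k_def)
  ultimately show "0 < rate" "rate < 1" by auto
qed

lemma G_gt_1: "1 < G"
proof -
  \<comment> \<open>\<open>93/80 = 31/32 * 6/5\<close>, where 6/5 is the lower bound for
    \<open>\<sigma>0\<close>.\<close>
  have "den \<alpha>bar * (1 - \<alpha>bar) < 93/80 * (1 - \<alpha>bar\<^sup>2 / 5)"
  proof -
    have "0 < 2 * (\<alpha>bar - 2/3)\<^sup>2 + 1/2" by (simp add: add_nonneg_pos)
    then have "0 < \<alpha>bar * (3/2 - 11/4 * \<alpha>bar + 2 * \<alpha>bar\<^sup>2)"
      using \<alpha>bar by (intro mult_pos_pos) (simp_all add: power2_eq_square algebra_simps)
    moreover have "93/80 * (1 - \<alpha>bar\<^sup>2 / 5) - den \<alpha>bar * (1 - \<alpha>bar)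
        = 13/80 + \<alpha>bar * (3/2 - 11/4 * \<alpha>bar + 2 * \<alpha>bar\<^sup>2) + 7/400 * \<alpha>bar\<^sup>2"
      by (simp add: den_def power2_eq_square field_simps)
    ultimately show ?thesis using zero_le_power2[of \<alpha>bar] by linarith
  qed
  also have "\<dots> \<le> 31/32 * \<sigma>0 * (1 - \<alpha>bar\<^sup>2 / 5)"
    using adm_facts \<alpha>bar power_le_one[of \<alpha>bar 2] by (intro mult_right_mono) auto
  finally show ?thesis unfolding G_def using den_lower(2)[of \<alpha>bar] \<alpha>bar by (simp add: divide_simps)
qed

text \<open>Since \<open>G < x\<close>, the logarithm has the positive coefficient
  \<open>x + v - G\<close>, so an upper bound for it suffices. \<open>u\<close> is the Pade bound at
  \<open>1 / (1 - \<alpha>bar)\<close>, and \<open>drift_gap\<close> is the resulting inequality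
  with denominators cleared.\<close>

lemma drift_bound:
  assumes "G < x"
  shows "(x + v) * ln (1 / (1 - \<alpha>bar)) \<le> G * (ln 2 + ln (1 / (1 - \<alpha>bar)))"
proof -
  define g lr where "g = 1 / (1 - \<alpha>bar)" and "lr = ln g"
  define u where "u = \<alpha>bar * (6 - 5 * \<alpha>bar) / ((1 - \<alpha>bar) * (6 - 2 * \<alpha>bar))"
  have g: "1 \<le> g" using \<alpha>bar by (simp add: g_def)
  have pos: "0 < 1 - \<alpha>bar" "0 < 6 - 2 * \<alpha>bar" "0 < den \<alpha>bar" using \<alpha>bar den_lower(2)[of \<alpha>bar] by auto
  have "lr \<le> (g - 1) * (g + 5) / (4 * g + 2)" unfolding lr_def by (rule ln_le_pade[OF g])
  also have "\<dots> = u"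
    unfolding g_def u_def using pos by (simp add: divide_simps)
  finally have lr: "lr \<le> u" .
  have "(x + v) * u \<le> G * (u + 693/1000)"
  proof -
    define E where "E = den \<alpha>bar * (1 - \<alpha>bar)"
    define N where "N = (1 - \<alpha>bar) * (6 - 2 * \<alpha>bar)"
    have EN: "0 < E" "0 < N" using pos by (auto simp: E_def N_def)
    have "0 \<le> drift_gap \<alpha>bar \<sigma>0 (x + v)" using adm_facts \<alpha>bar by auto
    then have "(x + v) * ((u * N) * E) \<le> 31/32 * \<sigma>0 * ((1 - \<alpha>bar\<^sup>2 / 5) * (u * N + 693/1000 * N))"
      using EN(2) unfolding drift_gap_def E_def N_def u_def den_def by simp
    moreover have "G * E = 31/32 * \<sigma>0 * (1 - \<alpha>bar\<^sup>2 / 5)" unfolding G_def E_def[symmetric] using EN(1) by simp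
    then have "31/32 * \<sigma>0 * ((1 - \<alpha>bar\<^sup>2 / 5) * (u * N + 693/1000 * N)) = G * (u + 693/1000) * (N * E)"
    proof -
      have "31/32 * \<sigma>0 * ((1 - \<alpha>bar\<^sup>2 / 5) * (u * N + 693/1000 * N)) = (31/32 * \<sigma>0 * (1 - \<alpha>bar\<^sup>2 / 5)) * ((u + 693/1000) * N)"
        by (simp only: distrib_right mult.assoc)
      also have "\<dots> = (G * E) * ((u + 693/1000) * N)" using \<open>G * E = _\<close> by simp
      finally show ?thesis by (simp only: mult_ac)
    qed
    ultimately have "(x + v) * ((u * N) * E) \<le> G * (u + 693/1000) * (N * E)" by linarith
    then have "(x + v) * u * (N * E) \<le> G * (u + 693/1000) * (N * E)" by (simp only: mult_ac)
    then show ?thesis using EN by (simp add: mult_le_cancel_right)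
  qed
  moreover have "(x + v - G) * lr \<le> (x + v - G) * u" using lr assms adm_facts by (intro mult_left_mono) auto
  moreover have "693/1000 \<le> ln (2::real)"
  proof -
    \<comment> \<open>Applied directly at 2, the Pade bound gives only 9/13, which is less than
      693/1000.\<close>
    have "ln (2::real) = ln (4/3) + ln (3/2)" by (simp flip: ln_mult_pos)
    then show ?thesis using pade_le_ln[of "4/3"] pade_le_ln[of "3/2"] by (simp add: power2_eq_square)
  qed
  then have "G * (693/1000) \<le> G * ln 2" using G_gt_1 by (intro mult_left_mono) auto
  ultimately have "(x + v) * lr \<le> G * (ln 2 + lr)" by (simp add: algebra_simps)
  then show ?thesis by (simp add: lr_def g_def)
qed

text \<open>The pair \<open>(x0, x1)\<close> is re-evaluated with the new \<alpha>, which costs the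
  jump factor, and the contraction is then applied with this \<alpha> on both sides.\<close>

lemma path_lyapunov_step:
  assumes \<alpha>0: "0 < \<alpha>0" "\<alpha>0 \<le> \<alpha>" and \<alpha>: "\<alpha> \<le> \<alpha>bar" and z: "z = x1 + \<alpha> *\<^sub>R (x1 - x0)"
    and \<rho>: "\<rho> = \<rho>b * (1 - \<alpha>)\<^sup>2 / den \<alpha>"
    and y: "y \<in> resolvent lam T (z - lam *\<^sub>R A)"
    and x2: "x2 = (1 - \<rho>) *\<^sub>R z + \<rho> *\<^sub>R (y + lam *\<^sub>R (A - B))"
    and U: "U = A - V z" and W: "W = B - V y"
    and S: "S0 = \<alpha>0 / (1 - \<alpha>0)" "S = \<alpha> / (1 - \<alpha>)"
  shows "lyapunov S (potential S \<kappa>) xbar x1 x2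
      \<le> rate powr G * ((1 + S) / (1 + S0)) powr x * lyapunov S0 (potential S0 \<kappa>) xbar x0 x1
        + \<rho>b * noise ((norm W)\<^sup>2) ((norm U)\<^sup>2)"
proof -
  have \<alpha>': "0 < \<alpha>" "\<alpha> < 1" using \<alpha>0 \<alpha> \<alpha>bar by auto
  have \<kappa>: "0 < \<kappa>" using adm_facts by simp
  have d0: "0 < den \<alpha>" using den_lower(2)[of \<alpha>] \<alpha>' by simp
  have S0: "0 \<le> S0" "0 \<le> S" using \<alpha>0 \<alpha>' by (auto simp: S)
  have gS: "1 + S = 1 / (1 - \<alpha>)" "1 + S0 = 1 / (1 - \<alpha>0)" using \<alpha>' \<alpha>0 by (auto simp: S field_simps)
  define t where "t = \<rho> * (\<sigma> * m)"
  have \<rho>0: "0 \<le> \<rho>" using \<rho>b_bounds d0 by (simp add: \<rho>)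
  have gt: "(1 + S) * t = \<rho>b * (\<sigma> * m) * ((1 - \<alpha>) / den \<alpha>)"
    using \<alpha>' d0 by (simp add: gS t_def \<rho> power2_eq_square)
  have nn: "0 \<le> noise ((norm W)\<^sup>2) ((norm U)\<^sup>2)"
    unfolding noise_def using D2_pos Pc_ge ch_nonneg Sl_pos by (intro add_nonneg_nonneg mult_nonneg_nonneg) auto
  have "lyapunov S (potential S \<kappa>) xbar x1 x2
      \<le> (1 - (1 + S) * t * (1 - \<alpha>\<^sup>2 / 5)) * lyapunov S (potential S \<kappa> - \<kappa> / 2) xbar x0 x1
        + (1 + S) * (\<rho> * noise ((norm W)\<^sup>2) ((norm U)\<^sup>2))"
  proof (rule lyapunov_contraction[OF \<alpha>' \<kappa> S(2) z refl])
    show "(norm (x2 - xbar))\<^sup>2 \<le> (1 - t) * (norm (z - xbar))\<^sup>2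
      - (\<alpha>\<^sup>2 + \<alpha> + \<kappa> * (1 + \<alpha> / 4)) / (1 - \<alpha>)\<^sup>2 * (norm (x2 - z))\<^sup>2
      + \<rho> * noise ((norm W)\<^sup>2) ((norm U)\<^sup>2)"
      unfolding t_def by (rule path_step[OF \<alpha>' z \<rho> y x2 U W])
    show "0 \<le> t" using \<rho>0 \<sigma>_bounds m_pos by (simp add: t_def)
    have "\<rho>b * (\<sigma> * m) \<le> (3/2 - m) / (1 + m) * (\<sigma>0 * m)"
      using \<rho>b_bounds \<sigma>_bounds m_pos m_le by (intro mult_mono) auto
    also have "\<dots> \<le> y0" using adm_facts m_pos by (simp add: divide_le_eq mult_ac)
    finally have "\<rho>b * (\<sigma> * m) * (1 - \<alpha>) \<le> y0 * (1 - \<alpha>)" using \<alpha>' by (intro mult_right_mono) auto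
    then show "(1 + S) * t * (2 * \<alpha>\<^sup>2 - 1/2 * \<alpha> + 1) \<le> y0 * (1 - \<alpha>)"
      unfolding gt den_def[symmetric] using d0 by simp
    show "0 \<le> rate_gap \<alpha> \<kappa> y0" using adm_facts \<alpha>' by simp
  qed
  also have "\<dots> \<le> rate powr G * lyapunov S (potential S \<kappa> - \<kappa> / 2) xbar x0 x1
        + \<rho>b * noise ((norm W)\<^sup>2) ((norm U)\<^sup>2)"
  proof (intro add_mono mult_right_mono)
    have ratio: "G * (1 - rate) = \<rho>b * (\<sigma> * m) * ((1 - \<alpha>bar\<^sup>2 / 5) * (1 - \<alpha>bar) / den \<alpha>bar)"
      using \<alpha>bar den_lower(2)[of \<alpha>bar] by (simp add: G_def rate_def \<sigma>_def power2_eq_square)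
    have "\<dots> \<le> \<rho>b * (\<sigma> * m) * ((1 - \<alpha>\<^sup>2 / 5) * (1 - \<alpha>) / den \<alpha>)"
      using drift_ratio_mono[of \<alpha> \<alpha>bar] \<alpha> \<alpha>' \<alpha>bar \<rho>b_bounds \<sigma>_bounds m_pos by (intro mult_left_mono) auto
    also have "\<dots> = (1 + S) * t * (1 - \<alpha>\<^sup>2 / 5)" unfolding gt by simp
    finally have "1 - (1 + S) * t * (1 - \<alpha>\<^sup>2 / 5) \<le> 1 - G * (1 - rate)" unfolding ratio by simp
    \<comment> \<open>Bernoulli's inequality, as the tangent of the convex \<open>x powr G\<close>
      at 1.\<close>
    also have "\<dots> \<le> rate powr G"
    proof -
      have "convex_on {0<..} (\<lambda>x. x powr G)" using G_gt_1 by (intro convex_on_subset[OF powr_convex]) auto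
      moreover have "((\<lambda>x. x powr G) has_real_derivative G) (at 1 within {0<..})"
        by (rule has_field_derivative_at_within) (auto intro!: derivative_eq_intros)
      ultimately have "G * (rate - 1) \<le> rate powr G - 1"
        using convex_on_imp_above_tangent[of "{0<..}" "\<lambda>x. x powr G" 1 rate G] rate_bounds by (auto simp: interior_open)
      then show ?thesis by (simp add: algebra_simps)
    qed
    finally show "1 - (1 + S) * t * (1 - \<alpha>\<^sup>2 / 5) \<le> rate powr G" .
    have "\<kappa> \<le> potential S \<kappa>" using potential_bounds[OF S0(2) \<kappa>] zero_le_power2[of S] by linarith
    then show "0 \<le> lyapunov S (potential S \<kappa> - \<kappa> / 2) xbar x0 x1" using \<kappa> by (simp add: lyapunov_def)
    \<comment> \<open>\<open>1 - \<alpha> \<le> den \<alpha>\<close> frees the noise factor from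
      \<alpha>.\<close>
    have "(1 + S) * \<rho> = \<rho>b * ((1 - \<alpha>) / den \<alpha>)" using \<alpha>' by (simp add: gS \<rho> power2_eq_square)
    also have "\<dots> \<le> \<rho>b * 1" using den_lower(1)[of \<alpha>] \<alpha>' d0 \<rho>b_bounds by (intro mult_left_mono) auto
    finally have "(1 + S) * \<rho> * noise ((norm W)\<^sup>2) ((norm U)\<^sup>2) \<le> \<rho>b * 1 * noise ((norm W)\<^sup>2) ((norm U)\<^sup>2)"
      using nn by (rule mult_right_mono)
    then show "(1 + S) * (\<rho> * noise ((norm W)\<^sup>2) ((norm U)\<^sup>2)) \<le> \<rho>b * noise ((norm W)\<^sup>2) ((norm U)\<^sup>2)" by simp
  qed
  also have "lyapunov S (potential S \<kappa> - \<kappa> / 2) xbar x0 x1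
      \<le> ((1 + S) / (1 + S0)) powr x * lyapunov S0 (potential S0 \<kappa>) xbar x0 x1"
  proof -
    define r where "r = (1 + S) / (1 + S0) - 1"
    have r: "0 \<le> r" using \<alpha>0 \<alpha>' by (simp add: r_def gS field_simps)
    have "r * (1 + S0) = S - S0" using S0 by (simp add: r_def left_diff_distrib)
    then have "S = S0 + r + r * S0" by (simp add: algebra_simps)
    from lyapunov_jump[OF _ S0(1) r this \<kappa>, of x xbar x0 x1] show ?thesis using adm_facts by (simp add: r_def)
  qed
  finally show ?thesis by (simp add: mult_left_mono)
qed

end

section \<open>Measurability and conditional expectations\<close>

lemma resolvent_nonexpansive:
  fixes y y' z z' :: "'h::real_inner"
  assumes T: "monotone_operator T" and lam: "0 < lam"
    and y: "y \<in> resolvent lam T z" "y' \<in> resolvent lam T z'"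
  shows "norm (y - y') \<le> norm (z - z')"
proof -
  obtain u u' where u: "u \<in> T y" "z = y + lam *\<^sub>R u" "u' \<in> T y'" "z' = y' + lam *\<^sub>R u'"
    using y by (auto simp: resolvent_def)
  have "0 \<le> lam * inner (u - u') (y - y')"
    using T u lam by (auto simp: monotone_operator_def)
  then have "(norm (y - y'))\<^sup>2 \<le> inner (z - z') (y - y')"
    unfolding u by (simp add: power2_norm_eq_inner inner_simps algebra_simps)
  also have "\<dots> \<le> norm (z - z') * norm (y - y')" by (rule norm_cauchy_schwarz)
  finally show ?thesis
    by (cases "y = y'") (auto simp: power2_eq_square)
qed

text \<open>The set where the resolvent is nonempty need not be visibly Borel. A selection on it is
  nonexpansive, hence extends to the closure, and a continuous function on a closed set is
  measurable once it is cut off outside.\<close>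

lemma borel_measurable_resolvent:
  fixes \<zeta> Y :: "'w \<Rightarrow> 'h::{real_inner, banach}"
  assumes T: "monotone_operator T" and lam: "0 < lam" and \<zeta>: "\<zeta> \<in> borel_measurable M"
    and Y: "\<And>\<omega>. \<omega> \<in> space M \<Longrightarrow> Y \<omega> \<in> resolvent lam T (\<zeta> \<omega>)"
  shows "Y \<in> borel_measurable M"
proof -
  define D where "D = {z. resolvent lam T z \<noteq> {}}"
  define J where "J z = (SOME y. y \<in> resolvent lam T z)" for z
  have J: "J z \<in> resolvent lam T z" if "z \<in> D" for z
    using that unfolding D_def J_def by (auto intro: someI)
  have "1-lipschitz_on D J"
    by (rule lipschitz_onI) (auto simp: dist_norm intro!: resolvent_nonexpansive[OF T lam] J)
  from lipschitz_extend_closure[OF this] obtain g where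
    g: "1-lipschitz_on (closure D) g" "\<And>x. x \<in> D \<Longrightarrow> g x = J x" by blast
  have "(\<lambda>x. indicator (closure D) x *\<^sub>R g x) \<in> borel_measurable borel"
    by (rule borel_measurable_continuous_on_indicator) (auto intro: lipschitz_on_continuous_on[OF g(1)])
  from measurable_compose[OF \<zeta> this]
  have "(\<lambda>\<omega>. indicator (closure D) (\<zeta> \<omega>) *\<^sub>R g (\<zeta> \<omega>)) \<in> borel_measurable M" .
  also have "?this \<longleftrightarrow> ?thesis"
  proof (rule measurable_cong)
    fix \<omega> assume \<omega>: "\<omega> \<in> space M"
    then have D: "\<zeta> \<omega> \<in> D" using Y by (auto simp: D_def)
    have "norm (J (\<zeta> \<omega>) - Y \<omega>) \<le> norm (\<zeta> \<omega> - \<zeta> \<omega>)"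
      by (rule resolvent_nonexpansive[OF T lam J[OF D] Y[OF \<omega>]])
    then show "indicator (closure D) (\<zeta> \<omega>) *\<^sub>R g (\<zeta> \<omega>) = Y \<omega>"
      using D closure_subset[of D] g(2)[OF D] by (auto simp: indicator_def)
  qed
  finally show ?thesis .
qed

lemma borel_measurable_batch_mean:
  fixes Vhat :: "'h::{real_normed_vector, second_countable_topology} \<Rightarrow> 'd::euclidean_space \<Rightarrow> 'h"
  assumes V: "stochastic_oracle \<Xi> P Vhat" and Q: "Q \<in> borel_measurable M"
    and \<zeta>: "\<And>t. t \<in> {1..n} \<Longrightarrow> \<zeta> t \<in> measurable M P"
  shows "batch_mean Vhat n \<zeta> Q \<in> borel_measurable M"
proof -
  have P: "sets P = sets (restrict_space borel \<Xi>)"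
    and Vm: "(\<lambda>(x, z). Vhat x z) \<in> borel_measurable (borel \<Otimes>\<^sub>M restrict_space borel \<Xi>)"
    using V by (auto simp: stochastic_oracle_def)
  have "(\<lambda>\<omega>. Vhat (Q \<omega>) (\<zeta> t \<omega>)) \<in> borel_measurable M" if t: "t \<in> {1..n}" for t
  proof -
    have "\<zeta> t \<in> measurable M (restrict_space borel \<Xi>)"
      using \<zeta>[OF t] measurable_cong_sets[OF refl P] by blast
    then have "(\<lambda>\<omega>. (Q \<omega>, \<zeta> t \<omega>)) \<in> measurable M (borel \<Otimes>\<^sub>M restrict_space borel \<Xi>)"
      using Q by (intro measurable_Pair)
    from measurable_compose[OF this Vm] show ?thesis by simp
  qed
  then show ?thesis unfolding batch_mean_def[abs_def]
    by (intro borel_measurable_scaleR borel_measurable_sum borel_measurable_const)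
qed

lemma RISFBF_measurable:
  fixes Vhat :: "'h::{real_inner, banach, second_countable_topology} \<Rightarrow> 'd::euclidean_space \<Rightarrow> 'h"
  assumes proc: "RISFBF M T Vhat \<alpha> \<rho> lam m \<xi> \<eta> x0 x1 X Y Z A B"
    and T: "monotone_operator T" and V: "stochastic_oracle \<Xi> P Vhat" and iid: "iid_samples M P m \<xi> \<eta>"
  shows "X k \<in> borel_measurable M"
    "1 \<le> k \<Longrightarrow> Z k \<in> borel_measurable M" "1 \<le> k \<Longrightarrow> A k \<in> borel_measurable M"
    "1 \<le> k \<Longrightarrow> Y k \<in> borel_measurable M" "1 \<le> k \<Longrightarrow> B k \<in> borel_measurable M"
proof -
  have samples: "\<xi> k t \<in> measurable M P" "\<eta> k t \<in> measurable M P" if "1 \<le> k" "t \<in> {1..m k}" for k t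
    using iid that unfolding iid_samples_def by blast+
  have init: "X 0 \<omega> = x0" "X 1 \<omega> = x1" if "\<omega> \<in> space M" for \<omega>
    using proc that by (auto simp: RISFBF_def)
  have it: "Z k \<omega> = X k \<omega> + \<alpha> k *\<^sub>R (X k \<omega> - X (k - 1) \<omega>)"
      "A k \<omega> = batch_mean Vhat (m k) (\<xi> k) (Z k) \<omega>"
      "Y k \<omega> \<in> resolvent (lam k) T (Z k \<omega> - lam k *\<^sub>R A k \<omega>)"
      "B k \<omega> = batch_mean Vhat (m k) (\<eta> k) (Y k) \<omega>"
      "X (k + 1) \<omega> = (1 - \<rho> k) *\<^sub>R Z k \<omega> + \<rho> k *\<^sub>R (Y k \<omega> + lam k *\<^sub>R (A k \<omega> - B k \<omega>))"
    if "\<omega> \<in> space M" "1 \<le> k" for k \<omega>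
    using proc that unfolding RISFBF_def by blast+
  have lam: "0 < lam k" if "1 \<le> k" for k using proc that unfolding RISFBF_def by blast
  have step: "Z k \<in> borel_measurable M \<and> A k \<in> borel_measurable M \<and> Y k \<in> borel_measurable M
      \<and> B k \<in> borel_measurable M \<and> X (k + 1) \<in> borel_measurable M"
    if k: "1 \<le> k" and X: "X k \<in> borel_measurable M" "X (k - 1) \<in> borel_measurable M" for k
  proof -
    note [measurable] = X
    have Z[measurable]: "Z k \<in> borel_measurable M"
      by (subst measurable_cong[OF it(1)[OF _ k]]) (use X in auto)
    have A[measurable]: "A k \<in> borel_measurable M"
      by (subst measurable_cong[OF it(2)[OF _ k]])
        (auto intro!: borel_measurable_batch_mean[OF V] samples k)
    have Y[measurable]: "Y k \<in> borel_measurable M"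
      by (rule borel_measurable_resolvent[OF T lam[OF k] _ it(3)[OF _ k]]) auto
    have B[measurable]: "B k \<in> borel_measurable M"
      by (subst measurable_cong[OF it(4)[OF _ k]])
        (auto intro!: borel_measurable_batch_mean[OF V] samples k)
    have "X (k + 1) \<in> borel_measurable M"
      by (subst measurable_cong[OF it(5)[OF _ k]]) auto
    then show ?thesis using Z A Y B by blast
  qed
  have X: "X k \<in> borel_measurable M \<and> X (Suc k) \<in> borel_measurable M" for k
  proof (induction k)
    case 0
    have "X 0 \<in> borel_measurable M" by (subst measurable_cong[OF init(1)]) auto
    moreover have "X 1 \<in> borel_measurable M" by (subst measurable_cong[OF init(2)]) auto
    ultimately show ?case by simp
  next
    case (Suc k)
    then show ?case using step[of "Suc k"] by simp
  qed
  then show "X k \<in> borel_measurable M" by simp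
  have "Z k \<in> borel_measurable M \<and> A k \<in> borel_measurable M \<and> Y k \<in> borel_measurable M
      \<and> B k \<in> borel_measurable M" if "1 \<le> k"
    using step[OF that] X[of k] X[of "k - 1"] by simp
  then show "1 \<le> k \<Longrightarrow> Z k \<in> borel_measurable M" "1 \<le> k \<Longrightarrow> A k \<in> borel_measurable M"
    "1 \<le> k \<Longrightarrow> Y k \<in> borel_measurable M" "1 \<le> k \<Longrightarrow> B k \<in> borel_measurable M" by simp_all
qed

lemma subalgebra_RISFBF_filtration:
  assumes X: "\<And>k. X k \<in> borel_measurable M" and iid: "iid_samples M P m \<xi> \<eta>"
  shows "subalgebra M (RISFBF_filtration M P m \<xi> \<eta> X k)"
proof -
  have samples: "\<xi> k t \<in> measurable M P" "\<eta> k t \<in> measurable M P" if "1 \<le> k" "t \<in> {1..m k}" for k t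
    using iid that unfolding iid_samples_def by blast+
  let ?G = "{X i -` S \<inter> space M | i S. i \<le> 1 \<and> S \<in> sets borel} \<union>
      {\<xi> j t -` S \<inter> space M | j t S. 1 \<le> j \<and> j < k \<and> t \<in> {1..m j} \<and> S \<in> sets P} \<union>
      {\<eta> j t -` S \<inter> space M | j t S. 1 \<le> j \<and> j < k \<and> t \<in> {1..m j} \<and> S \<in> sets P}"
  have "?G \<subseteq> sets M" using measurable_sets[OF X] measurable_sets[OF samples(1)] measurable_sets[OF samples(2)] by blast
  then have "sigma_sets (space M) ?G \<subseteq> sets M" by (rule sets.sigma_sets_subset)
  moreover have "?G \<subseteq> Pow (space M)" by auto
  ultimately show ?thesis
    by (simp add: subalgebra_def RISFBF_filtration_def space_measure_of sets_measure_of)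
qed

lemma (in prob_space) nn_integral_le_of_nn_cond_exp_le:
  assumes F: "subalgebra M F" and f: "f \<in> borel_measurable M"
    and AE: "AE \<omega> in M. nn_cond_exp M F f \<omega> \<le> c"
  shows "(\<integral>\<^sup>+ \<omega>. f \<omega> \<partial>M) \<le> c"
proof -
  interpret finite_measure_subalgebra M F by unfold_locales (rule F)
  have "(\<integral>\<^sup>+ \<omega>. f \<omega> \<partial>M) = (\<integral>\<^sup>+ \<omega>. 1 * nn_cond_exp M F f \<omega> \<partial>M)"
    using nn_cond_exp_intg[of "\<lambda>_. 1" f] f by simp
  also have "\<dots> \<le> (\<integral>\<^sup>+ \<omega>. c \<partial>M)" using AE by (intro nn_integral_mono_AE) auto
  also have "\<dots> = c" by (simp add: emeasure_space_1)
  finally show ?thesis .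
qed

section \<open>Expected first passage and complexity\<close>

text \<open>The floor of a number that is at least 1 is at least half of it. This 2 and the 2 in
  \<open>first_passage_bound\<close> make up the 4 before \<open>Bc\<close> in \<open>C\<close> and
  \<open>Chat\<close>.\<close>

lemma floor_batch_bounds:
  fixes p :: real
  assumes p: "0 < p" "p < 1" and n: "n = nat \<lfloor>p powi (- int k)\<rfloor>"
  shows "1 / real n \<le> 2 * p ^ k" "real n \<le> (1 / p) ^ k"
proof -
  define y where "y = (1 / p) ^ k"
  have y: "p powi (- int k) = y"
    using p by (simp add: y_def power_int_minus power_one_over inverse_eq_divide)
  have y1: "1 \<le> y" unfolding y_def by (rule one_le_power) (use p in simp)
  have n': "real n = of_int \<lfloor>y\<rfloor>" using y1 by (simp add: n y)
  then show "real n \<le> (1 / p) ^ k" by (simp add: y_def[symmetric])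
  have "1 \<le> \<lfloor>y\<rfloor>" using y1 by simp
  then have "1 \<le> real n" unfolding n' by linarith
  moreover have "y < real n + 1" unfolding n' by linarith
  ultimately have "y \<le> 2 * real n" "0 < real n" by linarith+
  moreover have "p ^ k * y = 1" using p by (simp add: y_def power_one_over)
  ultimately have "1 \<le> p ^ k * (2 * real n)" using p by (metis mult_left_mono zero_le_power less_imp_le)
  then show "1 / real n \<le> 2 * p ^ k" using \<open>0 < real n\<close> by (simp add: field_simps)
qed

context risfbf_setting
begin

text \<open>\<open>ly n\<close> belongs to the pair \<open>X n\<close>, \<open>X (n + 1)\<close>, so
  the index \<open>n\<close> of the abstract recursion speaks of \<open>X (n + 1)\<close>, as in the
  definition of the hitting index.\<close>

lemma expected_first_passage:
  fixes M :: "'w measure" and X Y Z A B U W :: "nat \<Rightarrow> 'w \<Rightarrow> 'h" and bs :: "nat \<Rightarrow> nat"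
    and \<alpha> \<rho> :: "nat \<Rightarrow> real"
  assumes \<alpha>: "\<And>j k. 1 \<le> j \<Longrightarrow> j \<le> k \<Longrightarrow> \<alpha> j \<le> \<alpha> k" "\<And>k. 1 \<le> k \<Longrightarrow> 0 < \<alpha> k \<and> \<alpha> k \<le> \<alpha>bar"
    and \<rho>: "\<And>k. 1 \<le> k \<Longrightarrow> \<rho> k = \<rho>b * (1 - \<alpha> k)\<^sup>2 / den (\<alpha> k)"
    and p: "0 < p" and bs: "\<And>k. 1 \<le> k \<Longrightarrow> 1 / real (bs k) \<le> 2 * p ^ k"
    and M: "prob_space M"
    and meas: "\<And>k. X k \<in> borel_measurable M" "\<And>k. 1 \<le> k \<Longrightarrow> U k \<in> borel_measurable M"
      "\<And>k. 1 \<le> k \<Longrightarrow> W k \<in> borel_measurable M"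
    and init: "\<And>\<omega>. \<omega> \<in> space M \<Longrightarrow> X 0 \<omega> = x1" "\<And>\<omega>. \<omega> \<in> space M \<Longrightarrow> X 1 \<omega> = x1"
    and it: "\<And>k \<omega>. \<omega> \<in> space M \<Longrightarrow> 1 \<le> k \<Longrightarrow> Z k \<omega> = X k \<omega> + \<alpha> k *\<^sub>R (X k \<omega> - X (k - 1) \<omega>)"
      "\<And>k \<omega>. \<omega> \<in> space M \<Longrightarrow> 1 \<le> k \<Longrightarrow> Y k \<omega> \<in> resolvent lam T (Z k \<omega> - lam *\<^sub>R A k \<omega>)"
      "\<And>k \<omega>. \<omega> \<in> space M \<Longrightarrow> 1 \<le> k \<Longrightarrow>
        X (k + 1) \<omega> = (1 - \<rho> k) *\<^sub>R Z k \<omega> + \<rho> k *\<^sub>R (Y k \<omega> + lam *\<^sub>R (A k \<omega> - B k \<omega>))"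
    and U: "\<And>k \<omega>. U k \<omega> = A k \<omega> - V (Z k \<omega>)" and W: "\<And>k \<omega>. W k \<omega> = B k \<omega> - V (Y k \<omega>)"
    and noise_bounds: "\<And>k. 1 \<le> k \<Longrightarrow> (\<integral>\<^sup>+ \<omega>. ennreal ((norm (U k \<omega>))\<^sup>2) \<partial>M) \<le> ennreal (s\<^sup>2 / real (bs k))"
      "\<And>k. 1 \<le> k \<Longrightarrow> (\<integral>\<^sup>+ \<omega>. ennreal ((norm (W k \<omega>))\<^sup>2) \<partial>M) \<le> ennreal (s\<^sup>2 / real (bs k))"
    and Bc: "Bc = 2 * \<rho>b * s\<^sup>2 * (1 + 4 * \<rho>b * lam\<^sup>2)"
  shows "\<exists>n\<le>k. (\<integral>\<^sup>+ \<omega>. ennreal ((norm (X (n + 1) \<omega> - xbar))\<^sup>2) \<partial>M)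
    \<le> ennreal (2 * (1 - \<alpha> 1) / (1 - \<alpha>bar) * (norm (x1 - xbar))\<^sup>2 * rate ^ k
        + 4 * Bc / (1 - \<alpha>bar) * (\<Sum>j=1..k. rate ^ (k - j) * p ^ j))"
proof -
  interpret prob_space M by fact
  \<comment> \<open>\<open>max n 1\<close> supplies a value at 0, which gives
    \<open>g 0 = 1 / (1 - \<alpha> 1)\<close> and with it the factor \<open>1 - \<alpha> 1\<close>
    of the bound.\<close>
  define \<alpha>' S g where "\<alpha>' n = \<alpha> (max n 1)" and "S n = \<alpha>' n / (1 - \<alpha>' n)" and "g n = 1 / (1 - \<alpha>' n)" for n
  have \<alpha>': "0 < \<alpha>' n" "\<alpha>' n \<le> \<alpha>bar" "\<alpha>' n < 1" for n
    using \<alpha>(2)[of "max n 1"] \<alpha>bar by (auto simp: \<alpha>'_def)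
  have \<alpha>'_mono: "\<alpha>' i \<le> \<alpha>' j" if "i \<le> j" for i j unfolding \<alpha>'_def by (rule \<alpha>(1)) (use that in auto)
  have S: "0 < S n" "1 + S n = g n" for n using \<alpha>'[of n] by (auto simp: S_def g_def field_simps)
  have \<kappa>: "0 < \<kappa>" using adm_facts by simp
  define Q where "Q n = potential (S n) \<kappa>" for n
  have Q: "0 < Q n" for n
    using potential_bounds[of "S n" \<kappa>] S(1)[of n] \<kappa> zero_le_power2[of "S n"] unfolding Q_def by linarith
  define ly where "ly n \<omega> = lyapunov (S n) (Q n) xbar (X n \<omega>) (X (Suc n) \<omega>)" for n \<omega>
  have ly_nn: "0 \<le> ly n \<omega>" for n \<omega> using Q[of n] by (simp add: ly_def lyapunov_def)
  have [measurable]: "ly n \<in> borel_measurable M" for n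
    unfolding ly_def lyapunov_def using meas(1) by simp
  define a where "a n = (\<integral>\<^sup>+ \<omega>. ennreal (ly n \<omega>) \<partial>M)" for n
  define r where "r n = rate powr G * (g (Suc n) / g n) powr x" for n
  have r: "0 \<le> r n" for n by (simp add: r_def)
  define c2 where "c2 = 2 * lam\<^sup>2 * (Pc + ch + cc / Sl)"
  define c1 where "c1 = lam\<^sup>2 / D2 + c2"
  have c: "0 \<le> c1" "0 \<le> c2" using D2_pos Pc_ge ch_nonneg Sl_pos by (auto simp: c1_def c2_def)
  \<comment> \<open>Both errors have the same variance bound, so only the sum counts;
    \<open>1 \<le> \<rho>b\<close> later turns this into the factor in \<open>Bc\<close>.\<close>
  have c12: "c1 + c2 \<le> 2 + 8 * lam\<^sup>2"
    using noise_le[of "lam\<^sup>2"] lam2 by (simp add: c1_def c2_def algebra_simps)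
  have Bc0: "0 \<le> Bc" using \<rho>b_bounds by (simp add: Bc)
  \<comment> \<open>As \<open>X 0 = X 1\<close>, the initial velocity vanishes and the initial value
    contains no weight.\<close>
  have a0: "a 0 = ennreal ((norm (x1 - xbar))\<^sup>2)"
  proof -
    have "a 0 = (\<integral>\<^sup>+ \<omega>. ennreal ((norm (x1 - xbar))\<^sup>2) \<partial>M)"
      unfolding a_def by (rule nn_integral_cong) (simp add: ly_def lyapunov_def init(1) init(2)[simplified])
    then show ?thesis by (simp add: emeasure_space_1)
  qed
  have rec: "a (Suc n) \<le> ennreal (r n) * a n + ennreal (2 * Bc * p ^ Suc n)" for n
  proof -
    let ?k = "Suc n"
    note [measurable] = meas(2,3)[of ?k, simplified]
    define nb where "nb = s\<^sup>2 / real (bs ?k)"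
    have nb: "0 \<le> nb" by (simp add: nb_def)
    have path: "ly ?k \<omega> \<le> r n * ly n \<omega> + \<rho>b * (c1 * (norm (W ?k \<omega>))\<^sup>2 + c2 * (norm (U ?k \<omega>))\<^sup>2)"
      if \<omega>: "\<omega> \<in> space M" for \<omega>
    proof -
      have \<alpha>k: "\<alpha>' ?k = \<alpha> ?k" by (simp add: \<alpha>'_def)
      have "lyapunov (S ?k) (potential (S ?k) \<kappa>) xbar (X ?k \<omega>) (X (Suc ?k) \<omega>)
        \<le> rate powr G * ((1 + S ?k) / (1 + S n)) powr x * lyapunov (S n) (potential (S n) \<kappa>) xbar (X n \<omega>) (X ?k \<omega>)
        + \<rho>b * noise ((norm (W ?k \<omega>))\<^sup>2) ((norm (U ?k \<omega>))\<^sup>2)"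
      proof (rule path_lyapunov_step)
        show "0 < \<alpha>' n" "\<alpha>' n \<le> \<alpha>' ?k" "\<alpha>' ?k \<le> \<alpha>bar" using \<alpha>' \<alpha>'_mono by auto
        show "Z ?k \<omega> = X ?k \<omega> + \<alpha>' ?k *\<^sub>R (X ?k \<omega> - X n \<omega>)" using it(1)[OF \<omega>, of ?k] by (simp add: \<alpha>k)
        show "\<rho> ?k = \<rho>b * (1 - \<alpha>' ?k)\<^sup>2 / den (\<alpha>' ?k)" using \<rho>[of ?k] by (simp add: \<alpha>k)
        show "Y ?k \<omega> \<in> resolvent lam T (Z ?k \<omega> - lam *\<^sub>R A ?k \<omega>)" using it(2)[OF \<omega>, of ?k] by simp
        show "X (Suc ?k) \<omega> = (1 - \<rho> ?k) *\<^sub>R Z ?k \<omega> + \<rho> ?k *\<^sub>R (Y ?k \<omega> + lam *\<^sub>R (A ?k \<omega> - B ?k \<omega>))"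
          using it(3)[OF \<omega>, of ?k] by simp
      qed (auto simp: U W S_def)
      moreover have "noise w u = c1 * w + c2 * u" for w u
        unfolding noise_def c1_def c2_def[symmetric] by (simp only: distrib_left distrib_right add_ac)
      ultimately show ?thesis by (simp add: ly_def Q_def r_def S(2))
    qed
    have "a ?k \<le> (\<integral>\<^sup>+ \<omega>. ennreal (r n) * ennreal (ly n \<omega>)
        + (ennreal (\<rho>b * c1) * ennreal ((norm (W ?k \<omega>))\<^sup>2) + ennreal (\<rho>b * c2) * ennreal ((norm (U ?k \<omega>))\<^sup>2)) \<partial>M)"
      unfolding a_def
    proof (rule nn_integral_mono)
      fix \<omega> assume "\<omega> \<in> space M"
      from path[OF this]
      have "ennreal (ly ?k \<omega>) \<le> ennreal (r n * ly n \<omega> + (\<rho>b * c1 * (norm (W ?k \<omega>))\<^sup>2 + \<rho>b * c2 * (norm (U ?k \<omega>))\<^sup>2))"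
        by (intro ennreal_leI) (simp add: algebra_simps)
      also have "\<dots> = ennreal (r n) * ennreal (ly n \<omega>)
        + (ennreal (\<rho>b * c1) * ennreal ((norm (W ?k \<omega>))\<^sup>2) + ennreal (\<rho>b * c2) * ennreal ((norm (U ?k \<omega>))\<^sup>2))"
        using r[of n] ly_nn[of n \<omega>] \<rho>b_bounds c by (simp add: ennreal_plus ennreal_mult)
      finally show "ennreal (ly ?k \<omega>) \<le> ennreal (r n) * ennreal (ly n \<omega>)
        + (ennreal (\<rho>b * c1) * ennreal ((norm (W ?k \<omega>))\<^sup>2) + ennreal (\<rho>b * c2) * ennreal ((norm (U ?k \<omega>))\<^sup>2))" .
    qed
    also have "\<dots> = ennreal (r n) * a n + (ennreal (\<rho>b * c1) * (\<integral>\<^sup>+ \<omega>. ennreal ((norm (W ?k \<omega>))\<^sup>2) \<partial>M)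
        + ennreal (\<rho>b * c2) * (\<integral>\<^sup>+ \<omega>. ennreal ((norm (U ?k \<omega>))\<^sup>2) \<partial>M))"
      by (simp add: nn_integral_add nn_integral_cmult a_def)
    also have "\<dots> \<le> ennreal (r n) * a n + (ennreal (\<rho>b * c1) * ennreal nb + ennreal (\<rho>b * c2) * ennreal nb)"
      using noise_bounds[of ?k] by (intro add_mono mult_left_mono) (auto simp: nb_def)
    also have "ennreal (\<rho>b * c1) * ennreal nb + ennreal (\<rho>b * c2) * ennreal nb = ennreal (\<rho>b * c1 * nb + \<rho>b * c2 * nb)"
      using \<rho>b_bounds c nb by (simp add: ennreal_plus ennreal_mult)
    also have "\<dots> \<le> ennreal (2 * Bc * p ^ ?k)"
    proof (rule ennreal_leI)
      have "\<rho>b * c1 * nb + \<rho>b * c2 * nb = (c1 + c2) * (\<rho>b * nb)" by (simp add: algebra_simps)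
      also have "\<dots> \<le> (2 * (1 + 4 * \<rho>b * lam\<^sup>2)) * (\<rho>b * nb)"
      proof (rule mult_right_mono)
        have "1 * lam\<^sup>2 \<le> \<rho>b * lam\<^sup>2" using \<rho>b_bounds(1) by (rule mult_right_mono) simp
        moreover have "2 * (1 + 4 * \<rho>b * lam\<^sup>2) = 2 + 8 * (\<rho>b * lam\<^sup>2)" by simp
        ultimately show "c1 + c2 \<le> 2 * (1 + 4 * \<rho>b * lam\<^sup>2)" using c12 by linarith
      qed (use \<rho>b_bounds nb in simp)
      also have "\<dots> = Bc * (1 / real (bs ?k))" by (simp add: Bc nb_def)
      also have "\<dots> \<le> Bc * (2 * p ^ ?k)" using bs[of ?k] Bc0 by (intro mult_left_mono) auto
      finally show "\<rho>b * c1 * nb + \<rho>b * c2 * nb \<le> 2 * Bc * p ^ ?k" by simp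
    qed
    finally show ?thesis by (simp add: add_left_mono)
  qed
  define A' where "A' n = enn2real (a n)" for n
  \<comment> \<open>Finiteness follows from the recursion in the extended reals, starting from the
    deterministic \<open>a 0\<close>; only now can real values be taken.\<close>
  have a_fin: "a n < \<top>" for n
  proof (induction n)
    case (Suc n)
    have "ennreal (r n) * a n + ennreal (2 * Bc * p ^ Suc n) < \<top>"
      using Suc by (simp add: ennreal_mult_less_top del: power_Suc)
    then show ?case using rec[of n] by (rule le_less_trans[rotated])
  qed (simp add: a0)
  have a: "a n = ennreal (A' n)" "0 \<le> A' n" for n using a_fin[of n] by (auto simp: A'_def)
  define K where "K n = 1 + (S n)\<^sup>2 / Q n" for n
  have K1: "1 \<le> K n" for n using Q[of n] by (simp add: K_def)
  define E where "E n = (\<integral>\<^sup>+ \<omega>. ennreal ((norm (X (n + 1) \<omega> - xbar))\<^sup>2) \<partial>M)" for n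
  have E: "E n \<le> ennreal (K n * A' n)" for n
  proof -
    have "E n \<le> (\<integral>\<^sup>+ \<omega>. ennreal (K n) * ennreal (ly n \<omega>) \<partial>M)"
      unfolding E_def
    proof (rule nn_integral_mono)
      fix \<omega>
      have "(norm (X (n + 1) \<omega> - xbar))\<^sup>2 \<le> K n * ly n \<omega>"
        using norm_le_lyapunov[OF Q] by (simp add: ly_def K_def)
      then show "ennreal ((norm (X (n + 1) \<omega> - xbar))\<^sup>2) \<le> ennreal (K n) * ennreal (ly n \<omega>)"
        using K1[of n] ly_nn by (simp add: ennreal_leI flip: ennreal_mult)
    qed
    also have "\<dots> = ennreal (K n) * a n" by (simp add: nn_integral_cmult a_def)
    finally show ?thesis using K1[of n] a by (simp add: ennreal_mult)
  qed
  have E0: "E 0 \<le> ennreal (A' 0)"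
  proof -
    have "E 0 = (\<integral>\<^sup>+ \<omega>. ennreal ((norm (x1 - xbar))\<^sup>2) \<partial>M)"
      unfolding E_def by (rule nn_integral_cong) (simp add: init(2)[simplified])
    then show ?thesis using a0 a(1)[of 0] by (simp add: emeasure_space_1)
  qed
  define gb where "gb = 1 / (1 - \<alpha>bar)"
  have "\<exists>n\<le>k. enn2real (E n) \<le> 2 * (gb / g 0) * rate ^ k * A' 0 + 2 * (2 * Bc) * gb * (\<Sum>j=1..k. rate ^ (k - j) * p ^ j)"
  proof (rule first_passage_bound[OF rate_bounds p _ G_gt_1])
    show "0 \<le> 2 * Bc" using Bc0 by simp
    show "0 \<le> v" "v \<le> 1" "1 \<le> x" using adm_facts by auto
    show "1 < g 0" using \<alpha>'[of 0] by (simp add: g_def)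
    show "mono g" unfolding g_def using \<alpha>' \<alpha>'_mono by (intro monoI divide_left_mono) (auto intro: mult_pos_pos)
    show "g n \<le> gb" for n unfolding g_def gb_def using \<alpha>'[of n] \<alpha>bar by (intro divide_left_mono) auto
    show "G < x \<Longrightarrow> (x + v) * ln gb \<le> G * (ln 2 + ln gb)" unfolding gb_def by (rule drift_bound)
    show "0 \<le> A' 0" by (rule a)
    show "A' (Suc n) \<le> rate powr G * (g (Suc n) / g n) powr x * A' n + 2 * Bc * p ^ Suc n" for n
    proof -
      have nn: "0 \<le> r n * A' n" "0 \<le> 2 * Bc * p ^ Suc n" using r a(2) Bc0 p by simp_all
      have "ennreal (A' (Suc n)) \<le> ennreal (r n) * ennreal (A' n) + ennreal (2 * Bc * p ^ Suc n)"
        using rec[of n] by (simp only: a(1))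
      also have "\<dots> = ennreal (r n * A' n + 2 * Bc * p ^ Suc n)"
        using nn r a(2) by (simp add: ennreal_plus ennreal_mult del: power_Suc)
      finally show ?thesis unfolding r_def[symmetric] ennreal_le_iff[OF add_nonneg_nonneg[OF nn]] .
    qed
    have lift: "0 \<le> lift_gap (S n) \<kappa> v" for n using adm_facts S(1)[of n] by auto
    show "0 < K n" for n using K1[of n] by simp
    show "ln (K n) \<le> v * ln (g n)" for n
      using lift_factor_bounds(1)[OF less_imp_le[OF S(1)] \<kappa> _ lift] adm_facts by (simp add: K_def Q_def S(2))
    show "K n \<le> 2" for n
      using lift_factor_bounds(2)[OF less_imp_le[OF S(1)] \<kappa> _ lift] adm_facts by (simp add: K_def Q_def)
    show "enn2real (E 0) \<le> A' 0" using E0 a(2) by (intro enn2real_leI)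
    show "enn2real (E n) \<le> K n * A' n" for n using E[of n] K1[of n] a(2)[of n] by (intro enn2real_leI) auto
  qed
  then obtain n where n: "n \<le> k"
    "enn2real (E n) \<le> 2 * (gb / g 0) * rate ^ k * A' 0 + 2 * (2 * Bc) * gb * (\<Sum>j=1..k. rate ^ (k - j) * p ^ j)" by blast
  have "E n = ennreal (enn2real (E n))" using E[of n] by (metis ennreal_enn2real ennreal_less_top le_less_trans)
  also have "\<dots> \<le> ennreal (2 * (gb / g 0) * rate ^ k * A' 0 + 2 * (2 * Bc) * gb * (\<Sum>j=1..k. rate ^ (k - j) * p ^ j))"
    using n(2) by (rule ennreal_leI)
  also have "2 * (gb / g 0) * rate ^ k * A' 0 + 2 * (2 * Bc) * gb * (\<Sum>j=1..k. rate ^ (k - j) * p ^ j)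
      = 2 * (1 - \<alpha> 1) / (1 - \<alpha>bar) * (norm (x1 - xbar))\<^sup>2 * rate ^ k
        + 4 * Bc / (1 - \<alpha>bar) * (\<Sum>j=1..k. rate ^ (k - j) * p ^ j)"
    using a0 a[of 0] by (simp add: g_def gb_def \<alpha>'_def)
  finally show ?thesis using n(1) by (auto simp: E_def)
qed

end

section \<open>Asymptotics for small \<epsilon>\<close>

lemma nat_ceiling_log_bigo:
  fixes c r :: real
  assumes c: "0 < c" and r: "0 < r" "r < 1"
  shows "(\<lambda>\<epsilon>. real (nat \<lceil>ln (c * (1 / \<epsilon>)) / ln (1 / r)\<rceil>)) \<in> O[at_right 0](\<lambda>\<epsilon>. ln (1 / \<epsilon>))"
proof (rule bigoI)
  define \<nu> where "\<nu> = ln (1 / r)"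
  have \<nu>: "0 < \<nu>" using r by (simp add: \<nu>_def)
  show "\<forall>\<^sub>F \<epsilon> in at_right 0. norm (real (nat \<lceil>ln (c * (1 / \<epsilon>)) / ln (1 / r)\<rceil>))
      \<le> ((\<bar>ln c\<bar> + 1) / \<nu> + 1) * norm (ln (1 / \<epsilon>))"
  proof (rule eventually_at_rightI)
    fix \<epsilon> :: real assume e: "\<epsilon> \<in> {0<..<exp (- 1)}"
    then have e0: "0 < \<epsilon>" by simp
    have "ln \<epsilon> < - 1" using e by (metis e0 exp_less_cancel_iff exp_ln greaterThanLessThan_iff)
    then have l1: "1 \<le> ln (1 / \<epsilon>)" using e0 by (simp add: ln_div)
    have "real (nat \<lceil>ln (c * (1 / \<epsilon>)) / \<nu>\<rceil>) \<le> \<bar>ln (c * (1 / \<epsilon>)) / \<nu>\<bar> + 1" by linarith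
    also have "\<bar>ln (c * (1 / \<epsilon>)) / \<nu>\<bar> \<le> (\<bar>ln c\<bar> + ln (1 / \<epsilon>)) / \<nu>"
    proof -
      have "ln (c * (1 / \<epsilon>)) = ln c + ln (1 / \<epsilon>)" using c e0 by (intro ln_mult_pos) auto
      then have "\<bar>ln (c * (1 / \<epsilon>))\<bar> \<le> \<bar>ln c\<bar> + ln (1 / \<epsilon>)" using l1 by linarith
      then show ?thesis using \<nu> by (simp add: divide_right_mono)
    qed
    also have "(\<bar>ln c\<bar> + ln (1 / \<epsilon>)) / \<nu> \<le> (\<bar>ln c\<bar> * ln (1 / \<epsilon>) + ln (1 / \<epsilon>)) / \<nu>"
    proof (rule divide_right_mono)
      have "\<bar>ln c\<bar> * 1 \<le> \<bar>ln c\<bar> * ln (1 / \<epsilon>)" using l1 by (rule mult_left_mono) simp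
      then show "\<bar>ln c\<bar> + ln (1 / \<epsilon>) \<le> \<bar>ln c\<bar> * ln (1 / \<epsilon>) + ln (1 / \<epsilon>)" by simp
    qed (use \<nu> in simp)
    finally have "real (nat \<lceil>ln (c * (1 / \<epsilon>)) / \<nu>\<rceil>) \<le> (\<bar>ln c\<bar> * ln (1 / \<epsilon>) + ln (1 / \<epsilon>)) / \<nu> + ln (1 / \<epsilon>)"
      using l1 by linarith
    also have "\<dots> = ((\<bar>ln c\<bar> + 1) / \<nu> + 1) * ln (1 / \<epsilon>)" using \<nu> by (simp add: field_simps)
    finally show "norm (real (nat \<lceil>ln (c * (1 / \<epsilon>)) / ln (1 / r)\<rceil>)) \<le> ((\<bar>ln c\<bar> + 1) / \<nu> + 1) * norm (ln (1 / \<epsilon>))"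
      using l1 by (simp add: \<nu>_def)
  qed simp
qed

lemma geometric_batches_bigo:
  fixes c r p :: real and bs :: "nat \<Rightarrow> nat"
  assumes c: "0 < c" and r: "0 < r" "r < 1" and p: "0 < p" "p < 1"
    and bs: "\<And>k. 1 \<le> k \<Longrightarrow> real (bs k) \<le> (1 / p) ^ k"
  shows "(\<lambda>\<epsilon>. real (2 * (\<Sum>i=1..nat \<lceil>ln (c * (1 / \<epsilon>)) / ln (1 / r)\<rceil>. bs i)))
      \<in> O[at_right 0](\<lambda>\<epsilon>. (1 / \<epsilon>) powr (ln p / ln r))"
proof (rule bigoI)
  define \<nu> where "\<nu> = ln (1 / r)"
  have \<nu>: "0 < \<nu>" using r by (simp add: \<nu>_def)
  have e: "ln p / ln r = ln (1 / p) / \<nu>" using p r by (simp add: \<nu>_def ln_div)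
  show "\<forall>\<^sub>F \<epsilon> in at_right 0. norm (real (2 * (\<Sum>i=1..nat \<lceil>ln (c * (1 / \<epsilon>)) / ln (1 / r)\<rceil>. bs i)))
      \<le> (2 / (1 - p) * (c powr (ln p / ln r) / p)) * norm ((1 / \<epsilon>) powr (ln p / ln r))"
  proof (rule eventually_at_rightI)
    fix \<epsilon> :: real assume "\<epsilon> \<in> {0<..<c}"
    then have \<epsilon>: "0 < \<epsilon>" "1 < c * (1 / \<epsilon>)" by auto
    define N S where "N = nat \<lceil>ln (c * (1 / \<epsilon>)) / \<nu>\<rceil>" and "S = (\<Sum>i=1..N. bs i)"
    have "0 \<le> ln (c * (1 / \<epsilon>)) / \<nu>" using \<epsilon> \<nu> by simp
    then have N: "real N \<le> ln (c * (1 / \<epsilon>)) / \<nu> + 1" unfolding N_def by linarith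
    have "real S \<le> (\<Sum>i=1..N. (1 / p) ^ i)"
      unfolding S_def of_nat_sum by (intro sum_mono bs) auto
    also have "\<dots> \<le> (1 / p) ^ N / (1 - p)"
    proof -
      \<comment> \<open>Read as a convolution of the bases 1 and \<open>1 / p\<close>, so that the
        last batch dominates the sum.\<close>
      have "(\<Sum>i=1..N. (1 / p) ^ i) = (\<Sum>i=1..N. 1 ^ (N - i) * (1 / p) ^ i)" by simp
      also have "\<dots> \<le> (1 / p) ^ N / (1 - 1 / (1 / p))"
        by (rule convolution_geometric_le(2)) (use p in auto)
      finally show ?thesis by simp
    qed
    also have "(1 / p) ^ N \<le> (1 / p) powr (ln (c * (1 / \<epsilon>)) / \<nu> + 1)"
      using N p by (simp add: powr_realpow[symmetric] powr_mono)
    also have "\<dots> = c powr (ln p / ln r) / p * (1 / \<epsilon>) powr (ln p / ln r)"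
    proof -
      have "(1 / p) powr (ln (c * (1 / \<epsilon>)) / \<nu>) = (c * (1 / \<epsilon>)) powr (ln (1 / p) / \<nu>)"
        using p \<epsilon> c by (simp add: powr_def)
      also have "\<dots> = c powr (ln (1 / p) / \<nu>) * (1 / \<epsilon>) powr (ln (1 / p) / \<nu>)"
        using c \<epsilon> by (intro powr_mult)
      finally show ?thesis using p unfolding e by (simp add: powr_add)
    qed
    finally have "real S \<le> c powr (ln p / ln r) / p * (1 / \<epsilon>) powr (ln p / ln r) / (1 - p)"
      using p by (simp add: divide_right_mono)
    then show "norm (real (2 * (\<Sum>i=1..nat \<lceil>ln (c * (1 / \<epsilon>)) / ln (1 / r)\<rceil>. bs i)))
      \<le> (2 / (1 - p) * (c powr (ln p / ln r) / p)) * norm ((1 / \<epsilon>) powr (ln p / ln r))"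
      unfolding \<nu>_def[symmetric] N_def[symmetric] S_def[symmetric] by (simp add: mult_ac)
  qed (use c in simp)
qed

lemma power_ceiling_log_le:
  fixes c r \<epsilon> :: real
  assumes c: "0 < c" and r: "0 < r" "r < 1" and \<epsilon>: "0 < \<epsilon>"
  shows "c * r ^ nat \<lceil>ln (c * (1 / \<epsilon>)) / ln (1 / r)\<rceil> \<le> \<epsilon>"
proof -
  define N where "N = nat \<lceil>ln (c * (1 / \<epsilon>)) / ln (1 / r)\<rceil>"
  have "ln (c * (1 / \<epsilon>)) / ln (1 / r) \<le> real N" unfolding N_def by linarith
  then have "ln (c / \<epsilon>) \<le> real N * ln (1 / r)" using r by (simp add: divide_le_eq)
  then have "c / \<epsilon> \<le> exp (real N * ln (1 / r))" using c \<epsilon> by (metis divide_pos_pos exp_le_cancel_iff exp_ln)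
  also have "\<dots> = (1 / r) ^ N" using r by (simp add: exp_of_nat_mult)
  finally show ?thesis unfolding N_def[symmetric] using r \<epsilon> by (simp add: field_simps power_one_over)
qed

section \<open>Assembly\<close>

theorem proposition4p9:
  fixes T :: "'h::{real_inner, banach, second_countable_topology} \<Rightarrow> 'h set"
    and V :: "'h \<Rightarrow> 'h" and xbar x0 x1 :: 'h
    and M :: "'w measure" and \<Xi> :: "(real ^ 'd) set" and P :: "(real ^ 'd) measure"
    and Vhat :: "'h \<Rightarrow> real ^ 'd \<Rightarrow> 'h"
    and \<xi> \<eta> :: "nat \<Rightarrow> nat \<Rightarrow> 'w \<Rightarrow> real ^ 'd"
    and X Y Z A B U W :: "nat \<Rightarrow> 'w \<Rightarrow> 'h"
    and \<alpha> \<rho>s :: "nat \<Rightarrow> real" and m :: "nat \<Rightarrow> nat"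
    and L \<mu> s a b Lt lam \<eta>c \<alpha>bar \<rho> q \<rho>bar Bc p phat C Chat \<delta> :: real
    and K :: "real \<Rightarrow> enat" and \<tau> :: "real \<Rightarrow> nat"
  assumes T: "maximally_monotone T"
    and V: "maximally_monotone (\<lambda>x. {V x})" "L-lipschitz_on UNIV V" "L > 0"
    and xbar: "xbar \<in> op_zeros (op_sum T V)"
    and strong: "\<mu> > 0" "strongly_monotone \<mu> V"
    and M: "prob_space M" "complete_measure M"
    and Vhat: "stochastic_oracle \<Xi> P Vhat"
    and samples: "iid_samples M P m \<xi> \<eta>"
    and process: "RISFBF M T Vhat \<alpha> \<rho>s (\<lambda>_. lam) m \<xi> \<eta> x0 x1 X Y Z A B"
    and init: "x0 = x1"
    and U: "\<And>k \<omega>. U k \<omega> = A k \<omega> - V (Z k \<omega>)"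
    and W: "\<And>k \<omega>. W k \<omega> = B k \<omega> - V (Y k \<omega>)"
    and s: "s > 0"
    and U_bound: "\<And>k. k \<ge> 1 \<Longrightarrow> AE \<omega> in M.
        nn_cond_exp M (RISFBF_filtration M P m \<xi> \<eta> X k)
          (\<lambda>\<omega>. ennreal ((norm (U k \<omega>))\<^sup>2)) \<omega> \<le> ennreal (s\<^sup>2 / real (m k))"
    and W_bound: "\<And>k. k \<ge> 1 \<Longrightarrow> AE \<omega> in M.
        nn_cond_exp M (RISFBF_filtration M P m \<xi> \<eta> X k)
          (\<lambda>\<omega>. ennreal ((norm (W k \<omega>))\<^sup>2)) \<omega> \<le> ennreal (s\<^sup>2 / real (m k))"
    and ab: "0 < a" "a < 1" "0 < b" "b < 1"
    and Lt: "Lt\<^sup>2 = L\<^sup>2 + 1 / 2" "Lt > 0"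
    and lam: "0 < lam" "lam \<le> Min {a / (2 * \<mu>), b * \<mu>, (1 - a) / (2 * Lt)}"
    and \<eta>c: "\<eta>c = (1 - b) * lam * \<mu>"
    and \<alpha>: "\<And>j k. 1 \<le> j \<Longrightarrow> j \<le> k \<Longrightarrow> \<alpha> j \<le> \<alpha> k"
      "\<And>k. k \<ge> 1 \<Longrightarrow> 0 < \<alpha> k \<and> \<alpha> k \<le> \<alpha>bar" "\<alpha>bar < 1"
    and \<rho>s: "\<And>k. k \<ge> 1 \<Longrightarrow>
        \<rho>s k = (3 - a) * (1 - \<alpha> k)\<^sup>2 / (2 * (2 * (\<alpha> k)\<^sup>2 - 0.5 * \<alpha> k + 1) * (1 + Lt * lam))"
    and \<rho>: "\<rho> = 16 * (3 - a) * (1 - \<alpha>bar)\<^sup>2 / (31 * (1 + Lt * lam))"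
    and q: "q = 1 - \<rho> * \<eta>c"
    and \<rho>bar: "\<rho>bar = (3 - a) / (2 * (1 + Lt * lam))"
    and Bc: "Bc = 2 * \<rho>bar * s\<^sup>2 * (1 + 2 * (3 - a) * lam\<^sup>2 / (1 + Lt * lam))"
    and p: "0 < p" "p < 1"
    and m: "\<And>k. k \<ge> 1 \<Longrightarrow> m k = nat \<lfloor>p powi (- int k)\<rfloor>"
    and phat: "p < phat" "phat < 1"
    and C: "C = 2 * (1 - \<alpha> 1) / (1 - \<alpha>bar) * (norm (x1 - xbar))\<^sup>2
                + 4 * Bc / ((1 - \<alpha>bar) * (1 - min (p / q) (q / p)))"
    and Chat: "Chat = 2 * (1 - \<alpha> 1) / (1 - \<alpha>bar) * (norm (x1 - xbar))\<^sup>2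
                + 4 * Bc / ((1 - \<alpha>bar) * exp 1 * ln (phat / q))"
    and K: "\<And>\<epsilon>. K \<epsilon> = hitting_index M X xbar \<epsilon>"
    and \<tau>: "\<And>\<epsilon>. \<tau> \<epsilon> = (if p \<noteq> q then nat \<lceil>ln (C * (1 / \<epsilon>)) / ln (1 / max p q)\<rceil>
                            else nat \<lceil>ln (Chat * (1 / \<epsilon>)) / ln (1 / phat)\<rceil>)"
    and \<delta>: "\<delta> = (if p > q then 0
                  else if p < q then ln p / ln q - 1
                  else ln p / ln phat - 1)"
  shows "op_zeros (op_sum T V) = {xbar} \<and> 0 < q \<and> q < 1 \<and>
    (\<forall>\<epsilon>>0. K \<epsilon> \<le> enat (\<tau> \<epsilon>)) \<and>
    (\<lambda>\<epsilon>. real (\<tau> \<epsilon>)) \<in> O[at_right 0](\<lambda>\<epsilon>. ln (1 / \<epsilon>)) \<and>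
    (\<forall>\<epsilon>>0. 2 * (\<Sum>i = 1..the_enat (K \<epsilon>). m i) \<le> 2 * (\<Sum>i = 1..\<tau> \<epsilon>. m i)) \<and>
    (\<lambda>\<epsilon>. real (2 * (\<Sum>i = 1..\<tau> \<epsilon>. m i))) \<in> O[at_right 0](\<lambda>\<epsilon>. (1 / \<epsilon>) powr (1 + \<delta>))"
proof -
  have lam1: "lam \<le> a / (2 * \<mu>)" "lam \<le> b * \<mu>" "lam \<le> (1 - a) / (2 * Lt)" using lam(2) by simp_all
  have T': "monotone_operator T" using T by (simp add: maximally_monotone_def)
  have zeros_iff: "y \<in> op_zeros (op_sum T V) \<longleftrightarrow> - V y \<in> T y" for y
  proof -
    have "0 = u + V y \<longleftrightarrow> u = - V y" for u by (metis eq_neg_iff_add_eq_0)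
    then show ?thesis by (simp add: op_zeros_def op_sum_def)
  qed
  have zero: "- V xbar \<in> T xbar" using xbar zeros_iff by blast
  have zeros: "op_zeros (op_sum T V) = {xbar}"
  proof (intro equalityI subsetI)
    fix y assume "y \<in> op_zeros (op_sum T V)"
    then have "- V y \<in> T y" using zeros_iff by blast
    then have "0 \<le> inner (- V y - - V xbar) (y - xbar)"
      using T' zero unfolding monotone_operator_def by blast
    moreover have "\<mu> * (norm (y - xbar))\<^sup>2 \<le> inner (V y - V xbar) (y - xbar)"
      using strong(2) by (simp add: strongly_monotone_def)
    ultimately have "\<mu> * (norm (y - xbar))\<^sup>2 \<le> 0" by (simp add: inner_simps)
    then show "y \<in> {xbar}" using strong(1) by (simp add: mult_le_0_iff)
  qed (use xbar in simp)
  have \<alpha>bar: "0 < \<alpha>bar" using \<alpha>(2)[of 1] by simp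
  define t where "t = Lt * lam"
  have t: "0 < t" using Lt lam by (simp add: t_def)
  have q_bounds: "0 < q" "q < 1"
  proof -
    define e where "e = (1 - b) * (lam * \<mu>)"
    have "lam * \<mu> \<le> a / 2" using lam1(1) strong(1) by (simp add: field_simps)
    then have "e \<le> 1 * (1/2)" unfolding e_def using ab lam(1) strong(1) by (intro mult_mono) auto
    moreover have "0 < e" unfolding e_def using ab lam(1) strong(1) by simp
    moreover have "\<rho> \<le> 48/31"
    proof -
      have "(3 - a) * (1 - \<alpha>bar)\<^sup>2 \<le> 3 * 1"
        using ab \<alpha>(3) \<alpha>bar by (intro mult_mono power_le_one) auto
      moreover have "16 * x \<le> 48 * (1 + t)" if "x \<le> 3 * 1" for x using that t by simp
      ultimately have "16 * ((3 - a) * (1 - \<alpha>bar)\<^sup>2) \<le> 48 * (1 + t)" by blast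
      then have "16 * (3 - a) * (1 - \<alpha>bar)\<^sup>2 \<le> 48 * (1 + t)" by (simp only: mult.assoc)
      then show ?thesis unfolding \<rho> t_def[symmetric] using t by (simp add: divide_le_eq)
    qed
    moreover have "0 < \<rho>" unfolding \<rho> using ab \<alpha>(3) t by (simp add: t_def)
    ultimately have "\<rho> * e \<le> 48/31 * (1/2)" "0 < \<rho> * e"
      using mult_mono[of \<rho> "48/31" e "1/2"] by simp_all
    moreover have "q = 1 - \<rho> * e" by (simp add: q \<eta>c e_def)
    ultimately show "0 < q" "q < 1" by simp_all
  qed
  have batch: "1 / real (m k) \<le> 2 * p ^ k" "real (m k) \<le> (1 / p) ^ k" if "1 \<le> k" for k
    using floor_batch_bounds[OF p, of "m k" k] m[of k] that by auto
  have \<rho>bar1: "0 < \<rho>bar" unfolding \<rho>bar using ab t by (simp add: t_def)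
  have "0 < 1 + 2 * (3 - a) * lam\<^sup>2 / (1 + Lt * lam)"
    using ab t by (intro add_pos_nonneg) (auto simp: t_def)
  then have Bc0: "0 < Bc" unfolding Bc using \<rho>bar1 s by simp
  define D where "D = 2 * (1 - \<alpha> 1) / (1 - \<alpha>bar) * (norm (x1 - xbar))\<^sup>2"
  have D0: "0 \<le> D" unfolding D_def using \<alpha>(2)[of 1] \<alpha>(3) by simp
  define N where "N = 4 * Bc / (1 - \<alpha>bar)"
  have N0: "0 < N" unfolding N_def using Bc0 \<alpha>(3) by simp
  have passage: "\<exists>n\<le>k. (\<integral>\<^sup>+ \<omega>. ennreal ((norm (X (n + 1) \<omega> - xbar))\<^sup>2) \<partial>M)
      \<le> ennreal (D * q ^ k + N * (\<Sum>j=1..k. q ^ (k - j) * p ^ j))" for k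
  \<comment> \<open>\<open>\<mu> \<le> L\<close> follows only if the space has two distinct points;
    otherwise every iterate equals \<open>xbar\<close>.\<close>
  proof (cases "\<exists>x y :: 'h. x \<noteq> y")
    case False
    then have "X (0 + 1) \<omega> - xbar = 0" for \<omega> by (metis right_minus_eq)
    then show ?thesis by (intro exI[of _ 0]) simp
  next
    case True
    then obtain x y :: 'h where xy: "x \<noteq> y" by blast
    have "\<mu> * (norm (x - y))\<^sup>2 \<le> inner (V x - V y) (x - y)"
      using strong(2) by (simp add: strongly_monotone_def)
    also have "\<dots> \<le> norm (V x - V y) * norm (x - y)" by (rule norm_cauchy_schwarz)
    also have "\<dots> \<le> L * norm (x - y) * norm (x - y)"
      using lipschitz_onD[OF V(2), of x y] by (intro mult_right_mono) (auto simp: dist_norm)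
    finally have "\<mu> * (norm (x - y))\<^sup>2 \<le> L * (norm (x - y))\<^sup>2" by (simp add: power2_eq_square)
    then have \<mu>L: "\<mu> \<le> L" using xy by simp
    have Ll: "L \<le> Lt"
    proof (rule power2_le_imp_le)
      show "L\<^sup>2 \<le> Lt\<^sup>2" unfolding Lt(1) by simp
    qed (use Lt(2) in simp)
    have "lam * \<mu> \<le> a / 2" using lam1(1) strong(1) by (simp add: field_simps)
    moreover have "lam * Lt \<le> (1 - a) / 2" using lam1(3) Lt(2) by (simp add: field_simps)
    moreover have "lam * \<mu> \<le> lam * Lt" using \<mu>L Ll lam(1) by (intro mult_left_mono) auto
    moreover have "e \<le> 1/4" if "e \<le> a / 2" "f \<le> (1 - a) / 2" "e \<le> f" for e f using that by simp
    ultimately have "lam * \<mu> \<le> 1/4" by blast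
    moreover have "0 \<le> lam * \<mu>" using lam(1) strong(1) by simp
    ultimately obtain \<sigma>0 \<kappa> d x v y0 \<theta> where adm: "admissible (lam * \<mu>) \<sigma>0 \<kappa> d x v y0 \<theta>"
      using admissible_exists by blast
    interpret S: risfbf_setting T V xbar L \<mu> a b Lt lam \<alpha>bar \<sigma>0 \<kappa> d x v y0 \<theta>
      by unfold_locales (fact T' zero V strong \<mu>L ab Lt lam lam1 \<alpha>bar \<alpha>(3) adm)+
    have proc: "Z k \<omega> = X k \<omega> + \<alpha> k *\<^sub>R (X k \<omega> - X (k - 1) \<omega>)"
      "Y k \<omega> \<in> resolvent lam T (Z k \<omega> - lam *\<^sub>R A k \<omega>)"
      "X (k + 1) \<omega> = (1 - \<rho>s k) *\<^sub>R Z k \<omega> + \<rho>s k *\<^sub>R (Y k \<omega> + lam *\<^sub>R (A k \<omega> - B k \<omega>))"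
      if "\<omega> \<in> space M" "1 \<le> k" for k \<omega>
      using process that unfolding RISFBF_def by blast+
    have X01: "X 0 \<omega> = x1" "X 1 \<omega> = x1" if "\<omega> \<in> space M" for \<omega>
      using process that init by (auto simp: RISFBF_def)
    note meas = RISFBF_measurable[OF process T' Vhat samples]
    have Vm: "V \<in> borel_measurable borel"
      by (rule borel_measurable_continuous_onI, rule lipschitz_on_continuous_on[OF V(2)])
    have Um: "U k \<in> borel_measurable M" and Wm: "W k \<in> borel_measurable M" if "1 \<le> k" for k
    proof -
      have "U k = (\<lambda>\<omega>. A k \<omega> - V (Z k \<omega>))" "W k = (\<lambda>\<omega>. B k \<omega> - V (Y k \<omega>))" by (auto simp: U W)
      then show "U k \<in> borel_measurable M" "W k \<in> borel_measurable M"
        using meas(2-5)[OF that] by (auto intro!: borel_measurable_diff measurable_compose[OF _ Vm])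
    qed
    have sub: "subalgebra M (RISFBF_filtration M P m \<xi> \<eta> X k)" for k
      by (rule subalgebra_RISFBF_filtration[OF meas(1) samples])
    have bounds: "(\<integral>\<^sup>+ \<omega>. ennreal ((norm (U k \<omega>))\<^sup>2) \<partial>M) \<le> ennreal (s\<^sup>2 / real (m k))"
      "(\<integral>\<^sup>+ \<omega>. ennreal ((norm (W k \<omega>))\<^sup>2) \<partial>M) \<le> ennreal (s\<^sup>2 / real (m k))" if "1 \<le> k" for k
    proof -
      have [measurable]: "U k \<in> borel_measurable M" "W k \<in> borel_measurable M" using Um Wm that by auto
      show "(\<integral>\<^sup>+ \<omega>. ennreal ((norm (U k \<omega>))\<^sup>2) \<partial>M) \<le> ennreal (s\<^sup>2 / real (m k))"
        by (rule prob_space.nn_integral_le_of_nn_cond_exp_le[OF M(1) sub _ U_bound[OF that]]) measurable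
      show "(\<integral>\<^sup>+ \<omega>. ennreal ((norm (W k \<omega>))\<^sup>2) \<partial>M) \<le> ennreal (s\<^sup>2 / real (m k))"
        by (rule prob_space.nn_integral_le_of_nn_cond_exp_le[OF M(1) sub _ W_bound[OF that]]) measurable
    qed
    have \<rho>eq: "S.\<rho>b = \<rho>bar" by (simp add: S.\<rho>b_def \<rho>bar)
    have rate_q: "S.rate = q"
    proof -
      have "\<rho> = 32/31 * S.\<rho>b * (1 - \<alpha>bar)\<^sup>2" using t by (simp add: \<rho> S.\<rho>b_def t_def field_simps)
      then show ?thesis by (simp add: S.rate_def q \<eta>c S.m_def mult.assoc)
    qed
    have \<rho>k: "\<rho>s k = S.\<rho>b * (1 - \<alpha> k)\<^sup>2 / S.den (\<alpha> k)" if "1 \<le> k" for k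
    proof -
      have "2 * (\<alpha> k)\<^sup>2 - 0.5 * \<alpha> k + 1 = S.den (\<alpha> k)" by (simp add: S.den_def)
      then show ?thesis unfolding \<rho>s[OF that] S.\<rho>b_def by (simp add: mult_ac)
    qed
    have Bc_eq: "Bc = 2 * S.\<rho>b * s\<^sup>2 * (1 + 4 * S.\<rho>b * lam\<^sup>2)"
    proof -
      have "4 * \<rho>bar * lam\<^sup>2 = 2 * (3 - a) * lam\<^sup>2 / (1 + Lt * lam)"
        unfolding \<rho>bar t_def[symmetric] using t by (simp add: field_simps)
      then show ?thesis by (simp only: Bc \<rho>eq)
    qed
    show ?thesis
      using S.expected_first_passage[OF \<alpha>(1,2) \<rho>k p(1) batch(1) M(1) meas(1) Um Wm X01 proc U W bounds Bc_eq]
      unfolding rate_q D_def N_def .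
  qed
  \<comment> \<open>\<open>r\<close> and \<open>c\<close> merge the cases \<open>p = q\<close> and
    \<open>p \<noteq> q\<close> into one bound \<open>c * r ^ k\<close>.\<close>
  define r c where "r = (if p = q then phat else max p q)" and "c = (if p = q then Chat else C)"
  have r: "0 < r" "r < 1" using p phat q_bounds by (auto simp: r_def)
  have \<tau>': "\<tau> \<epsilon> = nat \<lceil>ln (c * (1 / \<epsilon>)) / ln (1 / r)\<rceil>" for \<epsilon> by (simp add: \<tau> r_def c_def)
  have conv: "D * q ^ k + N * (\<Sum>j=1..k. q ^ (k - j) * p ^ j) \<le> c * r ^ k \<and> 0 < c" for k
  proof -
    have det: "D * q ^ k \<le> D * r ^ k"
      using q_bounds p phat D0 by (intro mult_left_mono power_mono) (auto simp: r_def)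
    consider "p = q" | "p < q" | "q < p" by linarith
    then show ?thesis
    proof cases
      case 1
      have l: "0 < ln (phat / q)" using phat(1) q_bounds 1 by simp
      have "N * (\<Sum>j=1..k. q ^ (k - j) * p ^ j) \<le> N * (phat ^ k / (exp 1 * ln (phat / q)))"
        using convolution_geometric_eq_le[of q phat k] q_bounds phat(1) N0 1 by (intro mult_left_mono) auto
      moreover have c: "c = D + N / (exp 1 * ln (phat / q))"
        using 1 by (simp add: c_def Chat D_def N_def)
      moreover have "0 < N / (exp 1 * ln (phat / q))" using N0 l by simp
      ultimately show ?thesis using det D0 1 by (auto simp: r_def algebra_simps)
    next
      case 2
      have "min (p / q) (q / p) = p / q" using 2 p q_bounds by (simp add: min_def divide_simps) (smt (verit) mult_mono)
      then have c: "c = D + N / (1 - p / q)" using 2 by (simp add: c_def C D_def N_def)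
      have "N * (\<Sum>j=1..k. q ^ (k - j) * p ^ j) \<le> N * (q ^ k / (1 - p / q))"
        using convolution_geometric_le(1)[of p q k] p 2 N0 by (intro mult_left_mono) auto
      moreover have "0 < N / (1 - p / q)" using N0 2 q_bounds by simp
      ultimately show ?thesis using det D0 2 unfolding c by (auto simp: r_def max_def algebra_simps)
    next
      case 3
      have "min (p / q) (q / p) = q / p" using 3 p q_bounds by (simp add: min_def divide_simps) (smt (verit) mult_mono)
      then have c: "c = D + N / (1 - q / p)" using 3 by (simp add: c_def C D_def N_def)
      have "N * (\<Sum>j=1..k. q ^ (k - j) * p ^ j) \<le> N * (p ^ k / (1 - q / p))"
        using convolution_geometric_le(2)[of q p k] q_bounds 3 N0 by (intro mult_left_mono) auto
      moreover have "0 < N / (1 - q / p)" using N0 3 p by simp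
      ultimately show ?thesis using det D0 3 unfolding c by (auto simp: r_def max_def algebra_simps)
    qed
  qed
  have c: "0 < c" using conv by blast
  have hit: "K \<epsilon> \<le> enat (\<tau> \<epsilon>)" if \<epsilon>: "0 < \<epsilon>" for \<epsilon>
  proof -
    obtain n where n: "n \<le> \<tau> \<epsilon>" "(\<integral>\<^sup>+ \<omega>. ennreal ((norm (X (n + 1) \<omega> - xbar))\<^sup>2) \<partial>M)
      \<le> ennreal (D * q ^ \<tau> \<epsilon> + N * (\<Sum>j=1..\<tau> \<epsilon>. q ^ (\<tau> \<epsilon> - j) * p ^ j))"
      using passage by blast
    have "D * q ^ \<tau> \<epsilon> + N * (\<Sum>j=1..\<tau> \<epsilon>. q ^ (\<tau> \<epsilon> - j) * p ^ j) \<le> c * r ^ \<tau> \<epsilon>" using conv by blast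
    also have "\<dots> \<le> \<epsilon>" unfolding \<tau>' by (rule power_ceiling_log_le[OF c r \<epsilon>])
    finally have "(\<integral>\<^sup>+ \<omega>. ennreal ((norm (X (n + 1) \<omega> - xbar))\<^sup>2) \<partial>M) \<le> ennreal \<epsilon>"
      using n(2) by (meson ennreal_leI order_trans)
    then have "K \<epsilon> \<le> enat n" unfolding K hitting_index_def by (intro INF_lower) simp
    then show ?thesis using n(1) by (meson enat_ord_simps(1) order_trans)
  qed
  \<comment> \<open>For \<open>p > q\<close> one has \<open>r = p\<close>, so the quotient is 1 and
    the exponent is optimal in this scheme.\<close>
  have \<delta>': "1 + \<delta> = ln p / ln r"
    using p by (auto simp: \<delta> r_def max_def)
  have "(\<lambda>\<epsilon>. real (\<tau> \<epsilon>)) \<in> O[at_right 0](\<lambda>\<epsilon>. ln (1 / \<epsilon>))"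
    unfolding \<tau>' by (rule nat_ceiling_log_bigo[OF c r])
  moreover have "(\<lambda>\<epsilon>. real (2 * (\<Sum>i = 1..\<tau> \<epsilon>. m i))) \<in> O[at_right 0](\<lambda>\<epsilon>. (1 / \<epsilon>) powr (1 + \<delta>))"
    unfolding \<tau>' \<delta>' by (rule geometric_batches_bigo[OF c r p batch(2)])
  moreover have "2 * (\<Sum>i = 1..the_enat (K \<epsilon>). m i) \<le> 2 * (\<Sum>i = 1..\<tau> \<epsilon>. m i)" if \<epsilon>: "0 < \<epsilon>" for \<epsilon>
  proof -
    \<comment> \<open>\<open>K \<epsilon>\<close> is finite by \<open>hit\<close>, so
      \<open>the_enat\<close> returns the index itself.\<close>
    obtain k where "K \<epsilon> = enat k" "k \<le> \<tau> \<epsilon>"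
      using hit[OF \<epsilon>] by (metis enat_ile enat_ord_simps(1))
    then show ?thesis by (auto intro!: sum_mono2)
  qed
  ultimately show ?thesis using zeros q_bounds hit by blast
qed

end
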